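(* For every integer $d\ge 3$ there is a polynomial $P\in\mathbb{C}[z_1,\dots,z_d]$, $P\neq 0$, such that the Euler operator $P(\theta):\mathscr{D}'(\mathbb{R}^d)\to\mathscr{D}'(\mathbb{R}^d)$ is not surjective.
   Context: $\mathscr{D}'(\mathbb{R}^d)$ is the space of all Schwartz distributions on $\mathbb{R}^d$. Put $\theta_j=x_j\,\partial/\partial x_j$ for $j=1,\dots,d$ and $\theta^\alpha=\theta_1^{\alpha_1}\cdots\theta_d^{\alpha_d}$ for $\alpha\in\mathbb{N}_0^d$. For a polynomial $P(z)=\sum_\alpha c_\alpha z^\alpha$ with complex coefficients, the Euler operator is $P(\theta)=\sum_\alpha c_\alpha\theta^\alpha$, a linear differential operator with polynomial coefficients acting on distributions in the usual sense. *)

theory Defs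
  imports "HOL-Analysis.Analysis" "HOL-Library.Poly_Mapping"
begin

section \<open>Partial derivatives and smooth functions\<close>

definition partial :: "'n::finite \<Rightarrow> (real ^ 'n \<Rightarrow> complex) \<Rightarrow> real ^ 'n \<Rightarrow> complex" where
  "partial i f x = frechet_derivative f (at x) (axis i 1)"

text \<open>
  Higher derivatives are indexed by words in the coordinates. On smooth functions the order of
  the letters is irrelevant (see \<open>partial_commute\<close>), so the words of length at most \<open>N\<close> give
  exactly the derivatives of multi-index order at most \<open>N\<close>.
\<close>

definition partials :: "'n::finite list \<Rightarrow> (real ^ 'n \<Rightarrow> complex) \<Rightarrow> real ^ 'n \<Rightarrow> complex" where
  "partials is f = foldr partial is f"

definition smooth :: "(real ^ 'n::finite \<Rightarrow> complex) \<Rightarrow> bool" where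
  "smooth f \<longleftrightarrow> (\<forall>is x. partials is f differentiable at x)"

lemma partials_Nil [simp]: "partials [] f = f"
  and partials_Cons [simp]: "partials (i # is) f = partial i (partials is f)"
  by (simp_all add: partials_def)

lemma partials_append: "partials (is @ js) f = partials is (partials js f)"
  by (simp add: partials_def)

lemma smoothD: "smooth f \<Longrightarrow> partials is f differentiable at x"
  by (simp add: smooth_def)

lemma smooth_differentiable: "smooth f \<Longrightarrow> f differentiable at x"
  using smoothD[of f "[]"] by simp

lemma smooth_partials: "smooth f \<Longrightarrow> smooth (partials is f)"
  by (simp add: smooth_def flip: partials_append)

lemma smooth_partial: "smooth f \<Longrightarrow> smooth (partial i f)"
  using smooth_partials[of f "[i]"] by simp

lemma partial_has_derivative:
  "f differentiable at x \<Longrightarrow> (f has_derivative frechet_derivative f (at x)) (at x)"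
  by (simp add: frechet_derivative_works)

lemma partialI: "(f has_derivative f') (at x) \<Longrightarrow> partial i f x = f' (axis i 1)"
  by (metis frechet_derivative_at partial_def)

lemma partial_add:
  assumes "\<And>x. f differentiable at x" "\<And>x. g differentiable at x"
  shows "partial i (\<lambda>x. f x + g x) = (\<lambda>x. partial i f x + partial i g x)"
proof
  fix x
  have "((\<lambda>x. f x + g x) has_derivative
      (\<lambda>h. frechet_derivative f (at x) h + frechet_derivative g (at x) h)) (at x)"
    by (intro has_derivative_add partial_has_derivative assms)
  then show "partial i (\<lambda>x. f x + g x) x = partial i f x + partial i g x"
    by (subst partialI) (auto simp: partial_def)
qed

lemma partial_cmult:
  assumes "\<And>x. f differentiable at x"
  shows "partial i (\<lambda>x. c * f x) = (\<lambda>x. c * partial i f x)"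
proof
  fix x
  have "((\<lambda>x. c * f x) has_derivative (\<lambda>h. c * frechet_derivative f (at x) h)) (at x)"
    by (intro has_derivative_mult_right partial_has_derivative assms)
  then show "partial i (\<lambda>x. c * f x) x = c * partial i f x"
    by (subst partialI) (auto simp: partial_def)
qed

lemma coord_has_derivative:
  "((\<lambda>x::real ^ 'n::finite. complex_of_real (x $ i)) has_derivative
     (\<lambda>h. complex_of_real (h $ i))) (at x)"
  by (intro bounded_linear_imp_has_derivative bounded_linear_compose[OF bounded_linear_of_real]
      bounded_linear_vec_nth)

lemma coord_mult_has_derivative:
  assumes "f differentiable at x"
  shows "((\<lambda>x. complex_of_real (x $ i) * f x) has_derivative
    (\<lambda>h. complex_of_real (x $ i) * frechet_derivative f (at x) h
       + complex_of_real (h $ i) * f x)) (at x)"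
  using has_derivative_mult[OF coord_has_derivative partial_has_derivative[OF assms]] by simp

lemma partial_coord_mult:
  assumes "\<And>x. f differentiable at x"
  shows "partial j (\<lambda>x. complex_of_real (x $ i) * f x) =
    (\<lambda>x. complex_of_real (x $ i) * partial j f x + (if i = j then f x else 0))"
  by (rule ext, subst partialI[OF coord_mult_has_derivative[OF assms]])
     (auto simp: partial_def axis_def)

lemma partials_zero: "partials is (\<lambda>x. 0) = (\<lambda>x. 0)"
proof (induction "is")
  case (Cons i "is")
  have "partial i (\<lambda>x. 0) x = 0" for x :: "real ^ 'a"
    by (subst partialI[OF has_derivative_const]) simp
  then show ?case using Cons by auto
qed simp

lemma smooth_zero: "smooth (\<lambda>x. 0)"
  by (simp add: smooth_def partials_zero)

lemma partials_add:
  assumes "smooth f" "smooth g"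
  shows "partials is (\<lambda>x. f x + g x) = (\<lambda>x. partials is f x + partials is g x)"
  by (induction "is") (simp_all add: partial_add smoothD assms)

lemma partials_cmult:
  assumes "smooth f"
  shows "partials is (\<lambda>x. c * f x) = (\<lambda>x. c * partials is f x)"
  by (induction "is") (simp_all add: partial_cmult smoothD assms)

lemma smooth_add: "smooth f \<Longrightarrow> smooth g \<Longrightarrow> smooth (\<lambda>x. f x + g x)"
  unfolding smooth_def[of "\<lambda>x. f x + g x"]
  by (simp add: partials_add) (intro allI differentiable_add smoothD)

lemma smooth_cmult: "smooth f \<Longrightarrow> smooth (\<lambda>x. c * f x)"
  unfolding smooth_def[of "\<lambda>x. c * f x"]
  by (simp add: partials_cmult smoothD)

lemma sum_list_differentiable:
  assumes "smooth f"
  shows "(\<lambda>x. \<Sum>w\<leftarrow>ws. partials w f x) differentiable at x"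
  by (induction ws) (auto intro!: differentiable_add smoothD assms)

lemma partial_sum_list:
  assumes "smooth f"
  shows "partial j (\<lambda>x. \<Sum>w\<leftarrow>ws. partials w f x) = (\<lambda>x. \<Sum>w\<leftarrow>map ((#) j) ws. partials w f x)"
proof (induction ws)
  case Nil
  show ?case using partials_zero[of "[j]"] by simp
next
  case (Cons w ws)
  then show ?case
    by (simp add: partial_add sum_list_differentiable smoothD assms)
qed

lemma partials_coord_mult:
  "\<exists>ws. (\<forall>w\<in>set ws. length w \<le> length is) \<and> (\<forall>f. smooth f \<longrightarrow>
    partials is (\<lambda>x. complex_of_real (x $ i) * f x) =
      (\<lambda>x. complex_of_real (x $ i) * partials is f x + (\<Sum>w\<leftarrow>ws. partials w f x)))"
proof (induction "is")
  case Nil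
  show ?case by (intro exI[of _ "[]"]) simp
next
  case (Cons j "is")
  then obtain ws where ws: "\<forall>w\<in>set ws. length w \<le> length is"
    and eq: "\<And>f. smooth f \<Longrightarrow> partials is (\<lambda>x. complex_of_real (x $ i) * f x) =
      (\<lambda>x. complex_of_real (x $ i) * partials is f x + (\<Sum>w\<leftarrow>ws. partials w f x))"
    by blast
  define vs where "vs = (if i = j then [is] else []) @ map ((#) j) ws"
  show ?case
  proof (intro exI[of _ vs] conjI allI impI)
    show "\<forall>w\<in>set vs. length w \<le> length (j # is)"
      using ws by (auto simp: vs_def)
    fix f :: "real ^ 'a \<Rightarrow> complex" assume f: "smooth f"
    have d: "(\<lambda>x. complex_of_real (x $ i) * partials is f x) differentiable at x" for x
      using coord_mult_has_derivative[OF smoothD[OF f]] by (auto simp: differentiable_def)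
    show "partials (j # is) (\<lambda>x. complex_of_real (x $ i) * f x) =
      (\<lambda>x. complex_of_real (x $ i) * partials (j # is) f x + (\<Sum>w\<leftarrow>vs. partials w f x))"
      using f
      by (auto simp: eq partial_add[OF d sum_list_differentiable] partial_sum_list
          partial_coord_mult[OF smoothD] vs_def fun_eq_iff simp del: map_map)
  qed
qed

lemma smooth_coord_mult:
  assumes "smooth f"
  shows "smooth (\<lambda>x. complex_of_real (x $ i) * f x)"
  unfolding smooth_def
proof (intro allI)
  fix "is" x
  obtain ws where "partials is (\<lambda>x. complex_of_real (x $ i) * f x) =
      (\<lambda>x. complex_of_real (x $ i) * partials is f x + (\<Sum>w\<leftarrow>ws. partials w f x))"
    using partials_coord_mult[of "is" i] assms by blast
  moreover have "(\<lambda>x. complex_of_real (x $ i) * partials is f x) differentiable at x"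
    using coord_mult_has_derivative[OF smoothD[OF assms]] by (auto simp: differentiable_def)
  ultimately show "partials is (\<lambda>x. complex_of_real (x $ i) * f x) differentiable at x"
    by (simp add: differentiable_add sum_list_differentiable assms)
qed

lemma smooth_partials_continuous: "smooth f \<Longrightarrow> continuous_on UNIV (partials is f)"
  by (simp add: continuous_on_eq_continuous_at differentiable_imp_continuous_within smoothD)

text \<open>Symmetry of second derivatives.\<close>

lemma symmetric_second_derivative_real:
  fixes g gi gj gij gji :: "'a::real_normed_vector \<Rightarrow> real" and a b :: 'a
  assumes gi: "\<And>x t. ((\<lambda>t. g (x + t *\<^sub>R a)) has_real_derivative gi (x + t *\<^sub>R a)) (at t)"
    and gj: "\<And>x t. ((\<lambda>t. g (x + t *\<^sub>R b)) has_real_derivative gj (x + t *\<^sub>R b)) (at t)"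
    and gij: "\<And>x t. ((\<lambda>t. gi (x + t *\<^sub>R b)) has_real_derivative gij (x + t *\<^sub>R b)) (at t)"
    and gji: "\<And>x t. ((\<lambda>t. gj (x + t *\<^sub>R a)) has_real_derivative gji (x + t *\<^sub>R a)) (at t)"
    and cont: "isCont gij x" "isCont gji x"
  shows "gij x = gji x"
proof -
  have main: "\<exists>y z. dist y x \<le> h * (norm a + norm b) \<and> dist z x \<le> h * (norm a + norm b)
      \<and> gij y = gji z" if h: "h > 0" for h :: real
  proof -
    define D where "D = g (x + h *\<^sub>R b + h *\<^sub>R a) - g (x + h *\<^sub>R a) - (g (x + h *\<^sub>R b) - g x)"
    have "\<exists>s>0. s < h \<and> (g (x + h *\<^sub>R b + h *\<^sub>R a) - g (x + h *\<^sub>R a)) -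
        (g (x + h *\<^sub>R b + 0 *\<^sub>R a) - g (x + 0 *\<^sub>R a)) =
        (h - 0) * (gi (x + h *\<^sub>R b + s *\<^sub>R a) - gi (x + s *\<^sub>R a))"
      using h by (intro MVT2) (auto intro!: derivative_intros gi)
    then obtain s where s: "0 < s" "s < h"
      "D = h * (gi (x + h *\<^sub>R b + s *\<^sub>R a) - gi (x + s *\<^sub>R a))"
      by (auto simp: D_def)
    have "\<exists>t>0. t < h \<and> gi (x + s *\<^sub>R a + h *\<^sub>R b) - gi (x + s *\<^sub>R a + 0 *\<^sub>R b) =
        (h - 0) * gij (x + s *\<^sub>R a + t *\<^sub>R b)"
      using h by (intro MVT2) (auto intro!: gij)
    then obtain t where t: "0 < t" "t < h" "D = h * (h * gij (x + s *\<^sub>R a + t *\<^sub>R b))"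
      using s by (auto simp: add_ac)
    have "\<exists>s>0. s < h \<and> (g (x + h *\<^sub>R a + h *\<^sub>R b) - g (x + h *\<^sub>R b)) -
        (g (x + h *\<^sub>R a + 0 *\<^sub>R b) - g (x + 0 *\<^sub>R b)) =
        (h - 0) * (gj (x + h *\<^sub>R a + s *\<^sub>R b) - gj (x + s *\<^sub>R b))"
      using h by (intro MVT2) (auto intro!: derivative_intros gj)
    then obtain s' where s': "0 < s'" "s' < h"
      "D = h * (gj (x + h *\<^sub>R a + s' *\<^sub>R b) - gj (x + s' *\<^sub>R b))"
      by (auto simp: D_def algebra_simps)
    have "\<exists>t>0. t < h \<and> gj (x + s' *\<^sub>R b + h *\<^sub>R a) - gj (x + s' *\<^sub>R b + 0 *\<^sub>R a) =
        (h - 0) * gji (x + s' *\<^sub>R b + t *\<^sub>R a)"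
      using h by (intro MVT2) (auto intro!: gji)
    then obtain t' where t': "0 < t'" "t' < h" "D = h * (h * gji (x + s' *\<^sub>R b + t' *\<^sub>R a))"
      using s' by (auto simp: add_ac)
    have *: "dist (x + p *\<^sub>R u + q *\<^sub>R v) x \<le> h * (norm u + norm v)"
      if "0 < p" "p < h" "0 < q" "q < h" for p q and u v :: 'a
    proof -
      have "norm (p *\<^sub>R u + q *\<^sub>R v) \<le> p * norm u + q * norm v"
        using norm_triangle_ineq[of "p *\<^sub>R u" "q *\<^sub>R v"] that by simp
      also have "\<dots> \<le> h * norm u + h * norm v"
        using that by (intro add_mono mult_right_mono) auto
      finally show ?thesis by (simp add: dist_norm algebra_simps)
    qed
    have "gij (x + s *\<^sub>R a + t *\<^sub>R b) = gji (x + s' *\<^sub>R b + t' *\<^sub>R a)"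
      using t(3) t'(3) h by simp
    with *[OF s(1,2) t(1,2), of a b] *[OF s'(1,2) t'(1,2), of b a] show ?thesis
      by (intro exI[of _ "x + s *\<^sub>R a + t *\<^sub>R b"] exI[of _ "x + s' *\<^sub>R b + t' *\<^sub>R a"])
         (simp add: add.commute)
  qed
  define h where "h n = inverse (real (Suc n))" for n
  have "\<forall>n. \<exists>y z. dist y x \<le> h n * (norm a + norm b) \<and> dist z x \<le> h n * (norm a + norm b)
      \<and> gij y = gji z"
    using main by (auto simp: h_def)
  then obtain Y Z where Y: "\<And>n. dist (Y n) x \<le> h n * (norm a + norm b)"
    and Z: "\<And>n. dist (Z n) x \<le> h n * (norm a + norm b)" and eq: "\<And>n. gij (Y n) = gji (Z n)"
    by metis
  have h0: "(\<lambda>n. h n * (norm a + norm b)) \<longlonglongrightarrow> 0"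
    unfolding h_def by (intro tendsto_mult_left_zero LIMSEQ_inverse_real_of_nat)
  have "Y \<longlonglongrightarrow> x" "Z \<longlonglongrightarrow> x"
    unfolding tendsto_dist_iff[of _ x]
    by (rule tendsto_sandwich[OF _ _ tendsto_const h0]; simp add: Y Z)+
  then have "(\<lambda>n. gij (Y n)) \<longlonglongrightarrow> gij x" "(\<lambda>n. gji (Z n)) \<longlonglongrightarrow> gji x"
    using cont isCont_tendsto_compose by blast+
  then show ?thesis using eq LIMSEQ_unique by auto
qed

lemma partial_has_vector_derivative:
  assumes "f differentiable at (x + t *\<^sub>R axis i 1)"
  shows "((\<lambda>t. f (x + t *\<^sub>R axis i 1)) has_vector_derivative
    partial i f (x + t *\<^sub>R axis i 1)) (at t)"
proof -
  let ?f' = "frechet_derivative f (at (x + t *\<^sub>R axis i 1))"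
  have f: "(f has_derivative ?f') (at (x + t *\<^sub>R axis i 1))"
    by (rule partial_has_derivative[OF assms])
  have "((\<lambda>t. x + t *\<^sub>R axis i 1) has_derivative (\<lambda>h. h *\<^sub>R axis i 1)) (at t)"
    by (auto intro!: derivative_eq_intros)
  from has_derivative_compose[OF this f] show ?thesis
    using linear_scale[OF has_derivative_linear[OF f]]
    by (simp add: has_vector_derivative_def partial_def)
qed

lemma partial_commute:
  assumes f: "smooth f"
  shows "partial i (partial j f) = partial j (partial i f)"
proof
  fix x
  note d = partial_has_vector_derivative[OF smooth_differentiable]
  note sm = f smooth_partial[OF f]
  have c: "isCont (partial k (partial l f)) x" for k l
    using smooth_partials_continuous[OF f, of "[k, l]"]
    by (simp add: continuous_on_eq_continuous_at)
  have re: "((\<lambda>t. Re (g (y + t *\<^sub>R axis k 1))) has_real_derivative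
      Re (partial k g (y + t *\<^sub>R axis k 1))) (at t)"
    and im: "((\<lambda>t. Im (g (y + t *\<^sub>R axis k 1))) has_real_derivative
      Im (partial k g (y + t *\<^sub>R axis k 1))) (at t)" if "smooth g" for g k y t
    using bounded_linear.has_vector_derivative[OF bounded_linear_Re d[OF that]]
      bounded_linear.has_vector_derivative[OF bounded_linear_Im d[OF that]]
    by (simp_all add: has_real_derivative_iff_has_vector_derivative)
  have "Re (partial i (partial j f) x) = Re (partial j (partial i f) x)"
    by (rule symmetric_second_derivative_real[where g="\<lambda>x. Re (f x)"
          and gi="\<lambda>x. Re (partial j f x)" and gj="\<lambda>x. Re (partial i f x)"
          and a="axis j 1" and b="axis i 1"])
       (intro re sm isCont_Re c)+
  moreover have "Im (partial i (partial j f) x) = Im (partial j (partial i f) x)"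
    by (rule symmetric_second_derivative_real[where g="\<lambda>x. Im (f x)"
          and gi="\<lambda>x. Im (partial j f x)" and gj="\<lambda>x. Im (partial i f x)"
          and a="axis j 1" and b="axis i 1"])
       (intro im sm isCont_Im c)+
  ultimately show "partial i (partial j f) x = partial j (partial i f) x"
    by (simp add: complex_eq_iff)
qed

section \<open>Test functions\<close>

typedef (overloaded) ('n::finite) test_function =
  "{f :: real ^ 'n \<Rightarrow> complex. smooth f \<and> compact (closure (support_on UNIV f))}"
  morphisms test_apply Test_function
  by (rule exI[of _ "\<lambda>x. 0"]) (simp add: smooth_zero support_on_def)

setup_lifting type_definition_test_function

lemma bounded_support_mono:
  fixes f g :: "real ^ 'n::finite \<Rightarrow> complex"
  assumes "compact (closure (support_on UNIV f))" "\<And>x. f x = 0 \<Longrightarrow> g x = 0"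
  shows "compact (closure (support_on UNIV g))"
proof -
  have "support_on UNIV g \<subseteq> support_on UNIV f"
    using assms(2) by (auto simp: support_on_def)
  with assms(1) show ?thesis by (simp add: bounded_subset)
qed

lemma bounded_support_Un:
  fixes f g h :: "real ^ 'n::finite \<Rightarrow> complex"
  assumes "compact (closure (support_on UNIV f))" "compact (closure (support_on UNIV g))"
    "\<And>x. f x = 0 \<Longrightarrow> g x = 0 \<Longrightarrow> h x = 0"
  shows "compact (closure (support_on UNIV h))"
proof -
  have "support_on UNIV h \<subseteq> support_on UNIV f \<union> support_on UNIV g"
    using assms(3) by (auto simp: support_on_def)
  moreover have "bounded (support_on UNIV f \<union> support_on UNIV g)"
    using assms(1,2) by simp
  ultimately have "bounded (support_on UNIV h)" by (rule bounded_subset[rotated])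
  then show ?thesis by simp
qed

lemma zero_outside_support: "x \<notin> closure (support_on UNIV f) \<Longrightarrow> f x = 0"
  by (metis closure_subset in_support_on UNIV_I subsetD)

lemma partial_outside_support:
  assumes "x \<notin> closure (support_on UNIV f)"
  shows "partial i f x = 0"
proof -
  have "(f has_derivative (\<lambda>h. 0)) (at x)"
    by (rule has_derivative_transform_within_open[where f="\<lambda>x. 0"
          and s="- closure (support_on UNIV f)"])
       (use assms zero_outside_support in force)+
  from partialI[OF this] show ?thesis by simp
qed

lemma partial_vanish:
  assumes "closed K" "\<And>x. x \<notin> K \<Longrightarrow> f x = 0" "x \<notin> K"
  shows "partial i f x = 0"
proof (rule partial_outside_support)
  have "closure (support_on UNIV f) \<subseteq> K"
    using assms by (intro closure_minimal) (auto simp: support_on_def)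
  with assms show "x \<notin> closure (support_on UNIV f)" by auto
qed

lemma partials_vanish:
  assumes "closed K" "\<And>x. x \<notin> K \<Longrightarrow> f x = 0"
  shows "x \<notin> K \<Longrightarrow> partials is f x = 0"
  by (induction "is" arbitrary: x) (simp_all add: assms partial_vanish[OF assms(1)])

instantiation test_function :: (finite) ab_group_add
begin

lift_definition zero_test_function :: "'a test_function" is "\<lambda>x. 0"
  by (simp add: smooth_zero support_on_def)

lift_definition plus_test_function ::
  "'a test_function \<Rightarrow> 'a test_function \<Rightarrow> 'a test_function" is "\<lambda>f g x. f x + g x"
proof
  fix f g :: "real ^ 'a \<Rightarrow> complex"
  assume f: "smooth f \<and> compact (closure (support_on UNIV f))"
    and g: "smooth g \<and> compact (closure (support_on UNIV g))"
  then show "smooth (\<lambda>x. f x + g x)"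
    by (simp add: smooth_add)
  show "compact (closure (support_on UNIV (\<lambda>x. f x + g x)))"
    by (rule bounded_support_Un[of f g]) (use f g in simp_all)
qed

lift_definition uminus_test_function :: "'a test_function \<Rightarrow> 'a test_function"
  is "\<lambda>f x. - f x"
proof
  fix f :: "real ^ 'a \<Rightarrow> complex"
  assume f: "smooth f \<and> compact (closure (support_on UNIV f))"
  then show "smooth (\<lambda>x. - f x)"
    using smooth_cmult[of f "-1"] by simp
  from f show "compact (closure (support_on UNIV (\<lambda>x. - f x)))"
    by (simp add: support_on_def)
qed

lift_definition minus_test_function ::
  "'a test_function \<Rightarrow> 'a test_function \<Rightarrow> 'a test_function" is "\<lambda>f g x. f x - g x"
proof
  fix f g :: "real ^ 'a \<Rightarrow> complex"
  assume f: "smooth f \<and> compact (closure (support_on UNIV f))"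
    and g: "smooth g \<and> compact (closure (support_on UNIV g))"
  then show "smooth (\<lambda>x. f x - g x)"
    using smooth_add[of f "\<lambda>x. - 1 * g x"] smooth_cmult[of g "-1"] by simp
  show "compact (closure (support_on UNIV (\<lambda>x. f x - g x)))"
    by (rule bounded_support_Un[of f g]) (use f g in simp_all)
qed

instance
  by (standard; transfer; simp add: fun_eq_iff algebra_simps)

end

lift_definition test_scale :: "complex \<Rightarrow> 'n::finite test_function \<Rightarrow> 'n test_function"
  is "\<lambda>c f x. c * f x"
proof
  fix c and f :: "real ^ 'n \<Rightarrow> complex"
  assume f: "smooth f \<and> compact (closure (support_on UNIV f))"
  then show "smooth (\<lambda>x. c * f x)"
    by (simp add: smooth_cmult)
  show "compact (closure (support_on UNIV (\<lambda>x. c * f x)))"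
    by (rule bounded_support_mono[of f "\<lambda>x. c * f x"]) (use f in simp_all)
qed

lift_definition test_partial :: "'n::finite \<Rightarrow> 'n test_function \<Rightarrow> 'n test_function"
  is partial
proof
  fix i :: 'n and f :: "real ^ 'n \<Rightarrow> complex"
  assume f: "smooth f \<and> compact (closure (support_on UNIV f))"
  then show "smooth (partial i f)" by (simp add: smooth_partial)
  have "support_on UNIV (partial i f) \<subseteq> closure (support_on UNIV f)"
    by (meson in_support_on partial_outside_support subsetI)
  with f show "compact (closure (support_on UNIV (partial i f)))"
    by (metis bounded_subset compact_closure compact_imp_bounded)
qed

lift_definition test_coord_mult :: "'n::finite \<Rightarrow> 'n test_function \<Rightarrow> 'n test_function"
  is "\<lambda>i f x. complex_of_real (x $ i) * f x"
proof
  fix i :: 'n and f :: "real ^ 'n \<Rightarrow> complex"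
  assume f: "smooth f \<and> compact (closure (support_on UNIV f))"
  then show "smooth (\<lambda>x. complex_of_real (x $ i) * f x)"
    by (simp add: smooth_coord_mult)
  show "compact (closure (support_on UNIV (\<lambda>x. complex_of_real (x $ i) * f x)))"
    by (rule bounded_support_mono[of f "\<lambda>x. complex_of_real (x $ i) * f x"]) (use f in simp_all)
qed

text \<open>The norm of \<open>C\<^sup>N\<close>-convergence; the suprema are finite because of the compact support.\<close>

definition test_norm :: "nat \<Rightarrow> 'n::finite test_function \<Rightarrow> real" where
  "test_norm N \<phi> =
    (\<Sum>is | length is \<le> N. SUP x. norm (partials is (test_apply \<phi>) x))"

lemma finite_words: "finite {is :: 'n::finite list. length is \<le> N}"
  using finite_lists_length_le[of "UNIV :: 'n set" N] by simp

lemma test_smooth: "smooth (test_apply \<phi>)"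
  and test_compact: "compact (closure (support_on UNIV (test_apply \<phi>)))"
  using test_apply[of \<phi>] by auto

lemma bdd_above_partials: "bdd_above (range (\<lambda>x. norm (partials is (test_apply \<phi>) x)))"
proof -
  let ?K = "closure (support_on UNIV (test_apply \<phi>))" and ?g = "partials is (test_apply \<phi>)"
  have "compact (?g ` ?K)"
    by (rule compact_continuous_image[OF continuous_on_subset[OF
            smooth_partials_continuous[OF test_smooth] subset_UNIV] test_compact])
  then obtain B where "\<And>x. x \<in> ?K \<Longrightarrow> norm (?g x) \<le> B"
    by (meson bounded_iff compact_imp_bounded imageI)
  moreover have "?g x = 0" if "x \<notin> ?K" for x
    by (rule partials_vanish[OF _ _ that])
       (simp_all add: zero_outside_support)
  ultimately have "norm (?g x) \<le> max B 0" for x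
    by (cases "x \<in> ?K") fastforce+
  then show ?thesis by (auto intro!: bdd_aboveI2)
qed

lemma partials_le_SUP:
  "norm (partials is (test_apply \<phi>) x) \<le> (SUP x. norm (partials is (test_apply \<phi>) x))"
  by (rule cSUP_upper[OF UNIV_I bdd_above_partials])

lemma SUP_partials_nonneg: "0 \<le> (SUP x. norm (partials is (test_apply \<phi>) x))"
  using partials_le_SUP[of "is" \<phi> 0] norm_ge_zero order_trans by blast

lemma partials_le_test_norm:
  assumes "length is \<le> N"
  shows "norm (partials is (test_apply \<phi>) x) \<le> test_norm N \<phi>"
proof -
  have "(SUP x. norm (partials is (test_apply \<phi>) x)) \<le> test_norm N \<phi>"
    unfolding test_norm_def
    by (rule member_le_sum) (use assms finite_words SUP_partials_nonneg in auto)
  with partials_le_SUP[of "is" \<phi> x] show ?thesis by linarith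
qed

lemma test_norm_nonneg: "0 \<le> test_norm N \<phi>"
  unfolding test_norm_def by (intro sum_nonneg SUP_partials_nonneg)

lemma test_norm_mono: "M \<le> N \<Longrightarrow> test_norm M \<phi> \<le> test_norm N \<phi>"
  unfolding test_norm_def
  by (intro sum_mono2 finite_words SUP_partials_nonneg) auto

lemma test_norm_bound:
  assumes "\<And>is x. length is \<le> N \<Longrightarrow> norm (partials is (test_apply \<phi>) x) \<le> B is"
  shows "test_norm N \<phi> \<le> (\<Sum>is | length is \<le> N. B is)"
  unfolding test_norm_def by (intro sum_mono cSUP_least) (use assms in auto)

section \<open>Distributions\<close>

definition test_supported_in :: "(real ^ 'n::finite) set \<Rightarrow> 'n test_function \<Rightarrow> bool" where
  "test_supported_in K \<phi> \<longleftrightarrow> closure (support_on UNIV (test_apply \<phi>)) \<subseteq> K"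

text \<open>
  Continuity for the inductive limit topology on test functions, spelled out as usual by
  estimates on each compact set.
\<close>

definition distribution_continuous :: "('n::finite test_function \<Rightarrow> complex) \<Rightarrow> bool" where
  "distribution_continuous u \<longleftrightarrow>
    (\<forall>K. compact K \<longrightarrow> (\<exists>C N. \<forall>\<phi>. test_supported_in K \<phi> \<longrightarrow> norm (u \<phi>) \<le> C * test_norm N \<phi>))"

lemma distribution_continuousI:
  assumes "\<And>K. compact K \<Longrightarrow> \<exists>C N. \<forall>\<phi>. test_supported_in K \<phi> \<longrightarrow> norm (u \<phi>) \<le> C * test_norm N \<phi>"
  shows "distribution_continuous u"
  using assms unfolding distribution_continuous_def by blast

lemma distribution_continuousD:
  assumes "distribution_continuous u" "compact K"
  shows "\<exists>C N. C \<ge> 0 \<and> (\<forall>\<phi>. test_supported_in K \<phi> \<longrightarrow> norm (u \<phi>) \<le> C * test_norm N \<phi>)"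
proof -
  obtain C N where *: "\<And>\<phi>. test_supported_in K \<phi> \<Longrightarrow> norm (u \<phi>) \<le> C * test_norm N \<phi>"
    using assms unfolding distribution_continuous_def by blast
  have "norm (u \<phi>) \<le> max C 0 * test_norm N \<phi>" if "test_supported_in K \<phi>" for \<phi>
    using *[OF that] mult_right_mono[OF max.cobounded1[of C 0] test_norm_nonneg[of N \<phi>]]
    by linarith
  then show ?thesis by (intro exI[of _ "max C 0"] exI[of _ N]) auto
qed

lemma test_supported_in_iff:
  assumes "closed K"
  shows "test_supported_in K \<phi> \<longleftrightarrow> (\<forall>x. x \<notin> K \<longrightarrow> test_apply \<phi> x = 0)"
proof -
  have "test_supported_in K \<phi> \<longleftrightarrow> support_on UNIV (test_apply \<phi>) \<subseteq> K"
    unfolding test_supported_in_def using assms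
    by (meson closure_minimal closure_subset subset_trans)
  then show ?thesis by (auto simp: support_on_def)
qed

lemma test_supported_in_partial:
  assumes "compact K" "test_supported_in K \<phi>"
  shows "test_supported_in K (test_partial i \<phi>)"
  using assms partial_vanish[OF compact_imp_closed[OF assms(1)]]
  by (simp add: test_supported_in_iff compact_imp_closed test_partial.rep_eq)

lemma test_supported_in_coord_mult:
  assumes "compact K" "test_supported_in K \<phi>"
  shows "test_supported_in K (test_coord_mult i \<phi>)"
  using assms by (simp add: test_supported_in_iff compact_imp_closed test_coord_mult.rep_eq)

lemma continuous_test_partial:
  assumes "distribution_continuous u"
  shows "distribution_continuous (\<lambda>\<phi>. u (test_partial i \<phi>))"
proof (rule distribution_continuousI)
  fix K :: "(real ^ 'a) set" assume K: "compact K"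
  obtain C N where C: "C \<ge> 0"
    and u: "\<And>\<phi>. test_supported_in K \<phi> \<Longrightarrow> norm (u \<phi>) \<le> C * test_norm N \<phi>"
    using distribution_continuousD[OF assms K] by blast
  let ?c = "\<Sum>is :: 'a list | length is \<le> N. 1::real"
  have le: "test_norm N (test_partial i \<phi>) \<le> ?c * test_norm (Suc N) \<phi>" for \<phi>
  proof -
    have "test_norm N (test_partial i \<phi>) \<le> (\<Sum>is :: 'a list | length is \<le> N. test_norm (Suc N) \<phi>)"
    proof (rule test_norm_bound)
      fix "is" :: "'a list" and x assume "length is \<le> N"
      then show "norm (partials is (test_apply (test_partial i \<phi>)) x) \<le> test_norm (Suc N) \<phi>"
        using partials_le_test_norm[of "is @ [i]" "Suc N" \<phi> x]
        by (simp add: partials_append test_partial.rep_eq)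
    qed
    then show ?thesis by simp
  qed
  have "norm (u (test_partial i \<phi>)) \<le> (C * ?c) * test_norm (Suc N) \<phi>"
    if "test_supported_in K \<phi>" for \<phi>
    using u[OF test_supported_in_partial[OF K that], of i] mult_left_mono[OF le[of \<phi>] C]
    by (simp add: mult.assoc)
  then show "\<exists>C N. \<forall>\<phi>. test_supported_in K \<phi> \<longrightarrow> norm (u (test_partial i \<phi>)) \<le> C * test_norm N \<phi>"
    by blast
qed

lemma norm_sum_list_partials:
  assumes "\<forall>w\<in>set ws. length w \<le> N"
  shows "norm (\<Sum>w\<leftarrow>ws. partials w (test_apply \<phi>) x) \<le> real (length ws) * test_norm N \<phi>"
  using assms
proof (induction ws)
  case (Cons w ws)
  then have "norm (partials w (test_apply \<phi>) x) \<le> test_norm N \<phi>"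
    by (simp add: partials_le_test_norm)
  moreover have "norm (\<Sum>w\<leftarrow>ws. partials w (test_apply \<phi>) x) \<le> real (length ws) * test_norm N \<phi>"
    using Cons by simp
  ultimately have "norm (partials w (test_apply \<phi>) x + (\<Sum>w\<leftarrow>ws. partials w (test_apply \<phi>) x))
      \<le> test_norm N \<phi> + real (length ws) * test_norm N \<phi>"
    by (rule norm_triangle_mono)
  then show ?case by (simp add: distrib_right)
qed simp

lemma continuous_test_coord_mult:
  assumes "distribution_continuous u"
  shows "distribution_continuous (\<lambda>\<phi>. u (test_coord_mult i \<phi>))"
proof (rule distribution_continuousI)
  fix K :: "(real ^ 'a) set" assume K: "compact K"
  obtain C N where C: "C \<ge> 0"
    and u: "\<And>\<phi>. test_supported_in K \<phi> \<Longrightarrow> norm (u \<phi>) \<le> C * test_norm N \<phi>"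
    using distribution_continuousD[OF assms K] by blast
  obtain R where R: "R \<ge> 0" "\<And>x. x \<in> K \<Longrightarrow> norm x \<le> R"
    using compact_imp_bounded[OF K] bounded_pos less_imp_le by metis
  let ?P = "\<lambda>is ws. (\<forall>w\<in>set ws. length w \<le> length is) \<and> (\<forall>f. smooth f \<longrightarrow>
    partials is (\<lambda>x. complex_of_real (x $ i) * f x) =
      (\<lambda>x. complex_of_real (x $ i) * partials is f x + (\<Sum>w\<leftarrow>ws. partials w f x)))"
  have "\<forall>is. \<exists>ws. ?P is ws"
    by (intro allI partials_coord_mult)
  then obtain W where "\<forall>is. ?P is (W is)"
    using choice[of ?P] by blast
  then have W: "\<And>is w. w \<in> set (W is) \<Longrightarrow> length w \<le> length is"
    and eq: "\<And>is f. smooth f \<Longrightarrow> partials is (\<lambda>x. complex_of_real (x $ i) * f x) =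
      (\<lambda>x. complex_of_real (x $ i) * partials is f x + (\<Sum>w\<leftarrow>W is. partials w f x))"
    by blast+
  let ?c = "\<Sum>is :: 'a list | length is \<le> N. R + real (length (W is))"
  have le: "test_norm N (test_coord_mult i \<phi>) \<le> ?c * test_norm N \<phi>"
    if "test_supported_in K \<phi>" for \<phi>
  proof -
    have "test_norm N (test_coord_mult i \<phi>) \<le>
        (\<Sum>is :: 'a list | length is \<le> N. (R + real (length (W is))) * test_norm N \<phi>)"
    proof (rule test_norm_bound)
      fix "is" :: "'a list" and x assume len: "length is \<le> N"
      let ?g = "partials is (test_apply \<phi>) x"
      have "norm (complex_of_real (x $ i) * ?g) \<le> R * test_norm N \<phi>"
      proof (cases "x \<in> K")
        case True
        then have "\<bar>x $ i\<bar> \<le> R" using R(2) component_le_norm_cart order_trans by blast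
        with partials_le_test_norm[OF len, of \<phi> x] R(1) show ?thesis
          by (simp add: norm_mult mult_mono)
      next
        case False
        then have "?g = 0"
          using partials_vanish[of K "test_apply \<phi>"] that K
          by (simp add: test_supported_in_iff compact_imp_closed)
        then show ?thesis by (simp add: R(1) test_norm_nonneg)
      qed
      moreover have "norm (\<Sum>w\<leftarrow>W is. partials w (test_apply \<phi>) x)
          \<le> real (length (W is)) * test_norm N \<phi>"
        by (rule norm_sum_list_partials) (use W len order_trans in blast)
      ultimately show "norm (partials is (test_apply (test_coord_mult i \<phi>)) x)
          \<le> (R + real (length (W is))) * test_norm N \<phi>"
        using norm_triangle_ineq[of "complex_of_real (x $ i) * ?g"
            "\<Sum>w\<leftarrow>W is. partials w (test_apply \<phi>) x"]
        by (simp add: test_coord_mult.rep_eq eq test_smooth distrib_right)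
    qed
    then show ?thesis by (simp add: sum_distrib_right)
  qed
  have "norm (u (test_coord_mult i \<phi>)) \<le> (C * ?c) * test_norm N \<phi>"
    if "test_supported_in K \<phi>" for \<phi>
    using u[OF test_supported_in_coord_mult[OF K that], of i] mult_left_mono[OF le[OF that] C]
    by (simp add: mult.assoc)
  then show "\<exists>C N. \<forall>\<phi>. test_supported_in K \<phi> \<longrightarrow> norm (u (test_coord_mult i \<phi>)) \<le> C * test_norm N \<phi>"
    by blast
qed

lemma continuous_zero: "distribution_continuous (\<lambda>\<phi>. 0)"
  by (rule distribution_continuousI, rule exI[of _ 0]) simp

lemma continuous_cmult:
  assumes "distribution_continuous u"
  shows "distribution_continuous (\<lambda>\<phi>. c * u \<phi>)"
proof (rule distribution_continuousI)
  fix K :: "(real ^ 'a) set" assume K: "compact K"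
  obtain C N where C: "C \<ge> 0"
    and u: "\<And>\<phi>. test_supported_in K \<phi> \<Longrightarrow> norm (u \<phi>) \<le> C * test_norm N \<phi>"
    using distribution_continuousD[OF assms K] by blast
  have "norm (c * u \<phi>) \<le> (norm c * C) * test_norm N \<phi>" if "test_supported_in K \<phi>" for \<phi>
    using mult_left_mono[OF u[OF that], of "norm c"] by (simp add: norm_mult mult.assoc)
  then show "\<exists>C N. \<forall>\<phi>. test_supported_in K \<phi> \<longrightarrow> norm (c * u \<phi>) \<le> C * test_norm N \<phi>"
    by blast
qed

lemma continuous_add:
  assumes "distribution_continuous u" "distribution_continuous v"
  shows "distribution_continuous (\<lambda>\<phi>. u \<phi> + v \<phi>)"
proof (rule distribution_continuousI)
  fix K :: "(real ^ 'a) set" assume K: "compact K"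
  obtain C N where C: "C \<ge> 0"
    and u: "\<And>\<phi>. test_supported_in K \<phi> \<Longrightarrow> norm (u \<phi>) \<le> C * test_norm N \<phi>"
    using distribution_continuousD[OF assms(1) K] by blast
  obtain D M where D: "D \<ge> 0"
    and v: "\<And>\<phi>. test_supported_in K \<phi> \<Longrightarrow> norm (v \<phi>) \<le> D * test_norm M \<phi>"
    using distribution_continuousD[OF assms(2) K] by blast
  have "norm (u \<phi> + v \<phi>) \<le> (C + D) * test_norm (max N M) \<phi>" if "test_supported_in K \<phi>" for \<phi>
  proof -
    have "norm (u \<phi>) \<le> C * test_norm (max N M) \<phi>" "norm (v \<phi>) \<le> D * test_norm (max N M) \<phi>"
      using u[OF that] v[OF that] mult_left_mono[OF test_norm_mono[of N "max N M" \<phi>] C]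
        mult_left_mono[OF test_norm_mono[of M "max N M" \<phi>] D] by auto
    then show ?thesis using norm_triangle_ineq[of "u \<phi>" "v \<phi>"] by (simp add: distrib_right)
  qed
  then show "\<exists>C N. \<forall>\<phi>. test_supported_in K \<phi> \<longrightarrow> norm (u \<phi> + v \<phi>) \<le> C * test_norm N \<phi>"
    by blast
qed

typedef (overloaded) ('n::finite) distribution =
  "{u :: 'n test_function \<Rightarrow> complex.
     (\<forall>\<phi> \<psi>. u (\<phi> + \<psi>) = u \<phi> + u \<psi>) \<and> (\<forall>c \<phi>. u (test_scale c \<phi>) = c * u \<phi>) \<and>
     distribution_continuous u}"
  morphisms dist_apply Distribution
  by (rule exI[of _ "\<lambda>\<phi>. 0"]) (simp add: continuous_zero)

setup_lifting type_definition_distribution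

instantiation distribution :: (finite) ab_group_add
begin

lift_definition zero_distribution :: "'a distribution" is "\<lambda>\<phi>. 0"
  by (simp add: continuous_zero)

lift_definition plus_distribution ::
  "'a distribution \<Rightarrow> 'a distribution \<Rightarrow> 'a distribution" is "\<lambda>u v \<phi>. u \<phi> + v \<phi>"
proof (intro conjI allI)
  fix u v :: "'a test_function \<Rightarrow> complex" and \<phi> \<psi> c
  let ?D = "\<lambda>u. (\<forall>\<phi> \<psi>. u (\<phi> + \<psi>) = u \<phi> + u \<psi>) \<and>
    (\<forall>c \<phi>. u (test_scale c \<phi>) = c * u \<phi>) \<and> distribution_continuous u"
  assume u: "?D u" and v: "?D v"
  then show "u (\<phi> + \<psi>) + v (\<phi> + \<psi>) = u \<phi> + v \<phi> + (u \<psi> + v \<psi>)"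
    "u (test_scale c \<phi>) + v (test_scale c \<phi>) = c * (u \<phi> + v \<phi>)"
    by (simp_all add: algebra_simps)
  show "distribution_continuous (\<lambda>\<phi>. u \<phi> + v \<phi>)"
    by (rule continuous_add) (use u v in simp_all)
qed

lift_definition uminus_distribution :: "'a distribution \<Rightarrow> 'a distribution"
  is "\<lambda>u \<phi>. - u \<phi>"
proof (intro conjI allI)
  fix u :: "'a test_function \<Rightarrow> complex" and \<phi> \<psi> c
  assume u: "(\<forall>\<phi> \<psi>. u (\<phi> + \<psi>) = u \<phi> + u \<psi>) \<and>
    (\<forall>c \<phi>. u (test_scale c \<phi>) = c * u \<phi>) \<and> distribution_continuous u"
  then show "- u (\<phi> + \<psi>) = - u \<phi> + - u \<psi>" "- u (test_scale c \<phi>) = c * - u \<phi>"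
    by simp_all
  from u show "distribution_continuous (\<lambda>\<phi>. - u \<phi>)"
    using continuous_cmult[of u "-1"] by simp
qed

lift_definition minus_distribution ::
  "'a distribution \<Rightarrow> 'a distribution \<Rightarrow> 'a distribution" is "\<lambda>u v \<phi>. u \<phi> - v \<phi>"
proof (intro conjI allI)
  fix u v :: "'a test_function \<Rightarrow> complex" and \<phi> \<psi> c
  let ?D = "\<lambda>u. (\<forall>\<phi> \<psi>. u (\<phi> + \<psi>) = u \<phi> + u \<psi>) \<and>
    (\<forall>c \<phi>. u (test_scale c \<phi>) = c * u \<phi>) \<and> distribution_continuous u"
  assume u: "?D u" and v: "?D v"
  then show "u (\<phi> + \<psi>) - v (\<phi> + \<psi>) = u \<phi> - v \<phi> + (u \<psi> - v \<psi>)"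
    "u (test_scale c \<phi>) - v (test_scale c \<phi>) = c * (u \<phi> - v \<phi>)"
    by (simp_all add: algebra_simps)
  from u v show "distribution_continuous (\<lambda>\<phi>. u \<phi> - v \<phi>)"
    using continuous_add[of u "\<lambda>\<phi>. - 1 * v \<phi>"] continuous_cmult[of v "-1"] by simp
qed

instance
  by (standard; transfer; simp add: fun_eq_iff algebra_simps)

end

lift_definition dist_scale :: "complex \<Rightarrow> 'n::finite distribution \<Rightarrow> 'n distribution"
  is "\<lambda>c u \<phi>. c * u \<phi>"
proof (intro conjI allI)
  fix u :: "'n test_function \<Rightarrow> complex" and b \<phi> \<psi> c
  assume u: "(\<forall>\<phi> \<psi>. u (\<phi> + \<psi>) = u \<phi> + u \<psi>) \<and>
    (\<forall>c \<phi>. u (test_scale c \<phi>) = c * u \<phi>) \<and> distribution_continuous u"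
  then show "b * u (\<phi> + \<psi>) = b * u \<phi> + b * u \<psi>" "b * u (test_scale c \<phi>) = c * (b * u \<phi>)"
    by (simp_all add: algebra_simps)
  show "distribution_continuous (\<lambda>\<phi>. b * u \<phi>)"
    by (rule continuous_cmult) (use u in simp_all)
qed

lemma test_partial_add: "test_partial i (\<phi> + \<psi>) = test_partial i \<phi> + test_partial i \<psi>"
  by transfer (simp add: partial_add smooth_differentiable)

lemma test_partial_scale: "test_partial i (test_scale c \<phi>) = test_scale c (test_partial i \<phi>)"
  by transfer (simp add: partial_cmult smooth_differentiable)

lemma test_coord_mult_add:
  "test_coord_mult i (\<phi> + \<psi>) = test_coord_mult i \<phi> + test_coord_mult i \<psi>"
  by transfer (simp add: algebra_simps)

lemma test_coord_mult_scale:
  "test_coord_mult i (test_scale c \<phi>) = test_scale c (test_coord_mult i \<phi>)"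
  by transfer (simp add: algebra_simps)

lift_definition dist_partial :: "'n::finite \<Rightarrow> 'n distribution \<Rightarrow> 'n distribution"
  is "\<lambda>i u \<phi>. - u (test_partial i \<phi>)"
proof (intro conjI allI)
  fix i :: 'n and u :: "'n test_function \<Rightarrow> complex" and \<phi> \<psi> c
  assume u: "(\<forall>\<phi> \<psi>. u (\<phi> + \<psi>) = u \<phi> + u \<psi>) \<and>
    (\<forall>c \<phi>. u (test_scale c \<phi>) = c * u \<phi>) \<and> distribution_continuous u"
  then show "- u (test_partial i (\<phi> + \<psi>)) = - u (test_partial i \<phi>) + - u (test_partial i \<psi>)"
    "- u (test_partial i (test_scale c \<phi>)) = c * - u (test_partial i \<phi>)"
    by (simp_all add: test_partial_add test_partial_scale)
  from u show "distribution_continuous (\<lambda>\<phi>. - u (test_partial i \<phi>))"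
    using continuous_cmult[of "\<lambda>\<phi>. u (test_partial i \<phi>)" "-1"]
    by (simp add: continuous_test_partial)
qed

lift_definition dist_coord_mult :: "'n::finite \<Rightarrow> 'n distribution \<Rightarrow> 'n distribution"
  is "\<lambda>i u \<phi>. u (test_coord_mult i \<phi>)"
proof (intro conjI allI)
  fix i :: 'n and u :: "'n test_function \<Rightarrow> complex" and \<phi> \<psi> c
  assume u: "(\<forall>\<phi> \<psi>. u (\<phi> + \<psi>) = u \<phi> + u \<psi>) \<and>
    (\<forall>c \<phi>. u (test_scale c \<phi>) = c * u \<phi>) \<and> distribution_continuous u"
  then show "u (test_coord_mult i (\<phi> + \<psi>)) = u (test_coord_mult i \<phi>) + u (test_coord_mult i \<psi>)"
    "u (test_coord_mult i (test_scale c \<phi>)) = c * u (test_coord_mult i \<phi>)"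
    by (simp_all add: test_coord_mult_add test_coord_mult_scale)
  show "distribution_continuous (\<lambda>\<phi>. u (test_coord_mult i \<phi>))"
    by (rule continuous_test_coord_mult) (use u in simp_all)
qed

section \<open>Euler operators\<close>

definition theta :: "'n::finite \<Rightarrow> 'n distribution \<Rightarrow> 'n distribution" where
  "theta j u = dist_coord_mult j (dist_partial j u)"

lemma test_euler_commute:
  "test_partial i (test_coord_mult i (test_partial j (test_coord_mult j \<phi>))) =
   test_partial j (test_coord_mult j (test_partial i (test_coord_mult i \<phi>)))"
proof (cases "i = j")
  case False
  have "partial i (\<lambda>x. complex_of_real (x $ i) * partial j (\<lambda>x. complex_of_real (x $ j) * f x) x) =
        partial j (\<lambda>x. complex_of_real (x $ j) * partial i (\<lambda>x. complex_of_real (x $ i) * f x) x)"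
    if f: "smooth f" for f :: "real ^ 'a \<Rightarrow> complex"
  proof -
    note sm = f smooth_partial[OF f] smooth_coord_mult[OF smooth_partial[OF f]]
    have *: "partial i (\<lambda>x. complex_of_real (x $ i) * partial j (\<lambda>x. complex_of_real (x $ j) * f x) x) =
      (\<lambda>x. complex_of_real (x $ i) * (complex_of_real (x $ j) * partial i (partial j f) x)
         + complex_of_real (x $ i) * partial i f x + complex_of_real (x $ j) * partial j f x + f x)"
      if "i \<noteq> j" for i j :: 'a
    proof -
      have "partial j (\<lambda>x. complex_of_real (x $ j) * f x) =
          (\<lambda>x. complex_of_real (x $ j) * partial j f x + f x)"
        using partial_coord_mult[of f j j] f by (simp add: smooth_differentiable)
      moreover have "partial i (\<lambda>x. complex_of_real (x $ j) * partial j f x + f x) =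
          (\<lambda>x. complex_of_real (x $ j) * partial i (partial j f) x + partial i f x)"
        using sm that
        by (simp add: partial_add smooth_differentiable partial_coord_mult)
      moreover have "smooth (\<lambda>x. complex_of_real (x $ j) * partial j f x + f x)"
        using sm by (intro smooth_add)
      ultimately show ?thesis
        by (simp add: partial_coord_mult smooth_differentiable) (simp add: algebra_simps)
    qed
    show ?thesis
      using *[OF False] *[of j i] False partial_commute[OF f, of i j]
      by (simp add: algebra_simps)
  qed
  then show ?thesis by transfer simp
qed simp

lemma theta_commute: "theta i \<circ> theta j = theta j \<circ> theta i"
proof -
  have "theta i (theta j u) = theta j (theta i u)" for u :: "'a distribution"
    unfolding theta_def by transfer (simp add: test_euler_commute)
  then show ?thesis by auto
qed

text \<open>
  A monomial is an exponent vector \<open>\<alpha> :: 'n \<Rightarrow>\<^sub>0 nat\<close>, and a polynomial in variables indexed by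
  \<open>'n\<close> is a finitely supported function from monomials to coefficients. The product of the
  commuting powers \<open>\<theta>\<^sub>j\<^bsup>\<alpha>\<^sub>j\<^esup>\<close> over all \<open>j\<close> is written as a fold, which by the next lemma does
  not depend on any enumeration of \<open>'n\<close>.
\<close>

lemma comp_fun_commute_theta_power:
  "comp_fun_commute (\<lambda>j. theta j ^^ Poly_Mapping.lookup \<alpha> j)"
proof
  have *: "(theta i ^^ m) (theta j u) = theta j ((theta i ^^ m) u)" for i j :: 'a and m u
    by (induction m) (simp_all add: theta_commute[unfolded fun_eq_iff o_apply, rule_format, of i j])
  have "(theta i ^^ m) ((theta j ^^ n) u) = (theta j ^^ n) ((theta i ^^ m) u)"
    for i j :: 'a and m n u
    by (induction n) (simp_all add: *)
  then show "(theta j ^^ Poly_Mapping.lookup \<alpha> j) \<circ> (theta i ^^ Poly_Mapping.lookup \<alpha> i) =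
      (theta i ^^ Poly_Mapping.lookup \<alpha> i) \<circ> (theta j ^^ Poly_Mapping.lookup \<alpha> j)" for i j
    by auto
qed

definition theta_monomial ::
  "('n::finite \<Rightarrow>\<^sub>0 nat) \<Rightarrow> 'n distribution \<Rightarrow> 'n distribution" where
  "theta_monomial \<alpha> u = Finite_Set.fold (\<lambda>j. theta j ^^ Poly_Mapping.lookup \<alpha> j) u UNIV"

definition euler_operator ::
  "(('n::finite \<Rightarrow>\<^sub>0 nat) \<Rightarrow>\<^sub>0 complex) \<Rightarrow> 'n distribution \<Rightarrow> 'n distribution" where
  "euler_operator P u =
    (\<Sum>\<alpha>\<in>Poly_Mapping.keys P. dist_scale (Poly_Mapping.lookup P \<alpha>) (theta_monomial \<alpha> u))"

end

theory Submission
  imports Defs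
begin

text \<open>
  The operator is \<open>P(\<theta>) = \<theta>\<^sub>a\<^sup>2 - \<i> \<theta>\<^sub>b\<close> for two distinct coordinates \<open>a\<close>, \<open>b\<close>.
  In the coordinates \<open>y = ln x\<close> its transpose is, up to the factor \<open>1 / (x\<^sub>a x\<^sub>b)\<close>, the free
  Schroedinger operator \<open>\<partial>\<^sub>a\<^sup>2 + \<i> \<partial>\<^sub>b\<close>, which has Gaussian beams of frequency about \<open>L\<close> in \<open>y\<^sub>a\<close>
  moving along the line \<open>y\<^sub>a = L (y\<^sub>b - \<tau>)\<close>. While \<open>x\<^sub>a\<close> runs from \<open>1\<close> down to \<open>e\<^bsup>-L(\<tau>+1)\<^esup>\<close>, the point
  \<open>x\<^sub>b\<close> only moves through the bounded range from \<open>e\<^bsup>\<tau>\<^esup>\<close> to \<open>e\<^bsup>-1\<^esup>\<close>. Cutting a beam off yields test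
  functions \<open>\<phi>\<close> for which the transpose is the sum of an error supported in a compact set that does not depend
  on \<open>\<tau>\<close>, whose \<open>C\<^sup>N\<close> norm is at most \<open>e\<^bsup>m(\<tau>+1)L\<^esup>\<close> up to polynomial factors with \<open>m\<close> depending only
  on \<open>N\<close>, and of an error all of whose derivatives grow polynomially in \<open>L\<close>: away from the beam the Gaussian
  \<open>e\<^bsup>-cL\<^sup>2\<^esup>\<close> beats every power of \<open>1 / x\<^sub>a\<close>. So if \<open>P(\<theta>) u = T\<close>, then the finite order of \<open>u\<close> on the fixed
  compact set bounds the growth rate of \<open>T(\<phi>)\<close> linearly in \<open>\<tau>\<close>. This is violated by a distribution \<open>T\<close> whose
  order near the points \<open>x\<^sub>a = 0\<close>, \<open>x\<^sub>b = e\<^sup>j\<close> grows quadratically in \<open>j\<close>.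
\<close>

section \<open>A smooth step function\<close>

text \<open>The index \<open>m\<close> keeps all derivatives of the standard flat function inside
  one explicit family: differentiation only leads to larger \<open>m\<close>, so no polynomials in
  \<open>1/x\<close> have to be tracked.\<close>

definition flat :: "nat \<Rightarrow> real \<Rightarrow> real" where
  "flat m x = (if x \<le> 0 then 0 else inverse x ^ m * exp (- inverse x))"

text \<open>A single term of the exponential series is at most the whole series.\<close>

lemma power_exp_le_fact: "0 \<le> (y::real) \<Longrightarrow> y ^ m * exp (- y) \<le> fact m"
proof -
  assume y: "0 \<le> y"
  have "(\<Sum>k\<in>{m}. y ^ k /\<^sub>R fact k) \<le> exp y"
    unfolding exp_def
    by (rule sum_le_suminf[OF summable_exp_generic]) (use y in auto)
  then have "y ^ m \<le> fact m * exp y"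
    by (simp add: field_simps)
  then show ?thesis
    by (simp add: exp_minus field_simps)
qed

lemma flat_nonneg: "0 \<le> flat m x"
  by (simp add: flat_def)

lemma flat_le: "flat m x \<le> fact m"
  using power_exp_le_fact[of "inverse x" m] by (simp add: flat_def)

text \<open>Two powers of \<open>1/x\<close> are traded for the constant
  \<open>fact (m + 2)\<close>. The quadratic bound makes the difference quotient at 0 tend to
  0.\<close>

lemma flat_le_square: "flat m x \<le> fact (m + 2) * x\<^sup>2"
proof (cases "x \<le> 0")
  case False
  then have "flat (m + 2) x * x\<^sup>2 = flat m x"
    by (simp add: flat_def power_add field_simps power2_eq_square)
  with mult_right_mono[OF flat_le[of "m + 2" x], of "x\<^sup>2"] show ?thesis by simp
qed (simp add: flat_def)

lemma flat_has_derivative: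
  "(flat m has_real_derivative flat (m + 2) x - of_nat m * flat (m + 1) x) (at x)"
proof -
  consider "x < 0" | "x = 0" | "x > 0" by linarith
  then show ?thesis
  proof cases
    case 1
    have "(flat m has_real_derivative 0) (at x)"
      by (rule has_field_derivative_transform_within_open[where f="\<lambda>x. 0" and S="{..<0}"])
         (use 1 in \<open>auto simp: flat_def\<close>)
    with 1 show ?thesis by (simp add: flat_def)
  next
    case 2
    have lim: "((\<lambda>h. fact (m + 2) * \<bar>h\<bar>) \<longlongrightarrow> 0) (at (0::real))"
      by (auto intro!: tendsto_eq_intros)
    have "norm ((flat m (0 + h) - flat m 0) / h) \<le> fact (m + 2) * \<bar>h\<bar>" if "h \<noteq> 0" for h
      using flat_le_square[of m h] that flat_nonneg[of m h]
      by (simp add: flat_def[of m 0] field_simps power2_eq_square split: abs_split)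
    then have "((\<lambda>h. (flat m (0 + h) - flat m 0) / h) \<longlongrightarrow> 0) (at 0)"
      by (intro Lim_null_comparison[OF _ lim]) (auto simp: eventually_at_filter)
    then show ?thesis using 2 by (simp add: DERIV_def flat_def[of _ 0])
  next
    case 3
    have "((\<lambda>x. inverse x ^ m * exp (- inverse x)) has_real_derivative
        of_nat m * inverse x ^ (m - 1) * (- (inverse x)\<^sup>2) * exp (- inverse x)
          + inverse x ^ m * (exp (- inverse x) * (inverse x)\<^sup>2)) (at x)"
      using 3 by (auto intro!: derivative_eq_intros simp: power2_eq_square)
    also have "of_nat m * inverse x ^ (m - 1) * (- (inverse x)\<^sup>2) * exp (- inverse x)
          + inverse x ^ m * (exp (- inverse x) * (inverse x)\<^sup>2)
        = flat (m + 2) x - of_nat m * flat (m + 1) x"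
      using 3 by (cases m) (simp_all add: flat_def power2_eq_square)
    finally show ?thesis
      by (rule has_field_derivative_transform_within_open[where S="{0<..}"])
         (use 3 in \<open>auto simp: flat_def\<close>)
  qed
qed

definition step_denominator :: "real \<Rightarrow> real" where
  "step_denominator x = flat 0 x + flat 0 (1 - x)"

text \<open>One of \<open>x\<close> and \<open>1 - x\<close> is at least 1/2, and
  \<open>flat 0\<close> is at least \<open>exp (- 2)\<close> there. A uniform lower bound is needed
  for the reciprocal to be bounded.\<close>

lemma step_denominator_ge: "exp (- 2) \<le> step_denominator x"
proof -
  have "exp (- 2) \<le> flat 0 y" if "y \<ge> 1/2" for y
    using that by (auto simp: flat_def field_simps)
  from this[of x] this[of "1 - x"] show ?thesis
    using flat_nonneg[of 0 x] flat_nonneg[of 0 "1 - x"]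
    by (cases "x \<ge> 1/2") (auto simp: step_denominator_def)
qed

lemma step_denominator_pos: "0 < step_denominator x"
  using step_denominator_ge[of x] exp_gt_zero[of "-2::real"] by linarith

text \<open>An algebra of bounded functions, closed under differentiation, that contains the step
  function. It bounds every derivative of the step without a formula for it.\<close>

inductive_set step_class :: "(real \<Rightarrow> real) set" where
  const: "(\<lambda>x. c) \<in> step_class"
| flat: "flat m \<in> step_class"
| flat_reflected: "(\<lambda>x. flat m (1 - x)) \<in> step_class"
| inv: "(\<lambda>x. inverse (step_denominator x)) \<in> step_class"
| add: "f \<in> step_class \<Longrightarrow> g \<in> step_class \<Longrightarrow> (\<lambda>x. f x + g x) \<in> step_class"
| mult: "f \<in> step_class \<Longrightarrow> g \<in> step_class \<Longrightarrow> (\<lambda>x. f x * g x) \<in> step_class"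

lemma step_class_bounded: "f \<in> step_class \<Longrightarrow> \<exists>B. \<forall>x. \<bar>f x\<bar> \<le> B"
proof (induction rule: step_class.induct)
  case (flat m)
  then show ?case using flat_le[of m] flat_nonneg[of m] by (metis abs_of_nonneg)
next
  case (flat_reflected m)
  then show ?case using flat_le[of m] flat_nonneg[of m] by (metis abs_of_nonneg)
next
  case inv
  have "\<bar>inverse (step_denominator x)\<bar> \<le> inverse (exp (-2))" for x
    using step_denominator_ge[of x] step_denominator_pos[of x] by (simp add: le_imp_inverse_le)
  then show ?case by blast
next
  case (add f g)
  then obtain B C where "\<And>x. \<bar>f x\<bar> \<le> B" "\<And>x. \<bar>g x\<bar> \<le> C" by blast
  then have "\<bar>f x + g x\<bar> \<le> B + C" for x
    using abs_triangle_ineq[of "f x" "g x"] add_mono order_trans by metis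
  then show ?case by blast
next
  case (mult f g)
  then obtain B C where BC: "\<And>x. \<bar>f x\<bar> \<le> B" "\<And>x. \<bar>g x\<bar> \<le> C" by blast
  then have "0 \<le> B" using abs_ge_zero order_trans by blast
  with BC have "\<bar>f x * g x\<bar> \<le> B * C" for x
    by (simp add: abs_mult mult_mono)
  then show ?case by blast
qed blast

lemma step_class_derivative:
  "f \<in> step_class \<Longrightarrow> \<exists>f'\<in>step_class. \<forall>x. (f has_real_derivative f' x) (at x)"
proof (induction rule: step_class.induct)
  case (const c)
  show ?case by (rule bexI[OF _ step_class.const[of 0]]) simp
next
  case (flat m)
  have "(\<lambda>x. flat (m + 2) x + (- of_nat m) * flat (m + 1) x) \<in> step_class"
    by (intro step_class.intros)
  then show ?case by (rule bexI[rotated]) (use flat_has_derivative in simp)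
next
  case (flat_reflected m)
  have "(\<lambda>x. of_nat m * flat (m + 1) (1 - x) + (- 1) * flat (m + 2) (1 - x)) \<in> step_class"
    by (intro step_class.intros)
  moreover have "((\<lambda>x. flat m (1 - x)) has_real_derivative
      of_nat m * flat (m + 1) (1 - x) + (- 1) * flat (m + 2) (1 - x)) (at x)" for x
    by (rule DERIV_cong[OF DERIV_chain2[OF flat_has_derivative]])
       (auto intro!: derivative_eq_intros simp: algebra_simps)
  ultimately show ?case by (intro bexI) auto
next
  case inv
  let ?d = "\<lambda>x. flat 2 x + (- 1) * flat 2 (1 - x)"
  let ?i = "\<lambda>x. inverse (step_denominator x)"
  have "(\<lambda>x. (- 1) * (?d x * (?i x * ?i x))) \<in> step_class"
    by (intro step_class.intros)
  moreover have "(?i has_real_derivative (- 1) * (?d x * (?i x * ?i x))) (at x)" for x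
  proof -
    have "((\<lambda>x. flat 0 (1 - x)) has_real_derivative (- 1) * flat 2 (1 - x)) (at x)"
      by (rule DERIV_cong[OF DERIV_chain2[OF flat_has_derivative]])
         (auto intro!: derivative_eq_intros simp: numeral_2_eq_2)
    moreover have "(flat 0 has_real_derivative flat 2 x) (at x)"
      using flat_has_derivative[of 0 x] by (simp add: numeral_2_eq_2)
    ultimately have "(step_denominator has_real_derivative ?d x) (at x)"
      unfolding step_denominator_def by (intro DERIV_add)
    from DERIV_inverse'[OF this] show ?thesis
      using step_denominator_pos[of x] by (simp add: algebra_simps)
  qed
  ultimately show ?case by (intro bexI) auto
next
  case (add f g)
  then obtain f' g' where "f' \<in> step_class" "g' \<in> step_class"
    "\<And>x. (f has_real_derivative f' x) (at x)" "\<And>x. (g has_real_derivative g' x) (at x)"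
    by blast
  then show ?case
    by (intro bexI[of _ "\<lambda>x. f' x + g' x"]) (auto intro: step_class.add DERIV_add)
next
  case (mult f g)
  then obtain f' g' where 1: "f' \<in> step_class" "g' \<in> step_class"
    and 2: "\<And>x. (f has_real_derivative f' x) (at x)" "\<And>x. (g has_real_derivative g' x) (at x)"
    by blast
  have "(\<lambda>x. f' x * g x + g' x * f x) \<in> step_class"
    using 1 mult.hyps by (intro step_class.intros)
  with DERIV_mult[OF 2] show ?case by (intro bexI) auto
qed

text \<open>The function is \<open>flat 0 x / (flat 0 x + flat 0 (1 - x))\<close>, and
  \<open>\<sigma> k\<close> is its \<open>k\<close>-th derivative. With the whole sequence at hand,
  a cutoff is differentiated by raising an index.\<close>

lemma smooth_step_exists:
  "\<exists>\<sigma> :: nat \<Rightarrow> real \<Rightarrow> real. (\<forall>x\<le>0. \<sigma> 0 x = 0) \<and> (\<forall>x\<ge>1. \<sigma> 0 x = 1) \<and>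
     (\<forall>x. 0 \<le> \<sigma> 0 x \<and> \<sigma> 0 x \<le> 1) \<and>
     (\<forall>k x. (\<sigma> k has_real_derivative \<sigma> (Suc k) x) (at x)) \<and>
     (\<forall>k. \<exists>B. \<forall>x. \<bar>\<sigma> k x\<bar> \<le> B)"
proof -
  define s where "s = (\<lambda>x. flat 0 x * inverse (step_denominator x))"
  have s: "s \<in> step_class" unfolding s_def by (intro step_class.intros)
  obtain D where D: "\<And>f. f \<in> step_class \<Longrightarrow> D f \<in> step_class"
    "\<And>f x. f \<in> step_class \<Longrightarrow> (f has_real_derivative D f x) (at x)"
    using step_class_derivative by metis
  define \<sigma> where "\<sigma> k = (D ^^ k) s" for k
  have mem: "\<sigma> k \<in> step_class" for k
    by (induction k) (simp_all add: \<sigma>_def s D(1))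
  have "s x = 0" if "x \<le> 0" for x using that by (simp add: s_def flat_def)
  moreover have "s x = 1" if "x \<ge> 1" for x
    using that step_denominator_pos[of x]
    by (simp add: s_def step_denominator_def flat_def)
  moreover have "0 \<le> s x" "s x \<le> 1" for x
    using step_denominator_pos[of x] flat_nonneg[of 0 x] flat_nonneg[of 0 "1 - x"]
    by (auto simp: s_def divide_inverse[symmetric] step_denominator_def intro!: divide_nonneg_pos)
  moreover have "(\<sigma> k has_real_derivative \<sigma> (Suc k) x) (at x)" for k x
    using D(2)[OF mem[of k], of x] by (simp add: \<sigma>_def)
  moreover have "\<exists>B. \<forall>x. \<bar>\<sigma> k x\<bar> \<le> B" for k
    by (rule step_class_bounded[OF mem])
  moreover have "\<sigma> 0 = s" by (simp add: \<sigma>_def)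
  ultimately show ?thesis by (intro exI[of _ \<sigma>]) auto
qed

section \<open>Function families closed under partial derivatives\<close>

text \<open>Differentiability is bundled with the value because \<open>partial\<close> is a total
  function, while the sum, product and chain rules need differentiability at the point.\<close>

definition has_partial :: "'n::finite \<Rightarrow> (real ^ 'n \<Rightarrow> complex) \<Rightarrow> complex \<Rightarrow> real ^ 'n \<Rightarrow> bool" where
  "has_partial i f d x \<longleftrightarrow> f differentiable at x \<and> partial i f x = d"

lemma has_partialI:
  "(f has_derivative f') (at x) \<Longrightarrow> f' (axis i 1) = d \<Longrightarrow> has_partial i f d x"
  by (auto simp: has_partial_def differentiable_def partialI)

lemma has_partial_imp_derivative:
  assumes "has_partial i f d x"
  obtains f' where "(f has_derivative f') (at x)" "f' (axis i 1) = d"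
  using assms partial_has_derivative[of f x] unfolding has_partial_def partial_def by blast

lemma has_partial_eq_rhs: "has_partial i f d x \<Longrightarrow> d = e \<Longrightarrow> has_partial i f e x"
  by simp

lemma has_partial_const: "has_partial i (\<lambda>x. c) 0 x"
  by (rule has_partialI[OF has_derivative_const]) simp

lemma has_partial_add:
  assumes "has_partial i f d x" "has_partial i g e x"
  shows "has_partial i (\<lambda>x. f x + g x) (d + e) x"
proof -
  obtain f' g' where f': "(f has_derivative f') (at x)" "f' (axis i 1) = d"
    and g': "(g has_derivative g') (at x)" "g' (axis i 1) = e"
    using assms by (meson has_partial_imp_derivative)
  show ?thesis
    by (rule has_partialI[OF has_derivative_add[OF f'(1) g'(1)]]) (simp add: f'(2) g'(2))
qed

lemma has_partial_mult:
  assumes "has_partial i f d x" "has_partial i g e x"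
  shows "has_partial i (\<lambda>x. f x * g x) (d * g x + f x * e) x"
proof -
  obtain f' g' where f': "(f has_derivative f') (at x)" "f' (axis i 1) = d"
    and g': "(g has_derivative g') (at x)" "g' (axis i 1) = e"
    using assms by (meson has_partial_imp_derivative)
  show ?thesis
    by (rule has_partialI[OF has_derivative_mult[OF f'(1) g'(1)]]) (simp add: f'(2) g'(2))
qed

lemma has_partial_compose:
  assumes "has_partial i f d x" "(G has_field_derivative D) (at (f x))"
  shows "has_partial i (\<lambda>x. G (f x)) (D * d) x"
proof -
  obtain f' where f': "(f has_derivative f') (at x)" "f' (axis i 1) = d"
    using assms(1) by (meson has_partial_imp_derivative)
  show ?thesis
    by (rule has_partialI[OF has_derivative_compose[OF f'(1)
            has_field_derivative_imp_has_derivative[OF assms(2)]]])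
       (simp add: f'(2))
qed

lemma has_partial_coord:
  fixes G :: "real \<Rightarrow> real"
  assumes "(G has_real_derivative D) (at (x $ j))"
  shows "has_partial i (\<lambda>x. complex_of_real (G (x $ j))) (if i = j then of_real D else 0) x"
proof -
  have "((\<lambda>x. x $ j) has_derivative (\<lambda>h. h $ j)) (at x)"
    by (intro bounded_linear_imp_has_derivative bounded_linear_vec_nth)
  from has_derivative_compose[OF this has_field_derivative_imp_has_derivative[OF assms]]
  have "((\<lambda>x. G (x $ j)) has_derivative (\<lambda>h. D * h $ j)) (at x)" .
  from has_derivative_compose[OF this bounded_linear_imp_has_derivative[OF bounded_linear_of_real]]
  have "((\<lambda>x. complex_of_real (G (x $ j))) has_derivative (\<lambda>h. of_real (D * h $ j))) (at x)" .
  then show ?thesis by (rule has_partialI) (auto simp: axis_def)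
qed

lemma has_partial_cong:
  assumes "open U" "x \<in> U" "\<And>y. y \<in> U \<Longrightarrow> f y = g y" "has_partial i g d x"
  shows "has_partial i f d x"
proof -
  obtain g' where g': "(g has_derivative g') (at x)" "g' (axis i 1) = d"
    using assms(4) by (meson has_partial_imp_derivative)
  have "(f has_derivative g') (at x)"
    by (rule has_derivative_transform_within_open[OF g'(1) assms(1,2)]) (simp add: assms(3))
  then show ?thesis using g'(2) by (rule has_partialI)
qed

text \<open>The members are families indexed by a parameter, and the derivative family
  \<open>g'\<close> is chosen before \<open>p\<close>. This order of quantifiers makes the later
  constants and exponents uniform in \<open>p\<close>.\<close>

definition partial_closed ::
  "(real ^ 'n::finite) set \<Rightarrow> ('p \<Rightarrow> real ^ 'n \<Rightarrow> complex) set \<Rightarrow> bool" where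
  "partial_closed U T \<longleftrightarrow>
    (\<forall>g\<in>T. \<forall>i. \<exists>g'\<in>T. \<forall>p. \<forall>x\<in>U. has_partial i (g p) (g' p x) x)"

text \<open>Asking for equality on the open set \<open>U\<close> alone is enough for the induction
  and makes the result applicable to extensions by zero.\<close>

lemma partial_closed_partials:
  assumes T: "partial_closed U T" and U: "open U" and g: "g \<in> T"
  shows "\<exists>g'\<in>T. \<forall>p f. (\<forall>x\<in>U. f x = g p x) \<longrightarrow> (\<forall>x\<in>U. partials w f x = g' p x)"
proof (induction w)
  case Nil
  show ?case using g by auto
next
  case (Cons i w)
  then obtain g' where g': "g' \<in> T"
    "\<And>p f x. (\<And>x. x \<in> U \<Longrightarrow> f x = g p x) \<Longrightarrow> x \<in> U \<Longrightarrow> partials w f x = g' p x"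
    by blast
  then obtain g'' where g'': "g'' \<in> T" "\<And>p x. x \<in> U \<Longrightarrow> has_partial i (g' p) (g'' p x) x"
    using T unfolding partial_closed_def by blast
  have "partials (i # w) f x = g'' p x" if "\<And>x. x \<in> U \<Longrightarrow> f x = g p x" "x \<in> U" for p f x
    using has_partial_cong[OF U that(2) g'(2)[OF that(1)] g''(2)[OF that(2)]]
    by (simp add: has_partial_def)
  then show ?case using g''(1) by blast
qed

text \<open>On \<open>U\<close> the iterated partials belong to the family; on the open complement
  of \<open>S\<close> they vanish identically. Since \<open>S \<subseteq> U\<close>, these two open
  sets cover the space.\<close>

lemma partial_closed_smooth:
  assumes T: "partial_closed U T" and U: "open U" and g: "g \<in> T"
    and S: "closed S" "S \<subseteq> U"
    and f: "\<And>x. x \<in> U \<Longrightarrow> f x = g p x" "\<And>x. x \<notin> S \<Longrightarrow> f x = 0"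
  shows "smooth f"
  unfolding smooth_def
proof (intro allI)
  fix w x
  show "partials w f differentiable at x"
  proof (cases "x \<in> U")
    case True
    obtain g' where g': "g' \<in> T" "\<And>x. x \<in> U \<Longrightarrow> partials w f x = g' p x"
      using partial_closed_partials[OF T U g, of w] f(1) by metis
    \<comment> \<open>Any coordinate serves here, as only differentiability is extracted.\<close>
    then obtain g'' where "has_partial undefined (g' p) (g'' p x) x"
      using T True unfolding partial_closed_def by blast
    with has_partial_cong[OF U True g'(2)] show ?thesis
      by (auto simp: has_partial_def)
  next
    case False
    then have "x \<in> - S" using S by auto
    have "((\<lambda>x. 0) has_derivative (\<lambda>h. 0)) (at x)" by simp
    then have "(partials w f has_derivative (\<lambda>h. 0)) (at x)"
      by (rule has_derivative_transform_within_open[where s="- S"])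
         (use \<open>x \<in> - S\<close> S partials_vanish[OF S(1) f(2)] in auto)
    then show ?thesis by (auto simp: differentiable_def)
  qed
qed

definition moderate ::
  "('p \<Rightarrow> 'a \<Rightarrow> real) \<Rightarrow> ('p \<Rightarrow> 'a set) \<Rightarrow> ('p \<Rightarrow> 'a \<Rightarrow> complex) \<Rightarrow> bool" where
  "moderate W R h \<longleftrightarrow> (\<exists>C\<ge>0. \<exists>m. \<forall>p. \<forall>x\<in>R p. norm (h p x) \<le> C * W p x ^ m)"

lemma moderateI:
  assumes "\<And>p x. x \<in> R p \<Longrightarrow> norm (h p x) \<le> C * W p x ^ m" "0 \<le> C"
  shows "moderate W R h"
  using assms unfolding moderate_def by blast

lemma moderate_add:
  assumes W: "\<And>p x. x \<in> R p \<Longrightarrow> 1 \<le> W p x" and "moderate W R f" "moderate W R g"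
  shows "moderate W R (\<lambda>p x. f p x + g p x)"
proof -
  obtain C m D n where C: "C \<ge> 0" and D: "D \<ge> 0"
    and f: "\<And>p x. x \<in> R p \<Longrightarrow> norm (f p x) \<le> C * W p x ^ m"
    and g: "\<And>p x. x \<in> R p \<Longrightarrow> norm (g p x) \<le> D * W p x ^ n"
    using assms(2,3) unfolding moderate_def by blast
  show ?thesis
  proof (rule moderateI)
    fix p x assume x: "x \<in> R p"
    have "W p x ^ m \<le> W p x ^ (m + n)" "W p x ^ n \<le> W p x ^ (m + n)"
      by (intro power_increasing W[OF x]; simp)+
    then have "C * W p x ^ m + D * W p x ^ n \<le> C * W p x ^ (m + n) + D * W p x ^ (m + n)"
      using C D by (intro add_mono mult_left_mono)
    then show "norm (f p x + g p x) \<le> (C + D) * W p x ^ (m + n)"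
      using f[OF x] g[OF x] norm_triangle_ineq[of "f p x" "g p x"] by (simp add: distrib_right)
  qed (use C D in simp)
qed

lemma moderate_mult:
  assumes "moderate W R f" "moderate W R g"
  shows "moderate W R (\<lambda>p x. f p x * g p x)"
proof -
  obtain C m D n where C: "C \<ge> 0" and D: "D \<ge> 0"
    and f: "\<And>p x. x \<in> R p \<Longrightarrow> norm (f p x) \<le> C * W p x ^ m"
    and g: "\<And>p x. x \<in> R p \<Longrightarrow> norm (g p x) \<le> D * W p x ^ n"
    using assms unfolding moderate_def by blast
  show ?thesis
  proof (rule moderateI)
    fix p x assume x: "x \<in> R p"
    have "norm (f p x) * norm (g p x) \<le> (C * W p x ^ m) * (D * W p x ^ n)"
      using f[OF x] g[OF x] by (intro mult_mono) (auto intro: order_trans[OF norm_ge_zero])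
    then show "norm (f p x * g p x) \<le> (C * D) * W p x ^ (m + n)"
      by (simp add: norm_mult power_add mult_ac)
  qed (use C D in simp)
qed

text \<open>The exponent \<open>m\<close> depends on the family and on \<open>N\<close>, but not on the parameter \<open>p\<close>.\<close>

lemma partial_closed_test_norm:
  fixes g :: "'p \<Rightarrow> real ^ 'n::finite \<Rightarrow> complex" and V :: "'p \<Rightarrow> real ^ 'n \<Rightarrow> real"
  assumes T: "partial_closed U T" and U: "open U" and g: "g \<in> T"
    and W: "\<And>p x. x \<in> R p \<Longrightarrow> 1 \<le> W p x" and V: "\<And>p x. 0 \<le> V p x"
    and bound: "\<And>g. g \<in> T \<Longrightarrow> \<exists>C\<ge>0. \<exists>m. \<forall>p. \<forall>x\<in>R p. norm (g p x) \<le> C * (V p x * W p x ^ m)"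
  obtains C m where "C \<ge> 0"
    "\<And>p \<phi> S B. closed S \<Longrightarrow> S \<subseteq> U \<inter> R p \<Longrightarrow> (\<And>x. x \<in> U \<Longrightarrow> test_apply \<phi> x = g p x) \<Longrightarrow>
      (\<And>x. x \<notin> S \<Longrightarrow> test_apply \<phi> x = 0) \<Longrightarrow> (\<And>x. x \<in> S \<Longrightarrow> V p x * W p x ^ m \<le> B) \<Longrightarrow>
      0 \<le> B \<Longrightarrow> test_norm N \<phi> \<le> C * B"
proof -
  have "\<exists>C m. C \<ge> 0 \<and> (\<forall>p f x. (\<forall>x\<in>U. f x = g p x) \<longrightarrow> x \<in> U \<inter> R p \<longrightarrow>
      norm (partials w f x) \<le> C * (V p x * W p x ^ m))" for w
    using partial_closed_partials[OF T U g, of w] bound by (metis IntE)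
  then obtain C m where C: "\<And>w. C w \<ge> 0"
    and le: "\<And>w p f x. (\<And>x. x \<in> U \<Longrightarrow> f x = g p x) \<Longrightarrow> x \<in> U \<inter> R p \<Longrightarrow>
      norm (partials w f x) \<le> C w * (V p x * W p x ^ m w)"
    by metis
  let ?A = "{w :: 'n list. length w \<le> N}"
  \<comment> \<open>The sum of the exponents is a common exponent for all words of length at most
    \<open>N\<close>; raising an exponent is harmless since \<open>W\<close> is at least 1 on
    \<open>R p\<close>.\<close>
  define M where "M = sum m ?A"
  have m: "m w \<le> M" if "w \<in> ?A" for w
    unfolding M_def using that by (intro member_le_sum finite_words) auto
  show ?thesis
  proof (rule that[of "sum C ?A" M])
    show "0 \<le> sum C ?A" by (intro sum_nonneg C)
    fix p \<phi> S B
    assume S: "closed S" "S \<subseteq> U \<inter> R p" and eq: "\<And>x. x \<in> U \<Longrightarrow> test_apply \<phi> x = g p x"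
      and z: "\<And>x. x \<notin> S \<Longrightarrow> test_apply \<phi> x = 0"
      and B: "\<And>x. x \<in> S \<Longrightarrow> V p x * W p x ^ M \<le> B" "0 \<le> B"
    have "test_norm N \<phi> \<le> (\<Sum>w\<in>?A. C w * B)"
    proof (rule test_norm_bound)
      fix w x assume w: "length (w :: 'n list) \<le> N"
      show "norm (partials w (test_apply \<phi>) x) \<le> C w * B"
      proof (cases "x \<in> S")
        case True
        then have x: "x \<in> U \<inter> R p" using S by blast
        have "V p x * W p x ^ m w \<le> V p x * W p x ^ M"
          using m[of w] w x by (intro mult_left_mono power_increasing W V) auto
        also have "\<dots> \<le> B" by (rule B(1)[OF True])
        finally have "C w * (V p x * W p x ^ m w) \<le> C w * B" using C by (intro mult_left_mono)
        with le[OF eq x] show ?thesis by (meson order_trans)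
      next
        case False
        then have "partials w (test_apply \<phi>) x = 0" by (intro partials_vanish[OF S(1) z])
        then show ?thesis by (simp add: C B(2))
      qed
    qed
    then show "test_norm N \<phi> \<le> sum C ?A * B" by (simp add: sum_distrib_right)
  qed
qed

section \<open>The operator and its transpose\<close>

text \<open>All factors other than the one at \<open>i\<close> are zeroth powers, so the fold
  collapses to a single step.\<close>

lemma theta_monomial_single:
  "theta_monomial (Poly_Mapping.single i k) u = (theta i ^^ k) u"
proof -
  let ?f = "\<lambda>j. theta j ^^ Poly_Mapping.lookup (Poly_Mapping.single i k) j"
  interpret comp_fun_commute ?f by (rule comp_fun_commute_theta_power)
  have "Finite_Set.fold ?f u A = u" if "finite A" "A \<subseteq> - {i}" for A
    using that
  proof induction
    case (insert j A)
    have "Finite_Set.fold ?f u (insert j A) = ?f j (Finite_Set.fold ?f u A)"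
      using insert.hyps by (rule fold_insert)
    moreover have "Poly_Mapping.lookup (Poly_Mapping.single i k) j = 0"
      using insert.prems by (auto simp: lookup_single)
    ultimately show ?case using insert by simp
  qed simp
  then have "Finite_Set.fold ?f u (insert i (- {i})) = ?f i u" by simp
  moreover have "insert i (- {i}) = UNIV" by auto
  ultimately show ?thesis by (simp add: theta_monomial_def lookup_single)
qed

definition schroedinger_poly :: "'n::finite \<Rightarrow> 'n \<Rightarrow> ('n \<Rightarrow>\<^sub>0 nat) \<Rightarrow>\<^sub>0 complex" where
  "schroedinger_poly a b = Poly_Mapping.single (Poly_Mapping.single a 2) 1
     + Poly_Mapping.single (Poly_Mapping.single b 1) (- \<i>)"

lemma single_two_ne_one: "Poly_Mapping.single a (2::nat) \<noteq> Poly_Mapping.single b 1"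
proof
  assume "Poly_Mapping.single a (2::nat) = Poly_Mapping.single b 1"
  then have "Poly_Mapping.lookup (Poly_Mapping.single a (2::nat)) a = Poly_Mapping.lookup (Poly_Mapping.single b 1) a"
    by simp
  then show False by (simp add: lookup_single when_def split: if_splits)
qed

lemma lookup_schroedinger_poly:
  "Poly_Mapping.lookup (schroedinger_poly a b) \<alpha> =
    (if \<alpha> = Poly_Mapping.single a 2 then 1 else if \<alpha> = Poly_Mapping.single b 1 then - \<i> else 0)"
  using single_two_ne_one[of a b]
  by (auto simp: schroedinger_poly_def lookup_add lookup_single when_def)

lemma keys_schroedinger_poly:
  "Poly_Mapping.keys (schroedinger_poly a b) = {Poly_Mapping.single a 2, Poly_Mapping.single b 1}"
  by (auto simp: in_keys_iff lookup_schroedinger_poly split: if_splits)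

lemma dist_apply_theta:
  "dist_apply (theta j u) \<phi> = - dist_apply u (test_partial j (test_coord_mult j \<phi>))"
  by (simp add: theta_def dist_coord_mult.rep_eq dist_partial.rep_eq)

lemma dist_apply_add: "dist_apply u (\<phi> + \<psi>) = dist_apply u \<phi> + dist_apply u \<psi>"
  and dist_apply_scale: "dist_apply u (test_scale c \<phi>) = c * dist_apply u \<phi>"
  and dist_apply_continuous: "distribution_continuous (dist_apply u)"
  using dist_apply[of u] by auto

text \<open>The transpose of \<open>theta j\<close> is minus multiplication by \<open>x_j\<close>
  followed by the partial derivative. The signs cancel in the square, and the single sign in
  direction \<open>b\<close> turns \<open>- \<i>\<close> into \<open>\<i>\<close>.\<close>

lemma dist_apply_schroedinger:
  "dist_apply (euler_operator (schroedinger_poly a b) u) \<phi> = dist_apply u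
    (test_partial a (test_coord_mult a (test_partial a (test_coord_mult a \<phi>)))
     + test_scale \<i> (test_partial b (test_coord_mult b \<phi>)))"
  using single_two_ne_one[of a b]
  by (simp add: euler_operator_def keys_schroedinger_poly lookup_schroedinger_poly
      theta_monomial_single numeral_2_eq_2 plus_distribution.rep_eq dist_scale.rep_eq
      dist_apply_theta dist_apply_add dist_apply_scale)

section \<open>A distribution of unbounded order\<close>

definition taylor_rem :: "'n::finite \<Rightarrow> real ^ 'n \<Rightarrow> nat \<Rightarrow> (real ^ 'n \<Rightarrow> complex) \<Rightarrow> real \<Rightarrow> complex" where
  "taylor_rem a x k f s = f (x + s *\<^sub>R axis a 1) - (\<Sum>i<k. (s ^ i / fact i) *\<^sub>R partials (replicate i a) f x)"

lemma partials_replicate_Suc: "partials (replicate (Suc i) a) f = partials (replicate i a) (partial a f)"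
  using partials_append[of "replicate i a" "[a]" f] by (simp add: replicate_append_same del: partials_append)

text \<open>The constant term drops out and the other terms shift by one, so differentiation lowers
  the order and replaces \<open>f\<close> by \<open>partial a f\<close>.\<close>

lemma taylor_rem_has_derivative:
  assumes f: "smooth f"
  shows "(taylor_rem a x (Suc k) f has_vector_derivative taylor_rem a x k (partial a f) s) (at s)"
proof -
  have "(\<Sum>i<Suc k. (s ^ i / fact i) *\<^sub>R partials (replicate i a) f x) =
    f x + (\<Sum>i<k. (s ^ Suc i / fact (Suc i)) *\<^sub>R partials (replicate i a) (partial a f) x)" for s :: real
    by (subst sum.lessThan_Suc_shift) (simp del: replicate_Suc fact_Suc add: partials_replicate_Suc)
  then have eq: "taylor_rem a x (Suc k) f = (\<lambda>s. f (x + s *\<^sub>R axis a 1) -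
    (f x + (\<Sum>i<k. (s ^ Suc i / fact (Suc i)) *\<^sub>R partials (replicate i a) (partial a f) x)))"
    by (simp add: taylor_rem_def fun_eq_iff)
  have "((\<lambda>s. s ^ Suc i / fact (Suc i)) has_real_derivative s ^ i / fact i) (at s)" for i
    by (rule DERIV_cong[OF DERIV_cdivide[OF DERIV_pow]]) (simp add: fact_Suc del: of_nat_Suc)
  then have "((\<lambda>s. \<Sum>i<k. (s ^ Suc i / fact (Suc i)) *\<^sub>R partials (replicate i a) (partial a f) x)
      has_vector_derivative (\<Sum>i<k. (s ^ i / fact i) *\<^sub>R partials (replicate i a) (partial a f) x)) (at s)"
    by (intro has_vector_derivative_sum has_vector_derivative_scaleR[where g'=0, simplified]) auto
  then have "(taylor_rem a x (Suc k) f has_vector_derivative partial a f (x + s *\<^sub>R axis a 1) -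
      (0 + (\<Sum>i<k. (s ^ i / fact i) *\<^sub>R partials (replicate i a) (partial a f) x))) (at s)"
    unfolding eq
    by (intro has_vector_derivative_diff has_vector_derivative_add has_vector_derivative_const
        partial_has_vector_derivative smooth_differentiable f)
  then show ?thesis by (simp add: taylor_rem_def)
qed

text \<open>Induction on the order through the mean value inequality. The usual factor
  \<open>1 / fact k\<close> is given away, as only the power of \<open>s\<close> matters for
  convergence.\<close>

lemma taylor_rem_bound:
  assumes "smooth f" "\<And>y. norm (partials (replicate k a) f y) \<le> M" "0 \<le> s"
  shows "norm (taylor_rem a x k f s) \<le> M * s ^ k"
  using assms
proof (induction k arbitrary: f s)
  case 0
  then show ?case by (simp add: taylor_rem_def)
next
  case (Suc k)
  have M: "0 \<le> M" using Suc.prems(2) norm_ge_zero order_trans by blast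
  have IH: "norm (taylor_rem a x k (partial a f) t) \<le> M * t ^ k" if "0 \<le> t" for t
    by (rule Suc.IH)
       (use Suc.prems that in \<open>simp_all add: smooth_partial flip: partials_replicate_Suc\<close>)
  note D = taylor_rem_has_derivative[OF Suc.prems(1)]
  have 0: "taylor_rem a x (Suc k) f 0 = 0"
    by (simp add: taylor_rem_def sum.lessThan_Suc_shift del: sum.lessThan_Suc)
  show ?case
  proof (cases "s = 0")
    case False
    have "norm (taylor_rem a x (Suc k) f s - taylor_rem a x (Suc k) f 0) \<le> M * s ^ Suc k - M * 0 ^ Suc k"
    proof (rule differentiable_bound_general[where
          f'="taylor_rem a x k (partial a f)" and \<phi>'="\<lambda>t. M * (of_nat (Suc k) * t ^ k)"])
      show "0 < s" using False Suc.prems by simp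
      show "continuous_on {0..s} (taylor_rem a x (Suc k) f)"
        using D by (meson continuous_at_imp_continuous_on has_vector_derivative_continuous)
      show "continuous_on {0..s} (\<lambda>t. M * t ^ Suc k)" by (intro continuous_intros)
      fix t assume t: "0 < t" "t < s"
      show "(taylor_rem a x (Suc k) f has_vector_derivative taylor_rem a x k (partial a f) t) (at t)"
        by (rule D)
      have "((\<lambda>t. M * t ^ Suc k) has_real_derivative M * (of_nat (Suc k) * t ^ k)) (at t)"
        by (rule DERIV_cong[OF DERIV_cmult[OF DERIV_pow]]) simp
      then show "((\<lambda>t. M * t ^ Suc k) has_vector_derivative M * (of_nat (Suc k) * t ^ k)) (at t)"
        by (simp add: has_real_derivative_iff_has_vector_derivative)
      have "M * t ^ k * 1 \<le> M * t ^ k * of_nat (Suc k)" using M t by (intro mult_left_mono) auto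
      with IH[of t] t show "norm (taylor_rem a x k (partial a f) t) \<le> M * (of_nat (Suc k) * t ^ k)"
        by (simp add: mult_ac)
    qed
    then show ?thesis using 0 by simp
  qed (simp add: 0)
qed

section \<open>A locally finite family of orders at points of the face
  \<open>x_a = 0\<close>\<close>

definition base :: "'n::finite \<Rightarrow> 'n \<Rightarrow> nat \<Rightarrow> real ^ 'n" where
  "base a b j = vec_lambda (\<lambda>i. if i = a then 0 else if i = b then exp (real j) else 1)"

text \<open>Every level occurs for infinitely many \<open>n\<close>, since the second component of
  the pair is free. So each base point is tested at arbitrarily small scales.\<close>

definition level :: "nat \<Rightarrow> nat" where
  "level n = fst (prod_decode n)"

definition order_at :: "nat \<Rightarrow> nat" where
  "order_at n = (level n + 2)\<^sup>2"

text \<open>Factorial growth gives \<open>real n * scale_at m \<le> scale_at n\<close> for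
  \<open>m < n\<close>. Thus in a test at scale \<open>n\<close> the earlier terms stay
  comparatively small, and the later ones sit too close to \<open>x_a = 0\<close> to be
  seen.\<close>

definition scale_at :: "nat \<Rightarrow> real" where
  "scale_at n = fact n"

text \<open>
  Near \<open>base a b j\<close> the distribution has order at least \<open>(j + 2)\<^sup>2\<close>; subtracting the Taylor
  polynomials makes the sum of the point masses converge.
\<close>

definition comb_term :: "'n::finite \<Rightarrow> 'n \<Rightarrow> nat \<Rightarrow> 'n test_function \<Rightarrow> complex" where
  "comb_term a b n \<phi> = of_real (exp (real (order_at n) * scale_at n)) *
    taylor_rem a (base a b (level n)) (order_at n + 1) (test_apply \<phi>) (exp (- scale_at n))"

lemma scale_at_ge: "real n \<le> scale_at n" "1 \<le> scale_at n"
proof -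
  have "real n \<le> real (fact n)" by (simp only: of_nat_le_iff fact_ge_self)
  then show "real n \<le> scale_at n" by (simp add: scale_at_def)
  show "1 \<le> scale_at n" by (simp add: scale_at_def)
qed

text \<open>With \<open>k = order_at n\<close> and \<open>s = scale_at n\<close>, the remainder of
  order \<open>k + 1\<close> at distance \<open>exp (- s)\<close> supplies \<open>exp (- s)\<close>
  to the power \<open>k + 1\<close>, one factor more than the prefactor \<open>exp (k * s)\<close>
  uses up.\<close>

lemma comb_term_bound:
  "norm (comb_term a b n \<phi>) \<le> exp (- scale_at n) * test_norm (order_at n + 1) \<phi>"
proof -
  let ?k = "order_at n" and ?s = "scale_at n"
  have "norm (taylor_rem a (base a b (level n)) (?k + 1) (test_apply \<phi>) (exp (- ?s)))
      \<le> test_norm (?k + 1) \<phi> * exp (- ?s) ^ (?k + 1)"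
    by (rule taylor_rem_bound[OF test_smooth partials_le_test_norm]) simp_all
  then have "norm (comb_term a b n \<phi>) \<le>
      exp (real ?k * ?s) * (test_norm (?k + 1) \<phi> * exp (- ?s) ^ (?k + 1))"
    by (simp add: comb_term_def norm_mult)
  also have "exp (- ?s) ^ (?k + 1) = exp (real (?k + 1) * - ?s)"
    by (rule exp_of_nat_mult[symmetric])
  also have "real (?k + 1) * - ?s = - (real ?k * ?s) + - ?s" by (simp add: algebra_simps)
  also have "exp \<dots> = exp (- (real ?k * ?s)) * exp (- ?s)" by (rule exp_add)
  finally show ?thesis by (simp add: exp_minus field_simps)
qed

lemma comb_term_eq_0:
  assumes "closed K" "\<And>x. x \<notin> K \<Longrightarrow> test_apply \<phi> x = 0" "\<And>s. base a b (level n) + s *\<^sub>R axis a 1 \<notin> K"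
  shows "comb_term a b n \<phi> = 0"
  using partials_vanish[OF assms(1,2) assms(3)[of 0, simplified]] assms(2,3)
  by (simp add: comb_term_def taylor_rem_def)

text \<open>Terms of level above \<open>J\<close> live on lines with
  \<open>x_b = exp (level n)\<close>, which exceeds the radius of \<open>K\<close>, so they vanish.
  The other terms have order at most \<open>(J + 2)^2\<close>; this makes the order of the sum
  finite on each compact set although it is unbounded globally.\<close>

lemma comb_term_bound_compact:
  assumes ab: "a \<noteq> b" and K: "compact K"
  shows "\<exists>k. \<forall>\<phi>. test_supported_in K \<phi> \<longrightarrow> (\<forall>n. norm (comb_term a b n \<phi>) \<le> exp (- scale_at n) * test_norm k \<phi>)"
proof -
  obtain R where R: "\<And>x. x \<in> K \<Longrightarrow> norm x \<le> R"
    using compact_imp_bounded[OF K] bounded_iff by blast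
  obtain J :: nat where J: "R < real J" using reals_Archimedean2 by blast
  have "norm (comb_term a b n \<phi>) \<le> exp (- scale_at n) * test_norm ((J + 2)\<^sup>2 + 1) \<phi>"
    if \<phi>: "test_supported_in K \<phi>" for \<phi> n
  proof (cases "level n \<le> J")
    case True
    then have "order_at n + 1 \<le> (J + 2)\<^sup>2 + 1" by (auto simp: order_at_def intro!: power_mono)
    then have "exp (- scale_at n) * test_norm (order_at n + 1) \<phi> \<le>
        exp (- scale_at n) * test_norm ((J + 2)\<^sup>2 + 1) \<phi>"
      by (intro mult_left_mono test_norm_mono) auto
    with comb_term_bound[of a b n \<phi>] show ?thesis by linarith
  next
    case False
    have "base a b (level n) + s *\<^sub>R axis a 1 \<notin> K" for s
    proof
      assume "base a b (level n) + s *\<^sub>R axis a 1 \<in> K"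
      then have "\<bar>(base a b (level n) + s *\<^sub>R axis a 1) $ b\<bar> \<le> R"
        using R component_le_norm_cart order_trans by blast
      then have "exp (real (level n)) \<le> R" using ab by (simp add: base_def axis_def)
      moreover have "real (level n) \<le> exp (real (level n))"
        using exp_ge_add_one_self[of "real (level n)"] by linarith
      ultimately show False using J False by simp
    qed
    then have "comb_term a b n \<phi> = 0"
      using \<phi> compact_imp_closed[OF K] by (intro comb_term_eq_0[of K]) (auto simp: test_supported_in_iff)
    then show ?thesis by (simp add: test_norm_nonneg)
  qed
  then show ?thesis by blast
qed

lemma summable_scale: "summable (\<lambda>n. exp (- scale_at n))"
proof (rule summable_comparison_test'[of "\<lambda>n. exp (- 1) ^ n"])
  show "summable (\<lambda>n. exp (- 1 :: real) ^ n)" by (rule summable_geometric) simp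
  show "norm (exp (- scale_at n)) \<le> exp (- 1) ^ n" for n
    using scale_at_ge(1)[of n] by (simp flip: exp_of_nat_mult)
qed

lemma comb_term_summable:
  assumes "a \<noteq> b"
  shows "summable (\<lambda>n. norm (comb_term a b n \<phi>))"
proof -
  have "test_supported_in (closure (support_on UNIV (test_apply \<phi>))) \<phi>"
    by (simp add: test_supported_in_def)
  with comb_term_bound_compact[OF assms test_compact[of \<phi>]]
  obtain k where "\<And>n. norm (comb_term a b n \<phi>) \<le> exp (- scale_at n) * test_norm k \<phi>" by blast
  then show ?thesis
    by (intro summable_comparison_test'[OF summable_mult2[OF summable_scale, of "test_norm k \<phi>"]]) simp
qed

lemma taylor_rem_linear:
  "smooth f \<Longrightarrow> smooth g \<Longrightarrow>
    taylor_rem a x k (\<lambda>x. f x + g x) s = taylor_rem a x k f s + taylor_rem a x k g s"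
  "smooth f \<Longrightarrow> taylor_rem a x k (\<lambda>x. c * f x) s = c * taylor_rem a x k f s"
  by (simp_all add: taylor_rem_def partials_add partials_cmult scaleR_add_right sum.distrib
      sum_distrib_left right_diff_distrib)

lemma comb_term_linear:
  "comb_term a b n (\<phi> + \<psi>) = comb_term a b n \<phi> + comb_term a b n \<psi>"
  "comb_term a b n (test_scale c \<phi>) = c * comb_term a b n \<phi>"
  by (simp_all add: comb_term_def plus_test_function.rep_eq test_scale.rep_eq taylor_rem_linear
      test_smooth algebra_simps)

lemma comb_exists:
  assumes ab: "a \<noteq> b"
  shows "\<exists>T. \<forall>\<phi>. dist_apply T \<phi> = suminf (\<lambda>n. comb_term a b n \<phi>)"
proof -
  let ?T = "\<lambda>\<phi>. suminf (\<lambda>n. comb_term a b n \<phi>)"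
  note sm = summable_norm_cancel[OF comb_term_summable[OF ab]]
  have "?T (\<phi> + \<psi>) = ?T \<phi> + ?T \<psi>" for \<phi> \<psi>
    by (simp only: comb_term_linear) (rule suminf_add[OF sm sm, symmetric])
  moreover have "?T (test_scale c \<phi>) = c * ?T \<phi>" for c \<phi>
    by (simp only: comb_term_linear suminf_mult[OF sm])
  moreover have "distribution_continuous ?T"
  proof (rule distribution_continuousI)
    fix K :: "(real ^ 'a) set" assume "compact K"
    from comb_term_bound_compact[OF ab this] obtain k where "\<forall>\<phi>. test_supported_in K \<phi> \<longrightarrow>
        (\<forall>n. norm (comb_term a b n \<phi>) \<le> exp (- scale_at n) * test_norm k \<phi>)" ..
    then have k: "norm (comb_term a b n \<phi>) \<le> exp (- scale_at n) * test_norm k \<phi>"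
      if "test_supported_in K \<phi>" for \<phi> n using that by simp
    have "norm (?T \<phi>) \<le> suminf (\<lambda>n. exp (- scale_at n)) * test_norm k \<phi>" if "test_supported_in K \<phi>" for \<phi>
    proof -
      have "norm (?T \<phi>) \<le> suminf (\<lambda>n. norm (comb_term a b n \<phi>))"
        by (rule summable_norm[OF comb_term_summable[OF ab]])
      also have "\<dots> \<le> suminf (\<lambda>n. exp (- scale_at n) * test_norm k \<phi>)"
        by (intro suminf_le k that comb_term_summable ab summable_mult2 summable_scale)
      also have "\<dots> = suminf (\<lambda>n. exp (- scale_at n)) * test_norm k \<phi>"
        by (rule suminf_mult2[OF summable_scale, symmetric])
      finally show ?thesis .
    qed
    then show "\<exists>C N. \<forall>\<phi>. test_supported_in K \<phi> \<longrightarrow> norm (?T \<phi>) \<le> C * test_norm N \<phi>" by blast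
  qed
  ultimately have "dist_apply (Distribution ?T) = ?T" by (intro Distribution_inverse) auto
  then show ?thesis by metis
qed

section \<open>Gaussian beams\<close>

definition orthant :: "(real ^ 'n::finite) set" where
  "orthant = {x. \<forall>i. 0 < x $ i}"

definition logbox :: "('n::finite \<Rightarrow> real) \<Rightarrow> ('n \<Rightarrow> real) \<Rightarrow> (real ^ 'n) set" where
  "logbox l h = cbox (vec_lambda (\<lambda>i. exp (l i))) (vec_lambda (\<lambda>i. exp (h i)))"

lemma open_orthant: "open (orthant :: (real ^ 'n::finite) set)"
  unfolding orthant_def Collect_all_eq
  by (intro open_INT) (auto intro!: open_Collect_less continuous_intros)

lemma in_logbox_iff: "x \<in> logbox l h \<longleftrightarrow> x \<in> orthant \<and> (\<forall>i. l i \<le> ln (x $ i) \<and> ln (x $ i) \<le> h i)"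
proof -
  have "exp u \<le> y \<and> y \<le> exp v \<longleftrightarrow> 0 < y \<and> u \<le> ln y \<and> ln y \<le> v" for u v y :: real
    by (metis exp_gt_zero exp_ln ln_exp ln_le_cancel_iff order_less_le_trans)
  then show ?thesis
    unfolding logbox_def orthant_def mem_box_cart by auto
qed

lemma logbox_subset_orthant: "logbox l h \<subseteq> orthant"
  by (auto simp: in_logbox_iff)

lemma closed_logbox: "closed (logbox l h)"
  and compact_logbox: "compact (logbox l h)"
  unfolding logbox_def by (rule closed_cbox, rule compact_cbox)

text \<open>The step function is a parameter known only through the properties provided by
  \<open>smooth_step_exists\<close>.\<close>

locale beam =
  fixes a b :: "'n::finite" and \<sigma> :: "nat \<Rightarrow> real \<Rightarrow> real"
  assumes ab: "a \<noteq> b"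
    and step0: "\<And>x. x \<le> 0 \<Longrightarrow> \<sigma> 0 x = 0" and step1: "\<And>x. 1 \<le> x \<Longrightarrow> \<sigma> 0 x = 1"
    and step_ge: "\<And>x. 0 \<le> \<sigma> 0 x" and step_le: "\<And>x. \<sigma> 0 x \<le> 1"
    and step_deriv: "\<And>k x. (\<sigma> k has_real_derivative \<sigma> (Suc k) x) (at x)"
    and step_bounded: "\<And>k. \<exists>B. \<forall>x. \<bar>\<sigma> k x\<bar> \<le> B"
begin

lemma step_deriv_eq_0: "x < 0 \<or> 1 < x \<Longrightarrow> \<sigma> (Suc k) x = 0"
proof (induction k arbitrary: x)
  case 0
  from 0 have "(\<sigma> 0 has_real_derivative 0) (at x)"
  proof
    assume "x < 0"
    show ?thesis
      by (rule has_field_derivative_transform_within_open[where f="\<lambda>x. 0" and S="{..<0}"])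
         (use \<open>x < 0\<close> in \<open>auto simp: step0\<close>)
  next
    assume "1 < x"
    show ?thesis
      by (rule has_field_derivative_transform_within_open[where f="\<lambda>x. 1" and S="{1<..}"])
         (use \<open>1 < x\<close> in \<open>auto simp: step1\<close>)
  qed
  then show ?case by (rule DERIV_unique[OF step_deriv])
next
  case (Suc k)
  have "(\<sigma> (Suc k) has_real_derivative 0) (at x)"
    by (rule has_field_derivative_transform_within_open[where f="\<lambda>x. 0" and S="{..<0} \<union> {1<..}"])
       (use Suc in auto)
  then show ?case by (rule DERIV_unique[OF step_deriv])
qed

lemma step_eq_0: "x < 0 \<Longrightarrow> \<sigma> k x = 0"
  using step0[of x] step_deriv_eq_0[of x] by (cases k) auto

section \<open>The box carrying a packet, and the weight used in the estimates\<close>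

definition lo :: "real \<times> real \<Rightarrow> 'n \<Rightarrow> real" where
  "lo p i = (if i = a then - (fst p + 3) * snd p else - 1)"

definition hi :: "real \<times> real \<Rightarrow> 'n \<Rightarrow> real" where
  "hi p i = (if i = b then fst p + 2 else 1)"

definition valid :: "real \<times> real \<Rightarrow> bool" where
  "valid p \<longleftrightarrow> 0 \<le> fst p \<and> 1 \<le> snd p"

text \<open>The value \<open>{}\<close> for invalid parameters lets estimates range over all
  \<open>p\<close> although bounds are available for valid ones only.\<close>

definition region :: "real \<times> real \<Rightarrow> (real ^ 'n) set" where
  "region p = (if valid p then logbox (lo p) (hi p) else {})"

definition size_of :: "real \<times> real \<Rightarrow> real" where
  "size_of p = (1 + fst p) * (1 + snd p)"

text \<open>In the box all coordinates except \<open>x_a\<close> are at least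
  \<open>exp (- 1)\<close>, so only powers of \<open>1 / x_a\<close> have to be recorded besides the
  size of the parameters. The factor \<open>exp 1\<close> makes the weight at least 1, since
  \<open>x_a \<le> exp 1\<close> there.\<close>

definition weight :: "real \<times> real \<Rightarrow> real ^ 'n \<Rightarrow> real" where
  "weight p x = size_of p * (exp 1 / x $ a)"

lemma size_of_ge_1: "valid p \<Longrightarrow> 1 \<le> size_of p"
  unfolding valid_def size_of_def by (intro mult_ge1_I) auto

lemma region_valid: "x \<in> region p \<Longrightarrow> valid p"
  by (auto simp: region_def split: if_splits)

lemma region_orthant: "x \<in> region p \<Longrightarrow> 0 < x $ i"
  using logbox_subset_orthant by (auto simp: region_def orthant_def split: if_splits)

lemma region_ln:
  assumes "x \<in> region p"
  shows "lo p i \<le> ln (x $ i)" "ln (x $ i) \<le> hi p i"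
  using assms by (auto simp: region_def in_logbox_iff split: if_splits)

lemma region_a: "x \<in> region p \<Longrightarrow> 1 \<le> exp 1 / x $ a"
  using region_ln(2)[of x p a] region_orthant[of x p a] ab
  by (simp add: hi_def field_simps) (metis exp_le_cancel_iff exp_ln)

lemma size_of_le_weight: "x \<in> region p \<Longrightarrow> size_of p \<le> weight p x"
  using mult_left_mono[OF region_a, of x p "size_of p"] size_of_ge_1[OF region_valid, of x p]
  by (simp add: weight_def)

lemma weight_ge_1: "x \<in> region p \<Longrightarrow> 1 \<le> weight p x"
  using size_of_le_weight size_of_ge_1[OF region_valid] order_trans by blast

section \<open>Amplitudes: coefficient functions of moderate growth\<close>

text \<open>
  The parameter is \<open>p = (\<tau>, L)\<close>. Both parameters enter the weight, so that the estimates are uniform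
  in \<open>\<tau>\<close> as well.
\<close>

inductive_set amplitudes :: "(real \<times> real \<Rightarrow> real ^ 'n \<Rightarrow> complex) set" where
  const: "(\<And>p. valid p \<Longrightarrow> norm (c p) \<le> C * size_of p ^ m) \<Longrightarrow> 0 \<le> C \<Longrightarrow>
    (\<lambda>p x. c p) \<in> amplitudes"
| log: "(\<lambda>p x. of_real (ln (x $ i))) \<in> amplitudes"
| inv: "(\<lambda>p x. of_real (inverse (x $ i))) \<in> amplitudes"
| width: "(\<lambda>p x. inverse (1 + 4 * \<i> * of_real (ln (x $ b)))) \<in> amplitudes"
| cutoff: "(\<And>p. valid p \<Longrightarrow> \<bar>d p\<bar> \<le> 1) \<Longrightarrow>
    (\<lambda>p x. of_real (\<sigma> k (c p + d p * ln (x $ i)))) \<in> amplitudes"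
| add: "f \<in> amplitudes \<Longrightarrow> g \<in> amplitudes \<Longrightarrow> (\<lambda>p x. f p x + g p x) \<in> amplitudes"
| mult: "f \<in> amplitudes \<Longrightarrow> g \<in> amplitudes \<Longrightarrow> (\<lambda>p x. f p x * g p x) \<in> amplitudes"

lemma amplitudes_fixed: "(\<lambda>p x. c) \<in> amplitudes"
  by (rule amplitudes.const[of "\<lambda>p. c" "norm c" 0]) auto

lemma amplitudes_cmult: "f \<in> amplitudes \<Longrightarrow> (\<lambda>p x. c * f p x) \<in> amplitudes"
  by (intro amplitudes.mult amplitudes_fixed)

lemma amplitudes_if:
  "f \<in> amplitudes \<Longrightarrow> (\<lambda>p x. if P then f p x else 0) \<in> amplitudes"
  using amplitudes_fixed[of 0] by (cases P) simp_all

lemma norm_width: "norm (inverse (1 + 4 * \<i> * complex_of_real t)) \<le> 1"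
proof -
  have "1 \<le> norm (1 + 4 * \<i> * complex_of_real t)"
    using complex_Re_le_cmod[of "1 + 4 * \<i> * complex_of_real t"] by simp
  then show ?thesis by (simp add: norm_inverse inverse_le_1_iff)
qed

lemma width_ne_0: "1 + 4 * \<i> * complex_of_real t \<noteq> 0"
  by (simp add: complex_eq_iff)

lemma amplitudes_moderate: "h \<in> amplitudes \<Longrightarrow> moderate weight region h"
proof (induction rule: amplitudes.induct)
  case (const c C m)
  show ?case
  proof (rule moderateI[of _ _ C _ m])
    fix p x assume x: "x \<in> region p"
    have "norm (c p) \<le> C * size_of p ^ m" by (rule const.hyps(1)[OF region_valid[OF x]])
    also have "\<dots> \<le> C * weight p x ^ m"
      using size_of_le_weight[OF x] size_of_ge_1[OF region_valid[OF x]] const.hyps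
      by (intro mult_left_mono power_mono) auto
    finally show "norm (c p) \<le> C * weight p x ^ m" .
  qed (rule const.hyps)
next
  case (log i)
  show ?case
  \<comment> \<open>The edges \<open>(fst p + 3) * snd p\<close> and \<open>fst p + 2\<close> of the
    box are both at most \<open>3 * size_of p\<close>.\<close>
  proof (rule moderateI[of _ _ 3 _ 1])
    fix p x assume x: "x \<in> region p"
    then have v: "0 \<le> fst p" "1 \<le> snd p" using region_valid by (auto simp: valid_def)
    then have *: "0 \<le> fst p * snd p" by simp
    have "size_of p = 1 + fst p + snd p + fst p * snd p"
      "lo p i = - (fst p * snd p) - 3 * snd p \<or> lo p i = - 1" "hi p i = fst p + 2 \<or> hi p i = 1"
      by (simp_all add: size_of_def lo_def hi_def algebra_simps)
    then have "- (3 * size_of p) \<le> lo p i" "hi p i \<le> 3 * size_of p"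
      using v * by linarith+
    then have "\<bar>ln (x $ i)\<bar> \<le> 3 * size_of p"
      using region_ln[OF x, of i] by linarith
    with size_of_le_weight[OF x]
    show "norm (complex_of_real (ln (x $ i))) \<le> 3 * weight p x ^ 1" by simp
  qed simp
next
  case (inv i)
  show ?case
  proof (rule moderateI[of _ _ "exp 1" _ 1])
    fix p x assume x: "x \<in> region p"
    note pos = region_orthant[OF x]
    have "inverse (x $ i) \<le> exp 1 * weight p x"
    proof (cases "i = a")
      case True
      have "inverse (x $ a) \<le> exp 1 / x $ a * 1"
        using pos[of a] by (simp add: field_simps)
      also have "\<dots> \<le> exp 1 / x $ a * size_of p"
        using size_of_ge_1[OF region_valid[OF x]] pos[of a] by (intro mult_left_mono) auto
      finally have "inverse (x $ i) \<le> weight p x" using True by (simp add: weight_def mult.commute)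
      also have "\<dots> \<le> exp 1 * weight p x"
        using weight_ge_1[OF x] mult_right_mono[of 1 "exp 1" "weight p x"] by simp
      finally show ?thesis .
    next
      case False
      then have "exp (- 1) \<le> x $ i"
        using region_ln(1)[OF x, of i] pos[of i]
        by (simp add: lo_def) (metis exp_le_cancel_iff exp_ln)
      then have "inverse (x $ i) \<le> exp 1"
        using le_imp_inverse_le[of "exp (- 1)" "x $ i"] by (simp add: exp_minus)
      also have "\<dots> \<le> exp 1 * weight p x" using weight_ge_1[OF x] by simp
      finally show ?thesis .
    qed
    then show "norm (complex_of_real (inverse (x $ i))) \<le> exp 1 * weight p x ^ 1"
      using pos[of i] by (simp add: norm_inverse)
  qed simp
next
  case width
  show ?case by (rule moderateI[of _ _ 1 _ 0]) (use norm_width in auto)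
next
  case (cutoff d k c i)
  obtain B where B: "\<And>x. \<bar>\<sigma> k x\<bar> \<le> B" using step_bounded by blast
  then have "0 \<le> B" using abs_ge_zero order_trans by blast
  then show ?case by (intro moderateI[of _ _ B _ 0]) (use B in auto)
next
  case (add f g)
  then show ?case by (intro moderate_add) (auto intro: weight_ge_1)
next
  case (mult f g)
  then show ?case by (intro moderate_mult)
qed

lemma has_partial_ln:
  "x \<in> orthant \<Longrightarrow> has_partial i (\<lambda>x. of_real (ln (x $ j))) (if i = j then of_real (inverse (x $ j)) else 0) x"
  by (rule has_partial_coord, rule DERIV_ln) (auto simp: orthant_def)

lemma has_partial_width:
  assumes "x \<in> orthant"
  shows "has_partial i (\<lambda>x. inverse (1 + 4 * \<i> * of_real (ln (x $ b))))
    (if i = b then - 4 * \<i> * ((inverse (1 + 4 * \<i> * of_real (ln (x $ b))) *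
      inverse (1 + 4 * \<i> * of_real (ln (x $ b)))) * of_real (inverse (x $ b))) else 0) x"
proof -
  have d: "((\<lambda>z. inverse (1 + 4 * \<i> * z)) has_field_derivative
      - 4 * \<i> * (inverse (1 + 4 * \<i> * of_real t))\<^sup>2) (at (complex_of_real t))" for t
    using width_ne_0[of t] by (auto intro!: derivative_eq_intros simp: power2_eq_square)
  show ?thesis
    by (rule has_partial_eq_rhs[OF has_partial_compose[OF has_partial_ln[OF assms] d]])
       (simp add: power2_eq_square)
qed

lemma has_partial_cutoff:
  assumes "x \<in> orthant"
  shows "has_partial i (\<lambda>x. of_real (\<sigma> k (c + d * ln (x $ j))))
    (if i = j then of_real d * (of_real (\<sigma> (Suc k) (c + d * ln (x $ j))) * of_real (inverse (x $ j)))
     else 0) x"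
proof -
  have "((\<lambda>t. c + d * ln t) has_real_derivative d * inverse (x $ j)) (at (x $ j))"
    using assms by (auto intro!: derivative_eq_intros simp: orthant_def inverse_eq_divide)
  from has_partial_coord[OF DERIV_chain2[OF step_deriv this]] show ?thesis
    by (rule has_partial_eq_rhs) simp
qed

text \<open>The derivative of each generator is a combination of products of generators. For a
  cutoff the inner derivative \<open>d p\<close> appears as a factor, and its bound by 1 makes it an
  admissible constant.\<close>

lemma amplitudes_partial_closed: "partial_closed orthant amplitudes"
  unfolding partial_closed_def
proof (intro ballI allI)
  fix h and i :: 'n assume "h \<in> amplitudes"
  then show "\<exists>h'\<in>amplitudes. \<forall>p. \<forall>x\<in>orthant. has_partial i (h p) (h' p x) x"
  proof (induction rule: amplitudes.induct)
    case (const c C m)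
    show ?case
      by (rule bexI[OF _ amplitudes_fixed[of 0]]) (simp add: has_partial_const)
  next
    case (log j)
    have "(\<lambda>p x. if i = j then of_real (inverse (x $ j)) else 0) \<in> amplitudes"
      by (intro amplitudes_if amplitudes.inv)
    then show ?case by (rule bexI[rotated]) (intro allI ballI has_partial_ln)
  next
    case (inv j)
    have "(\<lambda>p x. if i = j then (- 1) * (of_real (inverse (x $ j)) * of_real (inverse (x $ j))) else 0)
        \<in> amplitudes"
      by (intro amplitudes_if amplitudes_cmult amplitudes.mult amplitudes.inv)
    moreover have "has_partial i (\<lambda>x. of_real (inverse (x $ j)))
        (if i = j then (- 1) * (of_real (inverse (x $ j)) * of_real (inverse (x $ j))) else 0) x"
      if "x \<in> orthant" for x
    proof -
      have "x $ j \<noteq> 0" using that unfolding orthant_def by (metis less_irrefl mem_Collect_eq)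
      from has_partial_coord[OF DERIV_inverse[OF this]] show ?thesis
        by (rule has_partial_eq_rhs) (simp add: power2_eq_square)
    qed
    ultimately show ?case by (intro bexI) auto
  next
    case width
    let ?w = "\<lambda>x :: real ^ 'n. inverse (1 + 4 * \<i> * complex_of_real (ln (x $ b)))"
    have "(\<lambda>p x. - 4 * \<i> * ((?w x * ?w x) * of_real (inverse (x $ b)))) \<in> amplitudes"
      by (intro amplitudes_cmult amplitudes.mult amplitudes.width amplitudes.inv)
    then have "(\<lambda>p x. if i = b then - 4 * \<i> * ((?w x * ?w x) * of_real (inverse (x $ b))) else 0)
        \<in> amplitudes"
      by (rule amplitudes_if)
    then show ?case
      by (rule bexI[rotated]) (intro allI ballI has_partial_width)
  next
    case (cutoff d k c j)
    have "(\<lambda>p x. of_real (d p) * (of_real (\<sigma> (Suc k) (c p + d p * ln (x $ j))) * of_real (inverse (x $ j))))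
        \<in> amplitudes"
      by (intro amplitudes.mult amplitudes.inv amplitudes.cutoff
          amplitudes.const[of _ 1 0]) (use cutoff in auto)
    then have "(\<lambda>p x. if i = j then of_real (d p) *
        (of_real (\<sigma> (Suc k) (c p + d p * ln (x $ j))) * of_real (inverse (x $ j))) else 0) \<in> amplitudes"
      by (rule amplitudes_if)
    then show ?case
      by (rule bexI[rotated]) (intro allI ballI has_partial_cutoff)
  next
    case (add f g)
    then obtain f' g' where fg: "f' \<in> amplitudes" "g' \<in> amplitudes"
      "\<And>p x. x \<in> orthant \<Longrightarrow> has_partial i (f p) (f' p x) x"
      "\<And>p x. x \<in> orthant \<Longrightarrow> has_partial i (g p) (g' p x) x" by blast
    show ?case
      by (rule bexI[OF _ amplitudes.add[OF fg(1,2)]])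
         (intro allI ballI has_partial_add fg(3,4))
  next
    case (mult f g)
    then obtain f' g' where fg: "f' \<in> amplitudes" "g' \<in> amplitudes"
      "\<And>p x. x \<in> orthant \<Longrightarrow> has_partial i (f p) (f' p x) x"
      "\<And>p x. x \<in> orthant \<Longrightarrow> has_partial i (g p) (g' p x) x" by blast
    have "(\<lambda>p x. f' p x * g p x + f p x * g' p x) \<in> amplitudes"
      by (intro amplitudes.add amplitudes.mult fg mult.hyps)
    then show ?case
      by (rule bexI[rotated]) (intro allI ballI has_partial_mult fg(3,4))
  qed
qed

section \<open>The Gaussian beam and its derivatives in logarithmic coordinates\<close>

definition offset :: "real \<times> real \<Rightarrow> real ^ 'n \<Rightarrow> real" where
  "offset p x = ln (x $ a) - snd p * ln (x $ b) + snd p * fst p"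

definition width :: "real ^ 'n \<Rightarrow> complex" where
  "width x = inverse (1 + 4 * \<i> * of_real (ln (x $ b)))"

text \<open>
  In logarithmic coordinates \<open>exp (phase p)\<close> with \<open>p = (\<tau>, L)\<close> is the Gaussian solution of
  \<open>\<partial>\<^sub>a\<^sup>2\<psi> + \<i> \<partial>\<^sub>b\<psi> = 0\<close>, translated by \<open>- L \<tau>\<close> and boosted to velocity \<open>L\<close>.
\<close>

definition phase :: "real \<times> real \<Rightarrow> real ^ 'n \<Rightarrow> complex" where
  "phase p x = (\<i> * snd p / 2) * of_real (ln (x $ a)) + (- \<i> * (snd p)\<^sup>2 / 4) * of_real (ln (x $ b))
     + (- 1) * ((of_real (offset p x) * of_real (offset p x)) * width x)
     + (- 1 / 2) * Ln (1 + 4 * \<i> * of_real (ln (x $ b)))"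

definition phase_a :: "real \<times> real \<Rightarrow> real ^ 'n \<Rightarrow> complex" where
  "phase_a p x = \<i> * snd p / 2 + (- 2) * (of_real (offset p x) * width x)"

definition phase_b :: "real \<times> real \<Rightarrow> real ^ 'n \<Rightarrow> complex" where
  "phase_b p x = - \<i> * (snd p)\<^sup>2 / 4 + 2 * (of_real (snd p) * (of_real (offset p x) * width x))
     + 4 * \<i> * ((of_real (offset p x) * of_real (offset p x)) * (width x * width x))
     + (- 2 * \<i>) * width x"

text \<open>This is the Schroedinger equation for \<open>exp (phase p)\<close>, divided by the
  exponential: \<open>phase_a\<close> and \<open>phase_b\<close> are the logarithmic derivatives of
  the phase, and \<open>- 2 * width x\<close> is its second one in direction
  \<open>a\<close>.\<close>

lemma phase_identity: "(phase_a p x)\<^sup>2 - 2 * width x + \<i> * phase_b p x = 0"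
  by (simp add: phase_a_def phase_b_def power2_eq_square algebra_simps)

text \<open>On the orthant this is the derivative with respect to \<open>ln x_j\<close>.\<close>

definition log_partial :: "'n \<Rightarrow> (real ^ 'n \<Rightarrow> complex) \<Rightarrow> complex \<Rightarrow> real ^ 'n \<Rightarrow> bool" where
  "log_partial j f d x \<longleftrightarrow> has_partial j f (d * of_real (inverse (x $ j))) x"

lemma log_partial_eq_rhs: "log_partial j f d x \<Longrightarrow> d = e \<Longrightarrow> log_partial j f e x"
  by simp

lemma log_partial_const: "log_partial j (\<lambda>x. c) 0 x"
  using has_partial_const by (simp add: log_partial_def)

lemma log_partial_add:
  "log_partial j f d x \<Longrightarrow> log_partial j g e x \<Longrightarrow> log_partial j (\<lambda>x. f x + g x) (d + e) x"
  unfolding log_partial_def by (drule (1) has_partial_add) (simp add: algebra_simps)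

lemma log_partial_mult:
  "log_partial j f d x \<Longrightarrow> log_partial j g e x \<Longrightarrow>
    log_partial j (\<lambda>x. f x * g x) (d * g x + f x * e) x"
  unfolding log_partial_def by (drule (1) has_partial_mult) (simp add: algebra_simps)

lemma log_partial_cmult: "log_partial j f d x \<Longrightarrow> log_partial j (\<lambda>x. c * f x) (c * d) x"
  using log_partial_mult[OF log_partial_const, of j f d x c] by simp

lemma log_partial_compose:
  "log_partial j f d x \<Longrightarrow> (G has_field_derivative D) (at (f x)) \<Longrightarrow>
    log_partial j (\<lambda>x. G (f x)) (D * d) x"
  unfolding log_partial_def by (drule (1) has_partial_compose) (simp add: algebra_simps)

lemma log_partial_ln:
  "x \<in> orthant \<Longrightarrow> log_partial j (\<lambda>x. of_real (ln (x $ i))) (if j = i then 1 else 0) x"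
  unfolding log_partial_def by (rule has_partial_eq_rhs[OF has_partial_ln]) auto

lemma log_partial_cutoff:
  "x \<in> orthant \<Longrightarrow> log_partial j (\<lambda>x. of_real (\<sigma> k (c + d * ln (x $ i))))
    (if j = i then of_real d * of_real (\<sigma> (Suc k) (c + d * ln (x $ i))) else 0) x"
  unfolding log_partial_def by (rule has_partial_eq_rhs[OF has_partial_cutoff]) auto

lemma log_partial_offset:
  assumes "x \<in> orthant"
  shows "log_partial j (\<lambda>x. of_real (offset p x))
    (if j = a then 1 else if j = b then - of_real (snd p) else 0) x"
proof -
  have "(\<lambda>x. complex_of_real (offset p x)) = (\<lambda>x. (of_real (ln (x $ a)) +
      (- of_real (snd p)) * of_real (ln (x $ b))) + of_real (snd p * fst p))"
    by (simp add: offset_def fun_eq_iff)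
  moreover have "log_partial j \<dots> ((if j = a then 1 else 0) +
      (- of_real (snd p)) * (if j = b then 1 else 0) + 0) x"
    by (intro log_partial_add log_partial_cmult log_partial_const log_partial_ln assms)
  ultimately show ?thesis using ab by (auto elim!: log_partial_eq_rhs)
qed

lemma log_partial_width:
  assumes "x \<in> orthant"
  shows "log_partial j width (if j = b then - 4 * \<i> * (width x * width x) else 0) x"
  unfolding log_partial_def width_def[abs_def]
  by (rule has_partial_eq_rhs[OF has_partial_width[OF assms]]) simp

lemma log_partial_Ln:
  assumes "x \<in> orthant"
  shows "log_partial j (\<lambda>x. Ln (1 + 4 * \<i> * of_real (ln (x $ b)))) (if j = b then 4 * \<i> * width x else 0) x"
proof -
  have "1 + 4 * \<i> * complex_of_real t \<notin> \<real>\<^sub>\<le>\<^sub>0" for t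
    by (simp add: complex_nonpos_Reals_iff)
  then have d: "((\<lambda>z. Ln (1 + 4 * \<i> * z)) has_field_derivative
      4 * \<i> * inverse (1 + 4 * \<i> * of_real t)) (at (complex_of_real t))" for t
    by (auto intro!: derivative_eq_intros simp: field_simps)
  show ?thesis
    by (rule log_partial_eq_rhs[OF log_partial_compose[OF log_partial_ln[OF assms] d]])
       (simp add: width_def)
qed

lemma log_partial_phase:
  assumes "x \<in> orthant"
  shows "log_partial j (phase p) (if j = a then phase_a p x else if j = b then phase_b p x else 0) x"
  unfolding phase_def[abs_def]
  by (rule log_partial_eq_rhs,
      (rule log_partial_add log_partial_cmult log_partial_mult log_partial_ln log_partial_offset
        log_partial_width log_partial_Ln assms)+)
     (use ab in \<open>simp add: phase_a_def phase_b_def algebra_simps\<close>)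

lemma log_partial_phase_a:
  assumes "x \<in> orthant"
  shows "log_partial a (phase_a p) (- 2 * width x) x"
  unfolding phase_a_def[abs_def]
  by (rule log_partial_eq_rhs,
      (rule log_partial_const log_partial_add log_partial_cmult log_partial_mult
        log_partial_offset log_partial_width assms)+)
     (use ab in simp)

lemma log_partial_exp_phase:
  assumes "x \<in> orthant"
  shows "log_partial j (\<lambda>x. exp (phase p x))
    (exp (phase p x) * (if j = a then phase_a p x else if j = b then phase_b p x else 0)) x"
  by (rule log_partial_compose[OF log_partial_phase[OF assms] DERIV_exp])

lemma amplitudes_parameters:
  "(\<lambda>p x. of_real (snd p)) \<in> amplitudes" "(\<lambda>p x. of_real (fst p)) \<in> amplitudes"
proof -
  have "norm (complex_of_real (snd p)) \<le> 1 * size_of p ^ 1"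
    "norm (complex_of_real (fst p)) \<le> 1 * size_of p ^ 1" if "valid p" for p
  proof -
    have "0 \<le> fst p" "1 \<le> snd p" "0 \<le> fst p * snd p" using that by (auto simp: valid_def)
    then show "norm (complex_of_real (snd p)) \<le> 1 * size_of p ^ 1"
      "norm (complex_of_real (fst p)) \<le> 1 * size_of p ^ 1"
      by (auto simp: size_of_def algebra_simps)
  qed
  then show "(\<lambda>p x. of_real (snd p)) \<in> amplitudes" "(\<lambda>p x. of_real (fst p)) \<in> amplitudes"
    by (intro amplitudes.const[of _ 1 1]; simp)+
qed

lemma amplitudes_offset: "(\<lambda>p x. of_real (offset p x)) \<in> amplitudes"
proof -
  have "(\<lambda>p x. (of_real (ln (x $ a)) + (- 1) * (of_real (snd p) * of_real (ln (x $ b))))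
      + of_real (snd p) * of_real (fst p)) \<in> amplitudes"
    by (intro amplitudes.add amplitudes_cmult amplitudes.mult amplitudes.log amplitudes_parameters)
  then show ?thesis by (simp add: offset_def[abs_def])
qed

lemma amplitudes_width: "(\<lambda>p x. width x) \<in> amplitudes"
  unfolding width_def by (rule amplitudes.width)

lemma amplitudes_phase_a: "phase_a \<in> amplitudes"
proof -
  have "(\<lambda>p x. (\<i> / 2) * of_real (snd p) + (- 2) * (of_real (offset p x) * width x)) \<in> amplitudes"
    by (intro amplitudes.add amplitudes_cmult amplitudes.mult amplitudes_parameters
        amplitudes_offset amplitudes_width)
  then show ?thesis by (simp add: phase_a_def[abs_def])
qed

lemma amplitudes_phase_b: "phase_b \<in> amplitudes"
proof -
  have "(\<lambda>p x. (- \<i> / 4) * (of_real (snd p) * of_real (snd p))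
      + 2 * (of_real (snd p) * (of_real (offset p x) * width x))
      + 4 * \<i> * ((of_real (offset p x) * of_real (offset p x)) * (width x * width x))
      + (- 2 * \<i>) * width x) \<in> amplitudes"
    by (intro amplitudes.add amplitudes_cmult amplitudes.mult amplitudes_parameters
        amplitudes_offset amplitudes_width)
  then show ?thesis by (simp add: phase_b_def[abs_def] power2_eq_square)
qed

section \<open>Products of the beam with amplitudes\<close>

definition waves :: "(real \<times> real \<Rightarrow> real ^ 'n \<Rightarrow> complex) set" where
  "waves = (\<lambda>h p x. exp (phase p x) * h p x) ` amplitudes"

text \<open>Differentiating the exponential brings down \<open>phase_a\<close> or
  \<open>phase_b\<close> divided by a coordinate, which is again an amplitude.\<close>

lemma waves_partial_closed: "partial_closed orthant waves"
  unfolding partial_closed_def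
proof (intro ballI allI)
  fix g and i :: 'n assume "g \<in> waves"
  then obtain h where h: "h \<in> amplitudes" and g: "g = (\<lambda>p x. exp (phase p x) * h p x)"
    by (auto simp: waves_def)
  obtain h' where h': "h' \<in> amplitudes" "\<And>p x. x \<in> orthant \<Longrightarrow> has_partial i (h p) (h' p x) x"
    using amplitudes_partial_closed h unfolding partial_closed_def by blast
  define q where "q p x = (if i = a then phase_a p x else if i = b then phase_b p x else 0)" for p x
  have q: "q \<in> amplitudes"
    unfolding q_def[abs_def]
    using amplitudes_phase_a amplitudes_phase_b amplitudes_fixed[of 0] by (cases "i = a"; cases "i = b") auto
  have "(\<lambda>p x. q p x * of_real (inverse (x $ i)) * h p x + h' p x) \<in> amplitudes"
    by (intro amplitudes.add amplitudes.mult amplitudes.inv q h h')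
  then have "(\<lambda>p x. exp (phase p x) * (q p x * of_real (inverse (x $ i)) * h p x + h' p x)) \<in> waves"
    unfolding waves_def by (rule imageI)
  moreover have "has_partial i (g p) (exp (phase p x) * (q p x * of_real (inverse (x $ i)) * h p x + h' p x)) x"
    if "x \<in> orthant" for p x
    unfolding g
    by (rule has_partial_eq_rhs[OF has_partial_mult[OF
          log_partial_exp_phase[OF that, unfolded log_partial_def] h'(2)[OF that]]])
       (simp add: q_def algebra_simps)
  ultimately show "\<exists>g'\<in>waves. \<forall>p. \<forall>x\<in>orthant. has_partial i (g p) (g' p x) x" by (intro bexI) auto
qed

text \<open>The Gaussian profile around the axis \<open>offset p x = 0\<close> of the beam,
  spreading as \<open>ln x_b\<close> moves away from 0.\<close>

definition envelope :: "real \<times> real \<Rightarrow> real ^ 'n \<Rightarrow> real" where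
  "envelope p x = exp (- (offset p x)\<^sup>2 / (1 + 16 * (ln (x $ b))\<^sup>2))"

text \<open>The two terms linear in the logarithms are imaginary. The real part of
  \<open>width\<close> gives the Gaussian, and \<open>Ln\<close> gives the amplitude loss by
  spreading, the modulus of \<open>1 + 4 * \<i> * ln x_b\<close> to the power -1/2.\<close>

lemma norm_exp_phase:
  "norm (exp (phase p x)) = envelope p x * exp (- ln (cmod (1 + 4 * \<i> * of_real (ln (x $ b)))) / 2)"
proof -
  have "Re (width x) = 1 / (1 + 16 * (ln (x $ b))\<^sup>2)"
    by (simp add: width_def power_mult_distrib)
  then have "Re (phase p x) = - (offset p x)\<^sup>2 / (1 + 16 * (ln (x $ b))\<^sup>2)
      - ln (cmod (1 + 4 * \<i> * of_real (ln (x $ b)))) / 2"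
    using width_ne_0 by (simp add: phase_def power2_eq_square)
  then show ?thesis by (simp add: envelope_def flip: exp_add)
qed

lemma norm_exp_phase_le: "norm (exp (phase p x)) \<le> envelope p x"
proof -
  have "1 \<le> cmod (1 + 4 * \<i> * of_real (ln (x $ b)))"
    using complex_Re_le_cmod[of "1 + 4 * \<i> * complex_of_real (ln (x $ b))"] by simp
  then have "exp (- ln (cmod (1 + 4 * \<i> * of_real (ln (x $ b)))) / 2) \<le> 1" by simp
  then show ?thesis
    unfolding norm_exp_phase by (rule mult_left_le) (simp add: envelope_def)
qed

lemma envelope_le_1: "envelope p x \<le> 1"
  by (simp add: envelope_def)

lemma waves_bound:
  assumes "g \<in> waves"
  shows "\<exists>C\<ge>0. \<exists>m. \<forall>p. \<forall>x\<in>region p. norm (g p x) \<le> C * (envelope p x * weight p x ^ m)"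
proof -
  obtain h where h: "h \<in> amplitudes" and g: "g = (\<lambda>p x. exp (phase p x) * h p x)"
    using assms by (auto simp: waves_def)
  obtain C m where C: "C \<ge> 0" and le: "\<And>p x. x \<in> region p \<Longrightarrow> norm (h p x) \<le> C * weight p x ^ m"
    using amplitudes_moderate[OF h] unfolding moderate_def by blast
  have "norm (g p x) \<le> C * (envelope p x * weight p x ^ m)" if "x \<in> region p" for p x
    using mult_mono[OF norm_exp_phase_le[of p x] le[OF that]]
    by (simp add: g norm_mult mult_ac envelope_def)
  with C show ?thesis by blast
qed

text \<open>A compact \<open>S\<close> inside the open orthant keeps away from its boundary, so
  extension by zero is smooth.\<close>

lemma wave_test_function:
  assumes h: "h \<in> amplitudes" and S: "compact S" "S \<subseteq> orthant"
    and z: "\<And>x. x \<in> orthant \<Longrightarrow> x \<notin> S \<Longrightarrow> h p x = 0"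
  shows "\<exists>\<phi>. (\<forall>x\<in>orthant. test_apply \<phi> x = exp (phase p x) * h p x) \<and> (\<forall>x. x \<notin> S \<longrightarrow> test_apply \<phi> x = 0)"
proof -
  define f where "f x = (if x \<in> orthant then exp (phase p x) * h p x else 0)" for x
  have f0: "f x = 0" if "x \<notin> S" for x using z that by (simp add: f_def)
  have "(\<lambda>p x. exp (phase p x) * h p x) \<in> waves" using h by (auto simp: waves_def)
  then have "smooth f"
    by (rule partial_closed_smooth[OF waves_partial_closed open_orthant _ compact_imp_closed[OF S(1)] S(2)])
       (auto simp: f_def z)
  moreover have "compact (closure (support_on UNIV f))"
  proof -
    have "support_on UNIV f \<subseteq> S" using f0 by (auto simp: support_on_def)
    then show ?thesis using S(1) by (meson bounded_subset compact_closure compact_imp_bounded)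
  qed
  ultimately have "test_apply (Test_function f) = f" by (simp add: Test_function_inverse)
  then show ?thesis using f0 by (intro exI[of _ "Test_function f"]) (simp add: f_def)
qed

section \<open>Cutoffs and the action of the transpose on a packet\<close>

definition transposed :: "'n test_function \<Rightarrow> 'n test_function" where
  "transposed \<phi> = test_partial a (test_coord_mult a (test_partial a (test_coord_mult a \<phi>)))
     + test_scale \<i> (test_partial b (test_coord_mult b \<phi>))"

text \<open>The indices \<open>k\<close> and \<open>l\<close> count derivatives of the two factors.
  For \<open>k = l = 0\<close> the product is 1 for \<open>ln x_a\<close> between
  \<open>- (fst p + 2) * snd p\<close> and 0, and it falls to 0 at
  \<open>- (fst p + 3) * snd p\<close> and at 1. The slope \<open>inverse (snd p)\<close> is at most
  1 for valid \<open>p\<close>.\<close>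

definition cut_a :: "nat \<Rightarrow> nat \<Rightarrow> real \<times> real \<Rightarrow> real ^ 'n \<Rightarrow> complex" where
  "cut_a k l p x = of_real (\<sigma> k (1 + (- 1) * ln (x $ a))) *
     of_real (\<sigma> l ((fst p + 3) + inverse (snd p) * ln (x $ a)))"

text \<open>The lower edge, \<open>ln x_b\<close> from -1 to 0, does not depend on \<open>p\<close>;
  the upper one runs from \<open>fst p + 1\<close> to \<open>fst p + 2\<close>. The explicit slopes
  \<open>1\<close> and \<open>- 1\<close> match the shape of the rule
  \<open>amplitudes.cutoff\<close>.\<close>

definition cut_b :: "nat \<Rightarrow> nat \<Rightarrow> real \<times> real \<Rightarrow> real ^ 'n \<Rightarrow> complex" where
  "cut_b k l p x = of_real (\<sigma> k (1 + 1 * ln (x $ b))) *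
     of_real (\<sigma> l ((fst p + 2) + (- 1) * ln (x $ b)))"

definition cut_rest :: "real ^ 'n \<Rightarrow> complex" where
  "cut_rest x = (\<Prod>i\<in>- {a, b}. of_real (\<sigma> 0 (1 + 1 * ln (x $ i))) *
     of_real (\<sigma> 0 (1 + (- 1) * ln (x $ i))))"

definition jacobian :: "real ^ 'n \<Rightarrow> complex" where
  "jacobian x = of_real (inverse (x $ a)) * of_real (inverse (x $ b))"

text \<open>Together with \<open>cut_a''\<close>, the first two logarithmic derivatives of
  \<open>cut_a 0 0\<close> in direction \<open>a\<close>.\<close>

definition cut_a' :: "real \<times> real \<Rightarrow> real ^ 'n \<Rightarrow> complex" where
  "cut_a' p x = (- 1) * cut_a 1 0 p x + inverse (of_real (snd p)) * cut_a 0 1 p x"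

definition cut_a'' :: "real \<times> real \<Rightarrow> real ^ 'n \<Rightarrow> complex" where
  "cut_a'' p x = cut_a 2 0 p x + (- 2) * (inverse (of_real (snd p)) * cut_a 1 1 p x)
     + inverse (of_real (snd p)) * (inverse (of_real (snd p)) * cut_a 0 2 p x)"

lemma amplitudes_cut_a: "cut_a k l \<in> amplitudes"
  unfolding cut_a_def[abs_def]
  by (intro amplitudes.mult amplitudes.cutoff) (auto simp: valid_def inverse_le_1_iff)

lemma amplitudes_cut_b: "cut_b k l \<in> amplitudes"
  unfolding cut_b_def[abs_def]
  by (intro amplitudes.mult amplitudes.cutoff) auto

lemma amplitudes_cut_rest: "(\<lambda>p. cut_rest) \<in> amplitudes"
proof -
  have "(\<lambda>p x. \<Prod>i\<in>I. of_real (\<sigma> 0 (1 + 1 * ln (x $ i))) *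
     of_real (\<sigma> 0 (1 + (- 1) * ln (x $ i)))) \<in> amplitudes" if "finite I" for I
    using that
  proof induction
    case empty
    show ?case using amplitudes_fixed[of 1] by simp
  next
    case (insert i I)
    have "(\<lambda>p x. (of_real (\<sigma> 0 (1 + 1 * ln (x $ i))) * of_real (\<sigma> 0 (1 + (- 1) * ln (x $ i)))) *
      (\<Prod>i\<in>I. of_real (\<sigma> 0 (1 + 1 * ln (x $ i))) * of_real (\<sigma> 0 (1 + (- 1) * ln (x $ i))))) \<in> amplitudes"
      by (intro amplitudes.mult amplitudes.cutoff insert.IH) auto
    then show ?case using insert.hyps by simp
  qed
  then show ?thesis by (simp add: cut_rest_def[abs_def])
qed

lemma amplitudes_jacobian: "(\<lambda>p. jacobian) \<in> amplitudes"
  unfolding jacobian_def[abs_def] by (intro amplitudes.mult amplitudes.inv)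

lemma amplitudes_inverse_L: "(\<lambda>p x. inverse (of_real (snd p))) \<in> amplitudes"
  by (rule amplitudes.const[of _ 1 0]) (auto simp: valid_def norm_inverse inverse_le_1_iff)

lemma amplitudes_cut_a': "cut_a' \<in> amplitudes"
  unfolding cut_a'_def[abs_def]
  by (intro amplitudes.add amplitudes_cmult amplitudes.mult amplitudes_inverse_L amplitudes_cut_a)

lemma amplitudes_cut_a'': "cut_a'' \<in> amplitudes"
  unfolding cut_a''_def[abs_def]
  by (intro amplitudes.add amplitudes_cmult amplitudes.mult amplitudes_inverse_L amplitudes_cut_a)

lemma log_partial_cut_a:
  assumes "x \<in> orthant"
  shows "log_partial j (cut_a k l p)
    (if j = a then (- 1) * cut_a (Suc k) l p x + inverse (of_real (snd p)) * cut_a k (Suc l) p x else 0) x"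
  unfolding cut_a_def[abs_def]
  by (rule log_partial_eq_rhs, (rule log_partial_mult log_partial_cutoff assms)+)
     (auto simp: algebra_simps)

lemma log_partial_cut_b:
  assumes "x \<in> orthant"
  shows "log_partial j (cut_b k l p)
    (if j = b then cut_b (Suc k) l p x + (- 1) * cut_b k (Suc l) p x else 0) x"
  unfolding cut_b_def[abs_def]
  by (rule log_partial_eq_rhs, (rule log_partial_mult log_partial_cutoff assms)+)
     (auto simp: algebra_simps)

lemma log_partial_cut_a':
  assumes "x \<in> orthant"
  shows "log_partial a (cut_a' p) (cut_a'' p x) x"
  unfolding cut_a'_def[abs_def]
  by (rule log_partial_eq_rhs, (rule log_partial_add log_partial_cmult log_partial_cut_a assms)+)
     (simp add: cut_a''_def algebra_simps numeral_2_eq_2)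

lemma log_partial_cut_rest:
  assumes "x \<in> orthant" "j = a \<or> j = b"
  shows "log_partial j cut_rest 0 x"
proof -
  have "log_partial j (\<lambda>x. \<Prod>i\<in>I. of_real (\<sigma> 0 (1 + 1 * ln (x $ i))) *
     of_real (\<sigma> 0 (1 + (- 1) * ln (x $ i)))) 0 x" if "finite I" "I \<subseteq> - {a, b}" for I
    using that
  proof induction
    case empty
    show ?case by (simp add: log_partial_const)
  next
    case (insert i I)
    then have "j \<noteq> i" using assms by auto
    have "log_partial j (\<lambda>x. (of_real (\<sigma> 0 (1 + 1 * ln (x $ i))) * of_real (\<sigma> 0 (1 + (- 1) * ln (x $ i)))) *
      (\<Prod>i\<in>I. of_real (\<sigma> 0 (1 + 1 * ln (x $ i))) * of_real (\<sigma> 0 (1 + (- 1) * ln (x $ i))))) 0 x"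
      by (rule log_partial_eq_rhs, rule log_partial_mult, rule log_partial_mult,
          rule log_partial_cutoff, rule assms, rule log_partial_cutoff, rule assms, rule insert.IH)
         (use insert.prems \<open>j \<noteq> i\<close> in auto)
    then show ?case using insert.hyps by simp
  qed
  from this[of "- {a, b}"] show ?thesis by (simp add: cut_rest_def[abs_def])
qed

text \<open>Dividing by \<open>x\<^sub>a x\<^sub>b\<close> turns the transpose of \<open>- \<theta>\<close> into the logarithmic derivative.\<close>

lemma partial_coord_mult_jacobian:
  assumes j: "j = a \<or> j = b" and G: "\<And>x. x \<in> orthant \<Longrightarrow> log_partial j G (G' x) x"
    and f: "\<And>x. x \<in> orthant \<Longrightarrow> f x = G x * jacobian x" and x: "x \<in> orthant"
  shows "partial j (\<lambda>x. of_real (x $ j) * f x) x = G' x * jacobian x"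
proof -
  define k where "k = (if j = a then b else a)"
  have k: "k \<noteq> j" and J: "jacobian x = of_real (inverse (x $ j)) * of_real (inverse (x $ k))" for x
    using j ab by (auto simp: k_def jacobian_def)
  have pos: "x $ j \<noteq> 0" "x $ k \<noteq> 0" if "x \<in> orthant" for x :: "real ^ 'n"
    using that unfolding orthant_def by (metis less_irrefl mem_Collect_eq)+
  have "has_partial j (\<lambda>x. complex_of_real (inverse (x $ k))) 0 x"
    using has_partial_coord[OF DERIV_inverse[OF pos(2)[OF x]], of j] k by simp
  from has_partial_mult[OF G[OF x, unfolded log_partial_def] this]
  have "has_partial j (\<lambda>x. G x * of_real (inverse (x $ k))) (G' x * jacobian x) x"
    by (simp add: J mult_ac)
  then have "has_partial j (\<lambda>x. of_real (x $ j) * f x) (G' x * jacobian x) x"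
    by (rule has_partial_cong[OF open_orthant x, rotated]) (use f J pos in simp)
  then show ?thesis by (simp add: has_partial_def)
qed

text \<open>Up to the factor \<open>jacobian\<close>, the transpose acts on \<open>G\<close> as the
  Schroedinger operator in logarithmic coordinates.\<close>

lemma transposed_on_orthant:
  assumes G: "\<And>x. x \<in> orthant \<Longrightarrow> log_partial a G (G1 x) x"
    and G1: "\<And>x. x \<in> orthant \<Longrightarrow> log_partial a G1 (G2 x) x"
    and Gb: "\<And>x. x \<in> orthant \<Longrightarrow> log_partial b G (Gb x) x"
    and f: "\<And>x. x \<in> orthant \<Longrightarrow> test_apply \<phi> x = G x * jacobian x" and x: "x \<in> orthant"
  shows "test_apply (transposed \<phi>) x = (G2 x + \<i> * Gb x) * jacobian x"
proof -
  note 1 = partial_coord_mult_jacobian[OF _ G f, simplified]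
  have "test_apply (transposed \<phi>) x =
    partial a (\<lambda>x. of_real (x $ a) * partial a (\<lambda>x. of_real (x $ a) * test_apply \<phi> x) x) x
    + \<i> * partial b (\<lambda>x. of_real (x $ b) * test_apply \<phi> x) x"
    by (simp add: transposed_def plus_test_function.rep_eq test_scale.rep_eq test_partial.rep_eq
        test_coord_mult.rep_eq)
  also have "\<dots> = G2 x * jacobian x + \<i> * (Gb x * jacobian x)"
    using partial_coord_mult_jacobian[OF _ Gb f x]
      partial_coord_mult_jacobian[OF _ G1 1 x] by simp
  finally show ?thesis by (simp add: algebra_simps)
qed

text \<open>
  Here and in the two error terms the common factor \<open>exp (phase p)\<close> is left out. The first error comes
  from the cutoff where the beam enters \<open>x\<^sub>b < 1\<close>; the other cutoffs lie off the beam or in \<open>x\<^sub>a \<ge> 1\<close>.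
\<close>

definition packet :: "real \<times> real \<Rightarrow> real ^ 'n \<Rightarrow> complex" where
  "packet p x = cut_a 0 0 p x * (cut_b 0 0 p x * cut_rest x) * jacobian x"

definition error1 :: "real \<times> real \<Rightarrow> real ^ 'n \<Rightarrow> complex" where
  "error1 p x = \<i> * (cut_a 0 0 p x * (cut_b 1 0 p x * cut_rest x) * jacobian x)"

definition error2 :: "real \<times> real \<Rightarrow> real ^ 'n \<Rightarrow> complex" where
  "error2 p x = (cut_a'' p x + 2 * (cut_a' p x * phase_a p x)) * (cut_b 0 0 p x * cut_rest x) * jacobian x
     + (- \<i>) * (cut_a 0 0 p x * (cut_b 0 1 p x * cut_rest x) * jacobian x)"

lemma amplitudes_packet: "packet \<in> amplitudes"
  and amplitudes_error1: "error1 \<in> amplitudes"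
  and amplitudes_error2: "error2 \<in> amplitudes"
  unfolding packet_def[abs_def] error1_def[abs_def] error2_def[abs_def]
  by (intro amplitudes.add amplitudes_cmult amplitudes.mult amplitudes_cut_a amplitudes_cut_b
      amplitudes_cut_rest amplitudes_jacobian amplitudes_cut_a' amplitudes_cut_a'' amplitudes_phase_a)+

text \<open>By the product rule, the terms in which no cutoff is differentiated add up to a multiple
  of the left side of \<open>phase_identity\<close> and cancel. Of the others, the one with
  \<open>cut_b 1 0\<close> is \<open>error1\<close> and the rest is \<open>error2\<close>.\<close>

lemma transposed_packet:
  assumes f: "\<And>x. x \<in> orthant \<Longrightarrow> test_apply \<phi> x = exp (phase p x) * packet p x" and x: "x \<in> orthant"
  shows "test_apply (transposed \<phi>) x = exp (phase p x) * (error1 p x + error2 p x)"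
proof -
  define A where "A = cut_a 0 0 p"
  define B where "B = cut_b 0 0 p"
  define B' where "B' x = cut_b 1 0 p x + (- 1) * cut_b 0 1 p x" for x
  define e where "e x = exp (phase p x)" for x
  define q where "q = phase_a p"
  have A: "log_partial a A (cut_a' p x) x" "log_partial b A 0 x" if "x \<in> orthant" for x
    using log_partial_cut_a[OF that, of a 0 0 p] log_partial_cut_a[OF that, of b 0 0 p] ab
    by (simp_all add: A_def cut_a'_def)
  have B: "log_partial a B 0 x" "log_partial b B (B' x) x" if "x \<in> orthant" for x
    using log_partial_cut_b[OF that, of a 0 0 p] log_partial_cut_b[OF that, of b 0 0 p] ab
    by (simp_all add: B_def B'_def)
  have e: "log_partial a e (e x * q x) x" "log_partial b e (e x * phase_b p x) x"
    if "x \<in> orthant" for x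
    using log_partial_exp_phase[OF that, of a p] log_partial_exp_phase[OF that, of b p] ab
    by (simp_all add: e_def[abs_def] q_def)
  have q: "log_partial a q (- 2 * width x) x" if "x \<in> orthant" for x
    using log_partial_phase_a[OF that] by (simp add: q_def)
  note rules = A B e q log_partial_cut_rest[OF _ disjI1[OF refl]] log_partial_cut_rest[OF _ disjI2[OF refl]]
    log_partial_cut_a'
  let ?R = "\<lambda>x. B x * cut_rest x * e x"
  have G: "log_partial a (\<lambda>x. A x * ?R x) ((cut_a' p x + A x * q x) * ?R x) x"
    if "x \<in> orthant" for x
    by (rule log_partial_eq_rhs, (rule log_partial_mult | (rule rules, rule that))+)
       (simp add: algebra_simps)
  have G1: "log_partial a (\<lambda>x. (cut_a' p x + A x * q x) * ?R x)
      ((cut_a'' p x + 2 * (cut_a' p x * q x) + A x * ((q x)\<^sup>2 - 2 * width x)) * ?R x) x"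
    if "x \<in> orthant" for x
    by (rule log_partial_eq_rhs, (rule log_partial_mult log_partial_add | (rule rules, rule that))+)
       (simp add: algebra_simps power2_eq_square)
  have Gb: "log_partial b (\<lambda>x. A x * ?R x) (A x * (B' x + B x * phase_b p x) * cut_rest x * e x) x"
    if "x \<in> orthant" for x
    by (rule log_partial_eq_rhs, (rule log_partial_mult | (rule rules, rule that))+)
       (simp add: algebra_simps)
  have "test_apply \<phi> x = A x * ?R x * jacobian x" if "x \<in> orthant" for x
    using f[OF that] by (simp add: packet_def A_def B_def e_def mult_ac)
  from transposed_on_orthant[OF G G1 Gb this x]
  have "test_apply (transposed \<phi>) x =
    ((cut_a'' p x + 2 * (cut_a' p x * q x)) * B x + \<i> * A x * B' x
      + A x * B x * ((q x)\<^sup>2 - 2 * width x + \<i> * phase_b p x)) * cut_rest x * e x * jacobian x"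
    by (simp add: algebra_simps)
  then show ?thesis
    unfolding phase_identity[of p x, folded q_def]
    by (simp add: error1_def error2_def A_def B_def B'_def q_def e_def algebra_simps)
qed

section \<open>Supports of the packet and of the two errors\<close>

definition box1 :: "real \<times> real \<Rightarrow> (real ^ 'n) set" where
  "box1 p = logbox (lo p) ((hi p)(b := 0))"

definition box2 :: "real \<times> real \<Rightarrow> (real ^ 'n) set" where
  "box2 p = logbox ((lo p)(a := 0)) (hi p) \<union> logbox (lo p) ((hi p)(a := - (fst p + 2) * snd p))
     \<union> logbox ((lo p)(b := fst p + 1)) (hi p)"

lemma in_logbox_upd:
  assumes "x \<in> logbox l h"
  shows "x \<in> logbox (l(i := c)) h \<longleftrightarrow> c \<le> ln (x $ i)" "x \<in> logbox l (h(i := c)) \<longleftrightarrow> ln (x $ i) \<le> c"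
  using assms by (auto simp: in_logbox_iff)

lemma in_logboxD: "x \<in> logbox l h \<Longrightarrow> l i \<le> ln (x $ i) \<and> ln (x $ i) \<le> h i"
  by (simp add: in_logbox_iff)

lemma region_eq: "valid p \<Longrightarrow> region p = logbox (lo p) (hi p)"
  by (simp add: region_def)

lemma box1_subset: "valid p \<Longrightarrow> box1 p \<subseteq> region p"
  unfolding region_eq box1_def
  by (auto simp: in_logbox_iff hi_def valid_def split: if_splits) (smt (verit))+

lemma box2_subset: "valid p \<Longrightarrow> box2 p \<subseteq> region p"
proof
  fix x assume p: "valid p" and x: "x \<in> box2 p"
  have v: "0 \<le> fst p" "1 \<le> snd p" using p by (auto simp: valid_def)
  then have "- (fst p + 3) * snd p \<le> 0" "- (fst p + 2) * snd p \<le> 0"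
    by (auto simp: mult_le_0_iff)
  then have *: "lo p a \<le> 0" "- (fst p + 2) * snd p \<le> hi p a" "lo p b \<le> fst p + 1"
    using ab v by (auto simp: lo_def hi_def)
  have "logbox (l(i := c)) h \<subseteq> logbox l h" if "l i \<le> c" for l h :: "'n \<Rightarrow> real" and i c
    using that by (auto simp: in_logbox_iff split: if_splits) (smt (verit))+
  moreover have "logbox l (h(i := c)) \<subseteq> logbox l h" if "c \<le> h i" for l h :: "'n \<Rightarrow> real" and i c
    using that by (auto simp: in_logbox_iff split: if_splits) (smt (verit))+
  ultimately show "x \<in> region p"
    using x * unfolding region_eq[OF p] box2_def by blast
qed

lemma compact_boxes: "compact (box1 p)" "compact (box2 p)"
  unfolding box1_def box2_def by (intro compact_Un compact_logbox)+

lemma region_subset_orthant: "region p \<subseteq> orthant"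
  using logbox_subset_orthant by (auto simp: region_def)

lemma cut_a_eq_0:
  assumes "valid p"
  shows "1 < ln (x $ a) \<Longrightarrow> cut_a k l p x = 0"
    "ln (x $ a) < - (fst p + 3) * snd p \<Longrightarrow> cut_a k l p x = 0"
    "ln (x $ a) < 0 \<Longrightarrow> cut_a (Suc k) l p x = 0"
    "- (fst p + 2) * snd p < ln (x $ a) \<Longrightarrow> cut_a k (Suc l) p x = 0"
proof -
  have L: "0 < snd p" using assms by (auto simp: valid_def)
  have *: "inverse (snd p) * ln (x $ a) < c \<longleftrightarrow> ln (x $ a) < c * snd p"
    "c < inverse (snd p) * ln (x $ a) \<longleftrightarrow> c * snd p < ln (x $ a)" for c
    using L by (auto simp: field_simps)
  show "1 < ln (x $ a) \<Longrightarrow> cut_a k l p x = 0"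
    by (simp add: cut_a_def step_eq_0)
  show "ln (x $ a) < 0 \<Longrightarrow> cut_a (Suc k) l p x = 0"
    by (simp add: cut_a_def step_deriv_eq_0)
  show "cut_a k l p x = 0" if "ln (x $ a) < - (fst p + 3) * snd p"
    using that *(1)[of "- (fst p + 3)"] by (simp add: cut_a_def step_eq_0)
  show "cut_a k (Suc l) p x = 0" if "- (fst p + 2) * snd p < ln (x $ a)"
    using that *(2)[of "- (fst p + 2)"] by (simp add: cut_a_def step_deriv_eq_0)
qed

lemma cut_b_eq_0:
  shows "ln (x $ b) < - 1 \<Longrightarrow> cut_b k l p x = 0"
    "fst p + 2 < ln (x $ b) \<Longrightarrow> cut_b k l p x = 0"
    "0 < ln (x $ b) \<Longrightarrow> cut_b (Suc k) l p x = 0"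
    "ln (x $ b) < fst p + 1 \<Longrightarrow> cut_b k (Suc l) p x = 0"
  by (simp_all add: cut_b_def step_eq_0 step_deriv_eq_0)

lemma cut_rest_eq_0:
  assumes "i \<noteq> a" "i \<noteq> b" "ln (x $ i) < - 1 \<or> 1 < ln (x $ i)"
  shows "cut_rest x = 0"
  unfolding cut_rest_def
  by (rule prod_zero) (use assms in \<open>auto simp: step_eq_0 intro!: bexI[of _ i]\<close>)

text \<open>Some coordinate lies beyond its edge, and this kills the corresponding factor for all
  derivative orders at once, so the packet and both errors are covered by one argument.\<close>

lemma cut_outside_region:
  assumes p: "valid p" and x: "x \<in> orthant" "x \<notin> region p"
  shows "(\<forall>k l. cut_a k l p x = 0) \<or> (\<forall>k l. cut_b k l p x = 0) \<or> cut_rest x = 0"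
proof -
  obtain i where i: "ln (x $ i) < lo p i \<or> hi p i < ln (x $ i)"
    using x unfolding region_eq[OF p] in_logbox_iff by (meson not_le)
  consider "i = a" | "i = b" | "i \<noteq> a" "i \<noteq> b" by blast
  then show ?thesis
  proof cases
    case 1
    with i ab cut_a_eq_0(1,2)[OF p, where x=x] show ?thesis by (auto simp: lo_def hi_def)
  next
    case 2
    with i ab cut_b_eq_0(1,2)[where x=x and p=p] show ?thesis by (auto simp: lo_def hi_def)
  next
    case 3
    with i cut_rest_eq_0[where i=i and x=x] show ?thesis by (auto simp: lo_def hi_def)
  qed
qed

lemma packet_eq_0:
  assumes "valid p" "x \<in> orthant" "x \<notin> region p"
  shows "packet p x = 0"
  using cut_outside_region[OF assms] by (auto simp: packet_def)

lemma error1_eq_0: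
  assumes p: "valid p" and x: "x \<in> orthant" "x \<notin> box1 p"
  shows "error1 p x = 0"
proof (cases "x \<in> region p")
  case True
  then have "0 < ln (x $ b)"
    using x in_logbox_upd(2) unfolding box1_def region_eq[OF p] by force
  then show ?thesis using cut_b_eq_0(3)[of x 0] by (simp add: error1_def)
next
  case False
  then show ?thesis using cut_outside_region[OF p x(1)] by (auto simp: error1_def)
qed

lemma error2_eq_0:
  assumes p: "valid p" and x: "x \<in> orthant" "x \<notin> box2 p"
  shows "error2 p x = 0"
proof (cases "x \<in> region p")
  case True
  then have "ln (x $ a) < 0" "- (fst p + 2) * snd p < ln (x $ a)" "ln (x $ b) < fst p + 1"
    using x in_logbox_upd unfolding box2_def region_eq[OF p] by force+
  note * = cut_a_eq_0(3)[OF p this(1)] cut_a_eq_0(4)[OF p this(2)] cut_b_eq_0(4)[OF this(3)]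
  show ?thesis
    using *(1)[of 0] *(1)[of 1] *(2)[of _ 0] *(2)[of _ 1] *(3)[of _ 0]
    by (simp add: error2_def cut_a'_def cut_a''_def numeral_2_eq_2)
next
  case False
  then show ?thesis
    using cut_outside_region[OF p x(1)] by (auto simp: error2_def cut_a'_def cut_a''_def)
qed

definition is_wave ::
  "(real \<times> real \<Rightarrow> real ^ 'n \<Rightarrow> complex) \<Rightarrow> (real ^ 'n) set \<Rightarrow> real \<times> real \<Rightarrow> 'n test_function \<Rightarrow> bool"
where
  "is_wave h S p \<phi> \<longleftrightarrow> (\<forall>x\<in>orthant. test_apply \<phi> x = exp (phase p x) * h p x) \<and>
     (\<forall>x. x \<notin> S \<longrightarrow> test_apply \<phi> x = 0)"

lemma transposed_vanish:
  assumes "compact S" "\<And>x. x \<notin> S \<Longrightarrow> test_apply \<phi> x = 0" "x \<notin> S"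
  shows "test_apply (transposed \<phi>) x = 0"
proof -
  note S = compact_imp_closed[OF assms(1)]
  have "test_supported_in S \<phi>" using assms(2) by (simp add: test_supported_in_iff S)
  then have "test_supported_in S (test_partial b (test_coord_mult b \<phi>))"
    "test_supported_in S (test_partial a (test_coord_mult a (test_partial a (test_coord_mult a \<phi>))))"
    by (intro test_supported_in_partial test_supported_in_coord_mult assms(1); assumption)+
  then show ?thesis
    using assms(3) by (simp add: test_supported_in_iff S transposed_def plus_test_function.rep_eq
        test_scale.rep_eq)
qed

lemma packet_exists:
  assumes p: "valid p"
  shows "\<exists>\<phi> \<epsilon>1 \<epsilon>2. is_wave packet (region p) p \<phi> \<and> is_wave error1 (box1 p) p \<epsilon>1 \<and>
    is_wave error2 (box2 p) p \<epsilon>2 \<and> transposed \<phi> = \<epsilon>1 + \<epsilon>2"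
proof -
  have c: "compact (region p)" by (simp add: region_eq[OF p] compact_logbox)
  obtain \<phi> where \<phi>: "is_wave packet (region p) p \<phi>"
    unfolding is_wave_def
    using wave_test_function[where p=p, OF amplitudes_packet c region_subset_orthant packet_eq_0[OF p]] by blast
  obtain \<epsilon>1 where \<epsilon>1: "is_wave error1 (box1 p) p \<epsilon>1"
    unfolding is_wave_def
    using wave_test_function[where p=p, OF amplitudes_error1 compact_boxes(1)
        order_trans[OF box1_subset[OF p] region_subset_orthant] error1_eq_0[OF p]] by blast
  obtain \<epsilon>2 where \<epsilon>2: "is_wave error2 (box2 p) p \<epsilon>2"
    unfolding is_wave_def
    using wave_test_function[where p=p, OF amplitudes_error2 compact_boxes(2)
        order_trans[OF box2_subset[OF p] region_subset_orthant] error2_eq_0[OF p]] by blast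
  \<comment> \<open>On the orthant this is \<open>transposed_packet\<close>; elsewhere both sides
    are 0 because all three supports lie in the orthant.\<close>
  have "test_apply (transposed \<phi>) x = test_apply (\<epsilon>1 + \<epsilon>2) x" for x
  proof (cases "x \<in> orthant")
    case True
    then show ?thesis
      using transposed_packet[where p=p and \<phi>=\<phi>, OF _ True] \<phi> \<epsilon>1 \<epsilon>2
      by (simp add: is_wave_def plus_test_function.rep_eq algebra_simps)
  next
    case False
    then have "x \<notin> region p" "x \<notin> box1 p" "x \<notin> box2 p"
      using box1_subset[OF p] box2_subset[OF p] region_subset_orthant by blast+
    then show ?thesis
      using transposed_vanish[OF c, of \<phi> x] \<phi> \<epsilon>1 \<epsilon>2
      by (simp add: is_wave_def plus_test_function.rep_eq)
  qed
  then have "transposed \<phi> = \<epsilon>1 + \<epsilon>2" by (metis ext test_apply_inject)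
  with \<phi> \<epsilon>1 \<epsilon>2 show ?thesis by blast
qed

section \<open>Norm estimates of the two errors\<close>

lemma complete_square:
  fixes s u r :: real
  assumes "0 < r"
  shows "u * s - s\<^sup>2 / r \<le> r * u\<^sup>2 / 4"
proof -
  have "0 \<le> (r * u / 2 - s)\<^sup>2 / r" using assms by simp
  also have "\<dots> = r * u\<^sup>2 / 4 - u * s + s\<^sup>2 / r"
    using assms by (simp add: field_simps power2_eq_square)
  finally show ?thesis by simp
qed

lemma weight_power:
  assumes "x \<in> region p"
  shows "weight p x ^ m = (size_of p * exp 1) ^ m * exp (- real m * ln (x $ a))"
proof -
  have "inverse (x $ a) ^ m = exp (- real m * ln (x $ a))"
    using region_orthant[OF assms, of a]
    by (simp add: exp_minus power_inverse flip: exp_of_nat_mult)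
       (simp add: exp_of_nat_mult)
  then show ?thesis by (simp add: weight_def divide_inverse power_mult_distrib mult_ac)
qed

text \<open>On \<open>box1\<close> the logarithm of \<open>x_b\<close> lies between -1 and 0, so
  each factor \<open>1 / x_a\<close> costs at most \<open>exp ((fst p + 1) * snd p)\<close> times
  \<open>exp (- z)\<close>, where \<open>z\<close> is the offset; the Gaussian in \<open>z\<close>
  absorbs the latter. Both \<open>C\<close> and \<open>m\<close> are found before \<open>p\<close>,
  in particular independently of \<open>fst p\<close>.\<close>

lemma error1_norm:
  "\<exists>C\<ge>0. \<exists>m. \<forall>p \<epsilon>. valid p \<longrightarrow> is_wave error1 (box1 p) p \<epsilon> \<longrightarrow>
     test_norm N \<epsilon> \<le> C * (size_of p ^ m * exp (real m * (fst p + 1) * snd p))"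
proof -
  have g: "(\<lambda>p x. exp (phase p x) * error1 p x) \<in> waves"
    unfolding waves_def using amplitudes_error1 by (rule imageI)
  obtain C m where C: "C \<ge> 0" and le: "\<And>p \<phi> S B. closed S \<Longrightarrow> S \<subseteq> orthant \<inter> region p \<Longrightarrow>
      (\<And>x. x \<in> orthant \<Longrightarrow> test_apply \<phi> x = exp (phase p x) * error1 p x) \<Longrightarrow>
      (\<And>x. x \<notin> S \<Longrightarrow> test_apply \<phi> x = 0) \<Longrightarrow>
      (\<And>x. x \<in> S \<Longrightarrow> envelope p x * weight p x ^ m \<le> B) \<Longrightarrow> 0 \<le> B \<Longrightarrow> test_norm N \<phi> \<le> C * B"
    by (rule partial_closed_test_norm[OF waves_partial_closed open_orthant g weight_ge_1 _ waves_bound,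
          where N=N]) (auto simp: envelope_def)
  \<comment> \<open>The number 17 bounds \<open>1 + 16 * t^2\<close> for
    \<open>\<bar>t\<bar> \<le> 1\<close>, and the last exponent is the maximum of
    \<open>- m * z - z^2 / 17\<close> over \<open>z\<close>.\<close>
  define D where "D = exp 1 ^ m * exp (17 * (real m)\<^sup>2 / 4)"
  have "test_norm N \<epsilon> \<le> C * (size_of p ^ m * exp (real m * (fst p + 1) * snd p) * D)"
    if p: "valid p" and \<epsilon>: "is_wave error1 (box1 p) p \<epsilon>" for p \<epsilon>
  proof (rule le)
    have s: "0 \<le> size_of p" using size_of_ge_1[OF p] by simp
    fix x assume x: "x \<in> box1 p"
    then have r: "x \<in> region p" using box1_subset[OF p] by blast
    define t where "t = ln (x $ b)"
    define z where "z = offset p x"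
    have t: "-1 \<le> t" "t \<le> 0"
      using x ab unfolding box1_def in_logbox_iff t_def lo_def
      by (auto dest!: spec[of _ b])
    have L: "0 \<le> fst p" "1 \<le> snd p" using p by (auto simp: valid_def)
    have "t\<^sup>2 \<le> 1" using t by (simp add: abs_square_le_1)
    then have "z\<^sup>2 / 17 \<le> z\<^sup>2 / (1 + 16 * t\<^sup>2)"
      by (intro divide_left_mono) (auto intro!: mult_pos_pos add_pos_nonneg)
    then have 1: "envelope p x \<le> exp (- z\<^sup>2 / 17)" by (simp add: envelope_def z_def t_def)
    have "ln (x $ a) = z + snd p * t - snd p * fst p" by (simp add: z_def t_def offset_def)
    moreover have "snd p * (- 1) \<le> snd p * t" using t L by (intro mult_left_mono) auto
    ultimately have "- ln (x $ a) \<le> (fst p + 1) * snd p - z" by (simp add: algebra_simps)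
    then have "real m * (- ln (x $ a)) \<le> real m * ((fst p + 1) * snd p - z)"
      by (intro mult_left_mono) auto
    moreover have "(- real m) * z - z\<^sup>2 / 17 \<le> 17 * (real m)\<^sup>2 / 4"
      using complete_square[of 17 "- real m" z] by simp
    ultimately have "- z\<^sup>2 / 17 + - real m * ln (x $ a) \<le>
        real m * (fst p + 1) * snd p + 17 * (real m)\<^sup>2 / 4"
      by (simp add: algebra_simps)
    then have 2: "exp (- z\<^sup>2 / 17) * exp (- real m * ln (x $ a)) \<le>
        exp (real m * (fst p + 1) * snd p) * exp (17 * (real m)\<^sup>2 / 4)"
      by (simp flip: exp_add)
    have "envelope p x * weight p x ^ m \<le>
        exp (- z\<^sup>2 / 17) * ((size_of p * exp 1) ^ m * exp (- real m * ln (x $ a)))"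
      unfolding weight_power[OF r] using s by (intro mult_right_mono 1) auto
    also have "\<dots> \<le> (size_of p * exp 1) ^ m *
        (exp (real m * (fst p + 1) * snd p) * exp (17 * (real m)\<^sup>2 / 4))"
      using mult_left_mono[OF 2, of "(size_of p * exp 1) ^ m"] s by (simp add: mult_ac)
    finally show "envelope p x * weight p x ^ m \<le>
        size_of p ^ m * exp (real m * (fst p + 1) * snd p) * D"
      by (simp add: D_def power_mult_distrib mult_ac)
  qed (use \<epsilon> compact_imp_closed[OF compact_boxes(1)] box1_subset[OF p] region_subset_orthant[of p]
      size_of_ge_1[OF p] in \<open>auto simp: is_wave_def D_def\<close>)
  then show ?thesis
    using C by (intro exI[of _ "C * D"] conjI exI[of _ m]) (auto simp: D_def mult_ac)
qed

text \<open>Here the constants may depend on \<open>\<tau>\<close>. For \<open>x_a \<ge> 1\<close>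
  the powers of \<open>1 / x_a\<close> are harmless; on the rest of \<open>box2\<close> the point is
  at distance at least \<open>L - 1\<close> from the axis, and a Gaussian in \<open>L - 1\<close>
  beats the loss \<open>exp (m * (\<tau> + 3) * L)\<close>.\<close>

lemma error2_norm:
  assumes \<tau>: "0 \<le> \<tau>"
  shows "\<exists>C\<ge>0. \<exists>m. \<forall>L \<epsilon>. 1 \<le> L \<longrightarrow> is_wave error2 (box2 (\<tau>, L)) (\<tau>, L) \<epsilon> \<longrightarrow>
     test_norm N \<epsilon> \<le> C * (1 + L) ^ m"
proof -
  have g: "(\<lambda>p x. exp (phase p x) * error2 p x) \<in> waves"
    unfolding waves_def using amplitudes_error2 by (rule imageI)
  obtain C m where C: "C \<ge> 0" and le: "\<And>p \<phi> S B. closed S \<Longrightarrow> S \<subseteq> orthant \<inter> region p \<Longrightarrow>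
      (\<And>x. x \<in> orthant \<Longrightarrow> test_apply \<phi> x = exp (phase p x) * error2 p x) \<Longrightarrow>
      (\<And>x. x \<notin> S \<Longrightarrow> test_apply \<phi> x = 0) \<Longrightarrow>
      (\<And>x. x \<in> S \<Longrightarrow> envelope p x * weight p x ^ m \<le> B) \<Longrightarrow> 0 \<le> B \<Longrightarrow> test_norm N \<phi> \<le> C * B"
    by (rule partial_closed_test_norm[OF waves_partial_closed open_orthant g weight_ge_1 _ waves_bound,
          where N=N]) (auto simp: envelope_def)
  \<comment> \<open>The exponent lost to \<open>weight ^ m\<close> is at most \<open>u * L\<close>,
    and \<open>r\<close> bounds the denominator in \<open>envelope\<close>. Writing
    \<open>u * L = u + u * (L - 1)\<close> and completing the square yields
    \<open>K\<close>.\<close>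
  define u where "u = real m * (\<tau> + 3)"
  define r where "r = 1 + 16 * (\<tau> + 2)\<^sup>2"
  have u: "0 \<le> u" and r: "0 < r" using \<tau> by (auto simp: u_def r_def intro!: add_pos_nonneg)
  define K where "K = u + r * u\<^sup>2 / 4"
  have K: "0 \<le> K" using u r by (auto simp: K_def)
  define D where "D = ((1 + \<tau>) * exp 1) ^ m * exp K"
  have "test_norm N \<epsilon> \<le> C * ((1 + L) ^ m * D)"
    if L: "1 \<le> L" and \<epsilon>: "is_wave error2 (box2 (\<tau>, L)) (\<tau>, L) \<epsilon>" for L \<epsilon>
  proof -
    let ?p = "(\<tau>, L)"
    have p: "valid ?p" using \<tau> L by (simp add: valid_def)
    show ?thesis
    proof (rule le)
      fix x assume x: "x \<in> box2 ?p"
      then have reg: "x \<in> region ?p" using box2_subset[OF p] by blast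
      define t where "t = ln (x $ b)"
      define z where "z = offset ?p x"
      have t: "-1 \<le> t" "t \<le> \<tau> + 2" and xa: "- (\<tau> + 3) * L \<le> ln (x $ a)" "ln (x $ a) \<le> 1"
        using region_ln[OF reg, of b] region_ln[OF reg, of a] ab by (auto simp: t_def lo_def hi_def)
      have z: "z = ln (x $ a) - L * t + L * \<tau>" by (simp add: z_def t_def offset_def)
      have "envelope ?p x * exp (- real m * ln (x $ a)) \<le> exp K"
      proof (cases "0 \<le> ln (x $ a)")
        case True
        then have "exp (- real m * ln (x $ a)) \<le> 1" by simp
        then have "envelope ?p x * exp (- real m * ln (x $ a)) \<le> 1 * 1"
          by (intro mult_mono envelope_le_1) auto
        then show ?thesis using K one_le_exp_iff[of K] by linarith
      next
        case False
        \<comment> \<open>For \<open>t \<ge> \<tau> + 1\<close> the axis is at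
          \<open>ln x_a = L * (t - \<tau>) \<ge> L\<close>, far above the point. Otherwise the point
          lies in the lower cutoff zone of \<open>x_a\<close>, below
          \<open>- (\<tau> + 2) * L\<close>, while the axis is no lower than
          \<open>- (\<tau> + 1) * L\<close> because \<open>t \<ge> - 1\<close>.\<close>
        have "z \<le> 1 - L"
        proof (cases "\<tau> + 1 \<le> t")
          case True
          then have "L * (\<tau> + 1) \<le> L * t" using L by (intro mult_left_mono) auto
          then show ?thesis using xa z by (simp add: algebra_simps)
        next
          case False
          then have "ln (x $ a) \<le> - (\<tau> + 2) * L"
            using x \<open>\<not> 0 \<le> ln (x $ a)\<close> unfolding box2_def t_def
            by (auto dest: in_logboxD[where i=a] in_logboxD[where i=b])
          moreover have "L * (- 1) \<le> L * t" using L t by (intro mult_left_mono) auto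
          ultimately show ?thesis using z by (simp add: algebra_simps)
        qed
        then have "(L - 1)\<^sup>2 \<le> (- z)\<^sup>2" using L by (intro power_mono) auto
        moreover have "t\<^sup>2 \<le> (\<tau> + 2)\<^sup>2" using t \<tau> by (intro power2_le_iff_abs_le[THEN iffD2]) auto
        then have "1 + 16 * t\<^sup>2 \<le> r" by (simp add: r_def)
        ultimately have "(L - 1)\<^sup>2 / r \<le> z\<^sup>2 / (1 + 16 * t\<^sup>2)"
          by (intro frac_le) (auto intro!: add_pos_nonneg)
        moreover have "real m * (- ln (x $ a)) \<le> real m * ((\<tau> + 3) * L)"
          using xa by (intro mult_left_mono) (auto simp: algebra_simps)
        moreover have "u * (L - 1) - (L - 1)\<^sup>2 / r \<le> r * u\<^sup>2 / 4"
          by (rule complete_square[OF r])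
        ultimately have "- z\<^sup>2 / (1 + 16 * t\<^sup>2) + - real m * ln (x $ a) \<le> K"
          by (simp add: K_def u_def algebra_simps)
        then show ?thesis by (simp add: envelope_def z_def t_def flip: exp_add)
      qed
      then have "envelope ?p x * weight ?p x ^ m \<le> (size_of ?p * exp 1) ^ m * exp K"
        unfolding weight_power[OF reg]
        using mult_left_mono[of "envelope ?p x * exp (- real m * ln (x $ a))" "exp K"
            "(size_of ?p * exp 1) ^ m"] size_of_ge_1[OF p] by (simp add: mult_ac)
      then show "envelope ?p x * weight ?p x ^ m \<le> (1 + L) ^ m * D"
        by (simp add: D_def size_of_def power_mult_distrib mult_ac)
    qed (use \<epsilon> compact_imp_closed[OF compact_boxes(2)] box2_subset[OF p] region_subset_orthant[of ?p]
        L \<tau> in \<open>auto simp: is_wave_def D_def\<close>)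
  qed
  then show ?thesis
    using C \<tau> by (intro exI[of _ "C * D"] conjI exI[of _ m]) (auto simp: D_def mult_ac)
qed

section \<open>Failure of surjectivity\<close>


definition point :: "nat \<Rightarrow> real ^ 'n" where
  "point n = base a b (level n) + exp (- scale_at n) *\<^sub>R axis a 1"

lemma point_nth:
  "point n $ a = exp (- scale_at n)" "point n $ b = exp (real (level n))"
  "i \<noteq> a \<Longrightarrow> i \<noteq> b \<Longrightarrow> point n $ i = 1"
  using ab by (auto simp: point_def base_def axis_def)

lemma point_orthant: "point n \<in> orthant"
proof -
  have "0 < point n $ i" for i
    using point_nth(1,2)[of n] point_nth(3)[of i n] by (cases "i = a"; cases "i = b") auto
  then show ?thesis by (simp add: orthant_def)
qed

lemma norm_packet_le:
  assumes "x \<in> orthant"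
  shows "norm (packet p x) \<le> inverse (x $ a) * inverse (x $ b)"
proof -
  have 1: "norm (cut_a 0 0 p x) \<le> 1" "norm (cut_b 0 0 p x) \<le> 1"
    by (simp_all add: cut_a_def cut_b_def norm_mult step_ge step_le mult_le_one)
  have "norm (cut_rest x) \<le> 1"
    unfolding cut_rest_def prod_norm[symmetric]
    by (intro prod_le_1) (simp add: norm_mult step_ge step_le mult_le_one)
  with 1 have "norm (cut_a 0 0 p x * (cut_b 0 0 p x * cut_rest x)) \<le> 1"
    by (simp add: norm_mult mult_le_one)
  then have "norm (packet p x) \<le> 1 * norm (jacobian x)"
    unfolding packet_def norm_mult[of _ "jacobian x"] by (intro mult_right_mono) auto
  also have "norm (jacobian x) = inverse (x $ a) * inverse (x $ b)"
    using assms by (simp add: jacobian_def norm_mult norm_inverse orthant_def abs_of_pos)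
  finally show ?thesis by simp
qed

text \<open>The base point has \<open>x_a = 0\<close>, so the packet vanishes there with all
  derivatives; the Taylor polynomial drops out and the remainder is a plain point value.\<close>

lemma comb_term_packet:
  assumes p: "valid p" and \<phi>: "is_wave packet (region p) p \<phi>"
  shows "comb_term a b n \<phi> =
    of_real (exp (real (order_at n) * scale_at n)) * test_apply \<phi> (point n)"
proof -
  have c: "closed (region p)" by (simp add: region_eq[OF p] closed_logbox)
  have "base a b (level n) \<notin> orthant" by (auto simp: base_def orthant_def intro!: exI[of _ a])
  then have "base a b (level n) \<notin> region p" using region_subset_orthant by blast
  then have "partials w (test_apply \<phi>) (base a b (level n)) = 0" for w
    by (intro partials_vanish[OF c]) (use \<phi> in \<open>auto simp: is_wave_def\<close>)
  then show ?thesis by (simp add: comb_term_def taylor_rem_def point_def)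
qed

lemma norm_packet_wave:
  assumes p: "valid p" and \<phi>: "is_wave packet (region p) p \<phi>"
  shows "norm (test_apply \<phi> (point n)) \<le> exp (scale_at n)"
proof -
  have "norm (test_apply \<phi> (point n)) = norm (exp (phase p (point n))) * norm (packet p (point n))"
    using \<phi> point_orthant[of n] by (simp add: is_wave_def norm_mult)
  also have "\<dots> \<le> 1 * (inverse (point n $ a) * inverse (point n $ b))"
    using order_trans[OF norm_exp_phase_le envelope_le_1] norm_packet_le[OF point_orthant]
    by (intro mult_mono) auto
  also have "\<dots> = exp (scale_at n) * exp (- real (level n))"
    by (simp add: point_nth exp_minus)
  also have "\<dots> \<le> exp (scale_at n)" by simp
  finally show ?thesis .
qed

text \<open>The beam with \<open>\<tau> = level n + 1\<close> and \<open>L = scale_at n\<close> is centred at \<open>point n\<close>.\<close>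

lemma packet_wave_centre:
  assumes \<tau>: "\<tau> = real (level n) + 1" and \<phi>: "is_wave packet (region p) p \<phi>" and p: "p = (\<tau>, scale_at n)"
  shows "norm (test_apply \<phi> (point n)) =
    exp (- ln (cmod (1 + 4 * \<i> * of_real (real (level n)))) / 2) * exp (- real (level n)) * exp (scale_at n)"
proof -
  have L: "1 \<le> scale_at n" by (rule scale_at_ge)
  have 1: "cut_a 0 0 p (point n) = 1"
    using L \<tau> by (simp add: cut_a_def point_nth p step1)
  have 2: "cut_b 0 0 p (point n) = 1"
    using \<tau> by (simp add: cut_b_def point_nth p step1)
  have "cut_rest (point n) = 1"
    unfolding cut_rest_def by (rule prod.neutral) (auto simp: point_nth step1)
  with 1 2 have "packet p (point n) = jacobian (point n)" by (simp add: packet_def)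
  moreover have "norm (jacobian (point n)) = exp (- real (level n)) * exp (scale_at n)"
    by (simp add: jacobian_def point_nth norm_mult norm_inverse exp_minus)
  moreover have "offset p (point n) = 0"
    using \<tau> by (simp add: offset_def point_nth p algebra_simps)
  then have "norm (exp (phase p (point n))) = exp (- ln (cmod (1 + 4 * \<i> * of_real (real (level n)))) / 2)"
    unfolding norm_exp_phase by (simp add: envelope_def point_nth)
  moreover have "norm (test_apply \<phi> (point n)) = norm (exp (phase p (point n))) * norm (packet p (point n))"
    using \<phi> point_orthant[of n] by (simp add: is_wave_def norm_mult)
  ultimately show ?thesis by (simp add: mult_ac)
qed

lemma point_outside_region:
  assumes "valid p" "fst p + 2 < real (level n) \<or> (fst p + 3) * snd p < scale_at n"
  shows "point n \<notin> region p"
proof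
  assume r: "point n \<in> region p"
  have "lo p a \<le> - scale_at n" "real (level n) \<le> hi p b"
    using region_ln[OF r, of a] region_ln[OF r, of b] by (simp_all add: point_nth)
  then show False using assms(2) by (simp add: lo_def hi_def algebra_simps)
qed

lemma scale_at_mult: "m < n \<Longrightarrow> real n * scale_at m \<le> scale_at n"
proof -
  assume "m < n"
  then obtain k where k: "n = Suc k" "m \<le> k" by (cases n) auto
  then have "scale_at m \<le> scale_at k" by (simp add: scale_at_def fact_mono)
  then have "real n * scale_at m \<le> real n * scale_at k" by (intro mult_left_mono) auto
  also have "\<dots> = scale_at n" by (simp add: k scale_at_def)
  finally show ?thesis .
qed

text \<open>Term \<open>n\<close> dominates the sum. Later points lie below the box in
  \<open>x_a\<close>. Earlier ones either lie beyond the box in \<open>x_b\<close> or have order at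
  most \<open>(j + 5)^2\<close>, less than \<open>n\<close>, so that the growth of the scales bounds
  each term by \<open>exp (scale_at n)\<close>; their number \<open>n\<close> is at most
  \<open>scale_at n\<close>.\<close>

lemma comb_lower_bound:
  assumes T: "\<And>\<phi>. dist_apply T \<phi> = suminf (\<lambda>n. comb_term a b n \<phi>)"
    and j: "level n = j" and \<phi>: "is_wave packet (region p) p \<phi>" and p: "p = (real j + 1, scale_at n)"
    and n: "(j + 5)\<^sup>2 + 1 \<le> n"
  shows "exp (- ln (cmod (1 + 4 * \<i> * of_real (real j))) / 2) * exp (- real j) * exp (scale_at n)
      * exp (real ((j + 2)\<^sup>2) * scale_at n) \<le> norm (dist_apply T \<phi>) + scale_at n * exp (scale_at n)"
proof -
  let ?L = "scale_at n"
  have v: "valid p" using scale_at_ge(2)[of n] by (simp add: valid_def p)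
  note ct = comb_term_packet[OF v \<phi>]
  have out: "comb_term a b m \<phi> = 0" if "point m \<notin> region p" for m
    using ct[of m] \<phi> that by (simp add: is_wave_def)
  have "j + 5 \<le> (j + 5)\<^sup>2" by (simp add: power2_eq_square)
  then have nj: "j + 5 < n" using n by linarith
  have zero: "comb_term a b m \<phi> = 0" if "n < m" for m
  proof (rule out, rule point_outside_region[OF v])
    have "real m * ?L \<le> scale_at m" by (rule scale_at_mult[OF that])
    moreover have "(real j + 1 + 3) * ?L < real m * ?L"
      using that nj scale_at_ge(2)[of n] by (intro mult_strict_right_mono) auto
    ultimately show "fst p + 2 < real (level m) \<or> (fst p + 3) * snd p < scale_at m"
      by (simp add: p)
  qed
  have small: "norm (comb_term a b m \<phi>) \<le> exp ?L" if "m < n" for m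
  proof (cases "real (level m) \<le> fst p + 2")
    case False
    then show ?thesis using out[OF point_outside_region[OF v, of m]] by simp
  next
    case True
    then have "level m + 2 \<le> j + 5" by (simp add: p)
    then have "order_at m \<le> (j + 5)\<^sup>2" unfolding order_at_def by (intro power_mono) auto
    \<comment> \<open>The additional 1 pays for the factor \<open>exp (scale_at m)\<close> in the
      bound on the packet at \<open>point m\<close>.\<close>
    then have "real (order_at m) + 1 \<le> real n" using n by linarith
    then have "(real (order_at m) + 1) * scale_at m \<le> real n * scale_at m"
      using scale_at_ge(2)[of m] by (intro mult_right_mono) auto
    also have "\<dots> \<le> ?L" by (rule scale_at_mult[OF that])
    finally have le: "real (order_at m) * scale_at m + scale_at m \<le> ?L" by (simp add: algebra_simps)
    have "norm (comb_term a b m \<phi>) \<le> exp (real (order_at m) * scale_at m) * exp (scale_at m)"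
      unfolding ct norm_mult using norm_packet_wave[OF v \<phi>, of m] by (intro mult_mono) auto
    also have "\<dots> \<le> exp ?L" using le by (simp flip: exp_add)
    finally show ?thesis .
  qed
  have "dist_apply T \<phi> = (\<Sum>m<Suc n. comb_term a b m \<phi>)"
    unfolding T by (rule suminf_finite) (use zero in auto)
  then have "comb_term a b n \<phi> = dist_apply T \<phi> - (\<Sum>m<n. comb_term a b m \<phi>)" by simp
  then have "norm (comb_term a b n \<phi>) \<le> norm (dist_apply T \<phi>) + norm (\<Sum>m<n. comb_term a b m \<phi>)"
    by (simp add: norm_triangle_ineq4)
  also have "norm (\<Sum>m<n. comb_term a b m \<phi>) \<le> real n * exp ?L"
    using sum_norm_bound[of "{..<n}" "\<lambda>m. comb_term a b m \<phi>" "exp ?L"] small by simp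
  also have "\<dots> \<le> ?L * exp ?L" using scale_at_ge(1)[of n] by (intro mult_right_mono) auto
  finally have "norm (comb_term a b n \<phi>) \<le> norm (dist_apply T \<phi>) + ?L * exp ?L" by simp
  then show ?thesis
    using packet_wave_centre[of "real j + 1" n p \<phi>] \<phi> p j
    by (simp add: ct norm_mult order_at_def mult_ac)
qed

section \<open>Contradiction with the finite order of a solution on compact sets\<close>

definition slab :: "real \<Rightarrow> (real ^ 'n) set" where
  "slab t = cbox (vec_lambda (\<lambda>i. if i = a then 0 else exp (- 1)))
     (vec_lambda (\<lambda>i. if i = b then exp t else exp 1))"

lemma compact_slab: "compact (slab t)"
  unfolding slab_def by (rule compact_cbox)

lemma region_in_slab:
  assumes "x \<in> region p" "ln (x $ b) \<le> t"
  shows "x \<in> slab t"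
  unfolding slab_def mem_box_cart
proof
  fix i
  have pos: "0 < x $ i" by (rule region_orthant[OF assms(1)])
  have e: "u \<le> ln (x $ i) \<longleftrightarrow> exp u \<le> x $ i" "ln (x $ i) \<le> u \<longleftrightarrow> x $ i \<le> exp u" for u
    using pos by (metis exp_le_cancel_iff exp_ln)+
  show "vec_lambda (\<lambda>i. if i = a then 0 else exp (- 1)) $ i \<le> x $ i \<and>
      x $ i \<le> vec_lambda (\<lambda>i. if i = b then exp t else exp 1) $ i"
    using region_ln[OF assms(1), of i] assms(2) pos e ab by (auto simp: lo_def hi_def)
qed

text \<open>One compact set serves for all valid \<open>p\<close>. It includes the face
  \<open>x_a = 0\<close>, which the boxes approach as \<open>snd p\<close> grows.\<close>

lemma box1_in_slab: "valid p \<Longrightarrow> box1 p \<subseteq> slab 0"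
  using box1_subset region_in_slab in_logboxD[of _ "lo p" "(hi p)(b := 0)" b]
  by (fastforce simp: box1_def)

lemma box2_in_slab: "valid p \<Longrightarrow> box2 p \<subseteq> slab (fst p + 2)"
  using box2_subset region_in_slab region_ln(2)[of _ p b] by (fastforce simp: hi_def)

text \<open>One surplus power of \<open>1 + L\<close> is bounded by \<open>power_exp_le_fact\<close>
  and then divided out.\<close>

lemma polynomial_lt_exp:
  fixes c D :: real
  assumes "0 < c" "0 \<le> D"
  shows "\<exists>L0. \<forall>L\<ge>L0. D * (1 + L) ^ \<mu> < c * exp L"
proof -
  define E where "E = D * fact (Suc \<mu>) * exp 1"
  have "D * (1 + L) ^ \<mu> < c * exp L" if L: "E / c + 1 \<le> L" for L
  proof -
    have "0 \<le> E / c" using assms by (simp add: E_def)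
    then have pos: "0 < 1 + L" using L by linarith
    have "(1 + L) ^ Suc \<mu> \<le> fact (Suc \<mu>) * exp (1 + L)"
      using mult_right_mono[OF power_exp_le_fact[of "1 + L" "Suc \<mu>"], of "exp (1 + L)"] pos
      by (simp add: mult.assoc mult_exp_exp del: power_Suc)
    then have "D * ((1 + L) ^ Suc \<mu>) \<le> D * (fact (Suc \<mu>) * exp (1 + L))"
      using assms by (intro mult_left_mono)
    also have "\<dots> = E * exp L" by (simp add: E_def exp_add)
    also have "\<dots> < (c * (1 + L)) * exp L"
      using L assms by (intro mult_strict_right_mono) (auto simp: field_simps)
    finally have "(D * (1 + L) ^ \<mu>) * (1 + L) < (c * exp L) * (1 + L)" by (simp add: mult_ac)
    then show ?thesis using pos by (simp add: mult_less_cancel_right)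
  qed
  then show ?thesis by blast
qed

lemma schroedinger_not_surj: "\<not> surj (euler_operator (schroedinger_poly a b))"
proof
  assume "surj (euler_operator (schroedinger_poly a b))"
  moreover obtain T where T: "\<And>\<phi>. dist_apply T \<phi> = suminf (\<lambda>n. comb_term a b n \<phi>)"
    using comb_exists[OF ab] by blast
  ultimately obtain u where u: "euler_operator (schroedinger_poly a b) u = T" by (metis surjD)
  have Tu: "dist_apply T \<phi> = dist_apply u (transposed \<phi>)" for \<phi>
    unfolding u[symmetric] transposed_def by (rule dist_apply_schroedinger)
  \<comment> \<open>The order \<open>N\<close> of \<open>u\<close> on \<open>slab 0\<close>, and
    with it the exponent \<open>m\<close>, is fixed before \<open>\<tau>\<close>.\<close>
  obtain C1 N where C1: "C1 \<ge> 0"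
    and u1: "\<And>\<phi>. test_supported_in (slab 0) \<phi> \<Longrightarrow> norm (dist_apply u \<phi>) \<le> C1 * test_norm N \<phi>"
    using distribution_continuousD[OF dist_apply_continuous compact_slab] by blast
  obtain C2 m where C2: "C2 \<ge> 0" and e1: "\<And>p \<epsilon>. valid p \<Longrightarrow> is_wave error1 (box1 p) p \<epsilon> \<Longrightarrow>
     test_norm N \<epsilon> \<le> C2 * (size_of p ^ m * exp (real m * (fst p + 1) * snd p))"
    using error1_norm[of N] by blast
  \<comment> \<open>With this level, \<open>m * (\<tau> + 1) = j * (j + 2) \<le> (j + 2)^2\<close>:
    the first error grows no faster than the prefactor of the distribution at level
    \<open>j\<close>.\<close>
  define j where "j = m"
  define \<tau> where "\<tau> = real j + 1"
  have \<tau>: "0 \<le> \<tau>" by (simp add: \<tau>_def)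
  \<comment> \<open>The order \<open>M\<close> on the larger slab depends on \<open>\<tau>\<close>.
    This does no harm, as every norm of the second error grows only polynomially in
    \<open>L\<close>.\<close>
  obtain C3 M where C3: "C3 \<ge> 0"
    and u2: "\<And>\<phi>. test_supported_in (slab (\<tau> + 2)) \<phi> \<Longrightarrow> norm (dist_apply u \<phi>) \<le> C3 * test_norm M \<phi>"
    using distribution_continuousD[OF dist_apply_continuous compact_slab] by blast
  obtain C4 m2 where C4: "C4 \<ge> 0" and e2: "\<And>L \<epsilon>. 1 \<le> L \<Longrightarrow> is_wave error2 (box2 (\<tau>, L)) (\<tau>, L) \<epsilon> \<Longrightarrow>
     test_norm M \<epsilon> \<le> C4 * (1 + L) ^ m2"
    using error2_norm[OF \<tau>, of M] by blast
  define k where "k = (j + 2)\<^sup>2"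
  \<comment> \<open>This power dominates the powers \<open>m\<close> and \<open>m2\<close> of the
    two errors and the factor \<open>L\<close> in the remainder \<open>L * exp L\<close>.\<close>
  define \<mu> where "\<mu> = m + m2 + 1"
  define A where "A = C1 * C2 * (1 + \<tau>) ^ m"
  define B where "B = C3 * C4"
  define c where "c = exp (- ln (cmod (1 + 4 * \<i> * of_real (real j))) / 2) * exp (- real j)"
  have AB: "0 \<le> A" "0 \<le> B" using C1 C2 C3 C4 \<tau> by (auto simp: A_def B_def)
  obtain L0 where L0: "\<And>L. L0 \<le> L \<Longrightarrow> (1 + A + B) * (1 + L) ^ \<mu> < c * exp L"
    using polynomial_lt_exp[of c "1 + A + B" \<mu>] AB by (auto simp: c_def)
  \<comment> \<open>The second component of the pair is free, so \<open>n\<close> can be made large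
    within level \<open>j\<close>.\<close>
  obtain i :: nat where i: "L0 \<le> real i" "(j + 5)\<^sup>2 + 1 \<le> i"
    by (meson max.bounded_iff real_arch_simple of_nat_le_iff order_trans le_cases)
  define n where "n = prod_encode (j, i)"
  have level: "level n = j" and ni: "i \<le> n"
    by (simp_all add: n_def level_def le_prod_encode_2)
  define L where "L = scale_at n"
  have L: "1 \<le> L" "L0 \<le> L" using scale_at_ge[of n] i(1) ni by (auto simp: L_def)
  define p where "p = (\<tau>, L)"
  have p: "valid p" using \<tau> L by (simp add: p_def valid_def)
  obtain \<phi> \<epsilon>1 \<epsilon>2 where \<phi>: "is_wave packet (region p) p \<phi>" and \<epsilon>1: "is_wave error1 (box1 p) p \<epsilon>1"
    and \<epsilon>2: "is_wave error2 (box2 p) p \<epsilon>2" and sum: "transposed \<phi> = \<epsilon>1 + \<epsilon>2"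
    using packet_exists[OF p] by blast
  have s1: "test_supported_in (slab 0) \<epsilon>1"
    unfolding test_supported_in_iff[OF compact_imp_closed[OF compact_slab]]
    using \<epsilon>1 box1_in_slab[OF p] by (auto simp: is_wave_def)
  have s2: "test_supported_in (slab (\<tau> + 2)) \<epsilon>2"
    unfolding test_supported_in_iff[OF compact_imp_closed[OF compact_slab]]
    using \<epsilon>2 box2_in_slab[OF p] by (auto simp: is_wave_def p_def)
  have pw: "1 \<le> (1 + L) ^ q" for q using L by simp
  have mono: "(1 + L) ^ q \<le> (1 + L) ^ \<mu>" if "q \<le> \<mu>" for q
    using that L by (intro power_increasing) auto
  have "real m * (\<tau> + 1) \<le> real k"
    by (simp add: \<tau>_def k_def j_def power2_eq_square algebra_simps)
  then have "exp (real m * (\<tau> + 1) * L) \<le> exp (real k * L)" using L by simp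
  moreover have "L \<le> real k * L" using L by (simp add: k_def)
  ultimately have ek: "exp (real m * (\<tau> + 1) * L) \<le> exp (real k * L)" "exp L \<le> exp (real k * L)"
    "1 \<le> exp (real k * L)" using L by auto
  have "norm (dist_apply u \<epsilon>1) \<le> C1 * (C2 * (size_of p ^ m * exp (real m * (fst p + 1) * snd p)))"
    using u1[OF s1] mult_left_mono[OF e1[OF p \<epsilon>1] C1] by linarith
  also have "\<dots> = A * ((1 + L) ^ m * exp (real m * (\<tau> + 1) * L))"
    by (simp add: A_def p_def size_of_def power_mult_distrib mult_ac)
  also have "\<dots> \<le> A * ((1 + L) ^ \<mu> * exp (real k * L))"
    using AB L by (intro mult_left_mono mult_mono mono ek) (auto simp: \<mu>_def)
  finally have 1: "norm (dist_apply u \<epsilon>1) \<le> A * ((1 + L) ^ \<mu> * exp (real k * L))" .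
  have "norm (dist_apply u \<epsilon>2) \<le> C3 * (C4 * (1 + L) ^ m2)"
    using u2[OF s2] mult_left_mono[OF e2[OF L(1) \<epsilon>2[unfolded p_def]] C3] by linarith
  also have "\<dots> = B * ((1 + L) ^ m2 * 1)" by (simp add: B_def)
  also have "\<dots> \<le> B * ((1 + L) ^ \<mu> * exp (real k * L))"
    using AB L by (intro mult_left_mono mult_mono mono ek) (auto simp: \<mu>_def)
  finally have 2: "norm (dist_apply u \<epsilon>2) \<le> B * ((1 + L) ^ \<mu> * exp (real k * L))" .
  have "L \<le> (1 + L) ^ 1" by simp
  also have "\<dots> \<le> (1 + L) ^ \<mu>" by (rule mono) (simp add: \<mu>_def)
  finally have 3: "L * exp L \<le> (1 + L) ^ \<mu> * exp (real k * L)"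
    using L ek by (intro mult_mono) auto
  \<comment> \<open>The surplus factor \<open>exp L\<close> on the left is the value of
    \<open>1 / x_a\<close> at the centre of the beam. After cancelling
    \<open>exp (real k * L)\<close> only a polynomial in \<open>L\<close> stands against it.\<close>
  have "c * exp L * exp (real k * L) \<le> norm (dist_apply T \<phi>) + L * exp L"
    using comb_lower_bound[OF T level \<phi>] i(2) ni
    by (simp add: p_def \<tau>_def L_def c_def k_def)
  also have "norm (dist_apply T \<phi>) \<le> norm (dist_apply u \<epsilon>1) + norm (dist_apply u \<epsilon>2)"
    unfolding Tu sum dist_apply_add by (rule norm_triangle_ineq)
  finally have "c * exp L * exp (real k * L) \<le> ((1 + A + B) * (1 + L) ^ \<mu>) * exp (real k * L)"
    using 1 2 3 by (simp add: algebra_simps)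
  then have "c * exp L \<le> (1 + A + B) * (1 + L) ^ \<mu>" by simp
  with L0[OF L(2)] show False by simp
qed

end

theorem theorem2:
  assumes "CARD('n::finite) \<ge> 3"
  shows "\<exists>P :: ('n \<Rightarrow>\<^sub>0 nat) \<Rightarrow>\<^sub>0 complex. P \<noteq> 0 \<and> \<not> surj (euler_operator P)"
proof -
  have "\<not> is_singleton (UNIV :: 'n set)"
    using assms by (auto simp: is_singleton_altdef)
  then obtain a b :: 'n where ab: "a \<noteq> b"
    by (metis UNIV_I is_singletonI' UNIV_not_empty)
  obtain \<sigma> :: "nat \<Rightarrow> real \<Rightarrow> real" where "beam a b \<sigma>"
    using smooth_step_exists ab unfolding beam_def by metis
  then have "\<not> surj (euler_operator (schroedinger_poly a b))"
    by (rule beam.schroedinger_not_surj)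
  moreover have "schroedinger_poly a b \<noteq> 0"
    using keys_schroedinger_poly[of a b] by auto
  ultimately show ?thesis by blast
qed

end
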